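(* For every nonnegative integer $n$, there exists an RDSQS$(3\times 7^{n}+1)$ and there exists an RDSQS$(3\times 13^{n}+1)$.
   Context: A Steiner quadruple system SQS$(v)$ is a pair $(X,\mathcal{B})$ where $X$ is a set of $v$ points and $\mathcal{B}$ is a collection of $4$-element subsets of $X$ (blocks) such that every $3$-element subset of $X$ is contained in exactly one block. For $x\in X$, the derived design at $x$ is the pair $(X\setminus\{x\},\mathcal{B}_x)$ with $\mathcal{B}_x=\{B\setminus\{x\}: x\in B,\ B\in\mathcal{B}\}$; it is a Steiner triple system on $v-1$ points (every pair of distinct points lies in exactly one of its triples). A collection of blocks on a point set $Y$ is resolvable if it can be partitioned into parallel classes, a parallel class being a set of blocks that partitions $Y$. An RDSQS$(v)$ is an SQS$(v)$ whose derived design at every point is resolvable (i.e. is a Kirkman triple system on $v-1$ points). *)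

theory Defs
  imports Main "HOL-Library.Disjoint_Sets"
begin

definition steiner_quadruple_system :: "nat \<Rightarrow> 'a set \<Rightarrow> 'a set set \<Rightarrow> bool" where
  "steiner_quadruple_system v X \<B> \<longleftrightarrow>
     finite X \<and> card X = v \<and>
     (\<forall>B\<in>\<B>. B \<subseteq> X \<and> card B = 4) \<and>
     (\<forall>T. T \<subseteq> X \<and> card T = 3 \<longrightarrow> (\<exists>!B. B \<in> \<B> \<and> T \<subseteq> B))"

definition derived_blocks :: "'a set set \<Rightarrow> 'a \<Rightarrow> 'a set set" where
  "derived_blocks \<B> x = {B - {x} | B. B \<in> \<B> \<and> x \<in> B}"

definition parallel_class :: "'a set \<Rightarrow> 'a set set \<Rightarrow> 'a set set \<Rightarrow> bool" where
  "parallel_class Y \<A> C \<longleftrightarrow> C \<subseteq> \<A> \<and> partition_on Y C"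

definition resolvable :: "'a set \<Rightarrow> 'a set set \<Rightarrow> bool" where
  "resolvable Y \<A> \<longleftrightarrow> (\<exists>\<R>. partition_on \<A> \<R> \<and> (\<forall>C\<in>\<R>. parallel_class Y \<A> C))"

definition RDSQS :: "nat \<Rightarrow> 'a set \<Rightarrow> 'a set set \<Rightarrow> bool" where
  "RDSQS v X \<B> \<longleftrightarrow>
     steiner_quadruple_system v X \<B> \<and>
     (\<forall>x\<in>X. resolvable (X - {x}) (derived_blocks \<B> x))"

end

theory Submission
  imports Defs "HOL-Algebra.Algebraic_Closure_Type" "Berlekamp_Zassenhaus.Finite_Field"
begin

text \<open>
  Let q be 7 or 13, let n > 0, and let F be the field with q^n elements.  The circles of F over its prime field
  (the images of the projective line over the prime field under the Moebius maps of F) are the blocks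
  of a Steiner system S(3, q+1, q^n+1) on F and a point \<omega> at infinity.  Moebius maps carry any point
  to \<omega>, and the circles through \<omega> are the affine lines of F; so every derived design is an affine
  space over the prime field, and is resolvable because lines fall into directions.

  Replace every point other than \<omega> by three copies of it, its fibre.  A circle through \<omega> then becomes a set
  of 3q+1 points, on which a copy of one fixed RDSQS(3q+1) is put in such a way that \<omega> together with any fibre
  is a block.  Any other circle becomes a set of 3(q+1) points in q+1 fibres, on which a copy of a design is put
  whose quadruples meet each fibre at most once and cover each such triple of points exactly once.  These pieces
  fit together to an SQS(3q^n+1): a triple from three fibres lies over one circle, and every
  other triple lies over the circles through \<omega> only.

  Over a circle not through \<omega> the derived design at a point p splits into k = 3(q-1)/2 parallel classes.  Over a
  circle through \<omega> there is one more class, the one with the triple that completes a fibre; for p = \<omega> it is arranged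
  to consist of fibres only.  For each direction of circles through the point under p and each i < k, the i-th classes
  over the circles of that direction make one parallel class of the derived design at p, and
  the additional classes over the circles through \<omega> make the last one.  This is what the locale tripling proves.

  What remains is finite: for q = 7 and q = 13, an RDSQS(3q+1) and a design with q+1 fibres and
  resolvable derived designs.  (For n = 0 a single block does.)
  All four have a group of automorphisms that is regular on the points, except for one fixed point
  in the two quadruple systems.  It is therefore enough to list the blocks through one point of each orbit,
  sorted into parallel classes, and to check that these triples form a resolvable design and that they
  are closed under moving another point of a block into the base point.  The fields with q^n elements
  are found as the fixed points of the n-th power of the Frobenius map in an algebraic closure.
\<close>

(* X denotes point sets below, not the variable of a polynomial ring. *)
no_notation Polynomials.var (\<open>X\<index>\<close>)

section \<open>Designs with groups and their resolvable derived designs\<close>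

text \<open>
  The groups are the classes of equal value of \<open>g\<close>, and only sets that meet each group at most once are
  concerned.  With an injective \<open>g\<close> this is a Steiner quadruple system; with groups of equal size it is
  known as an H-design.
\<close>

definition quad_design :: "'a set \<Rightarrow> ('a \<Rightarrow> 'g) \<Rightarrow> 'a set set \<Rightarrow> bool" where
  "quad_design X g \<B> \<longleftrightarrow> finite X \<and> (\<forall>B\<in>\<B>. B \<subseteq> X \<and> card B = 4 \<and> inj_on g B) \<and>
     (\<forall>T. T \<subseteq> X \<and> card T = 3 \<and> inj_on g T \<longrightarrow> (\<exists>!B. B \<in> \<B> \<and> T \<subseteq> B))"

text \<open>
  A resolvable group divisible design with blocks of size three.  The resolution is recorded as a
  colouring of the blocks with colours below \<open>k\<close>, so that designs on different point sets can be
  combined colour by colour.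
\<close>

definition rgdd :: "nat \<Rightarrow> 'a set \<Rightarrow> ('a \<Rightarrow> 'g) \<Rightarrow> ('a set \<Rightarrow> nat) \<Rightarrow> 'a set set \<Rightarrow> bool" where
  "rgdd k Y g c \<T> \<longleftrightarrow>
     (\<forall>T\<in>\<T>. T \<subseteq> Y \<and> card T = 3 \<and> inj_on g T \<and> c T < k) \<and>
     (\<forall>x\<in>Y. \<forall>y\<in>Y. g x \<noteq> g y \<longrightarrow> (\<exists>!T. T \<in> \<T> \<and> x \<in> T \<and> y \<in> T)) \<and>
     (\<forall>i<k. \<forall>x\<in>Y. \<exists>!T. T \<in> \<T> \<and> c T = i \<and> x \<in> T)"

lemma rgdd_block:
  assumes "rgdd k Y g c \<T>" "T \<in> \<T>"
  shows "T \<subseteq> Y" "card T = 3" "inj_on g T" "c T < k"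
  using assms by (auto simp: rgdd_def)

lemma rgdd_pair:
  assumes "rgdd k Y g c \<T>" "x \<in> Y" "y \<in> Y" "g x \<noteq> g y"
  shows "\<exists>!T. T \<in> \<T> \<and> x \<in> T \<and> y \<in> T"
  using assms by (auto simp: rgdd_def)

lemma rgdd_class:
  assumes "rgdd k Y g c \<T>" "i < k" "x \<in> Y"
  shows "\<exists>!T. T \<in> \<T> \<and> c T = i \<and> x \<in> T"
  using assms by (auto simp: rgdd_def)

lemma ex1_obtain:
  assumes "\<exists>!x. P x" obtains x where "P x" "\<And>y. P y \<Longrightarrow> y = x"
  using assms by (elim ex1E) blast

lemma ex1_image_iff:
  assumes "inj_on f \<T>" "\<And>T. T \<in> \<T> \<Longrightarrow> P (f T) \<longleftrightarrow> Q T"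
  shows "(\<exists>!S. S \<in> f ` \<T> \<and> P S) \<longleftrightarrow> (\<exists>!T. T \<in> \<T> \<and> Q T)"
  using assms unfolding inj_on_def by (smt (verit) imageE imageI)

lemma rgdd_transport:
  assumes r: "rgdd k Y g c \<T>" and inj: "inj_on \<phi> Y"
    and g: "\<And>x y. x \<in> Y \<Longrightarrow> y \<in> Y \<Longrightarrow> g' (\<phi> x) = g' (\<phi> y) \<longleftrightarrow> g x = g y"
  shows "rgdd k (\<phi> ` Y) g' (\<lambda>S. c (the_inv_into Y \<phi> ` S)) (image \<phi> ` \<T>)"
proof -
  have inv: "the_inv_into Y \<phi> ` \<phi> ` T = T" if "T \<in> \<T>" for T
  proof -
    have "T \<subseteq> Y" using rgdd_block(1)[OF r that] .
    then show ?thesis by (force simp: image_image the_inv_into_f_f[OF inj])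
  qed
  have injT: "inj_on (image \<phi>) \<T>"
    by (rule inj_on_inverseI[where g = "image (the_inv_into Y \<phi>)"]) (rule inv)
  have mem: "\<phi> x \<in> \<phi> ` T \<longleftrightarrow> x \<in> T" if "T \<in> \<T>" "x \<in> Y" for x T
    using rgdd_block(1)[OF r that(1)] that(2) inj by (auto simp: inj_on_def)
  show ?thesis unfolding rgdd_def
  proof (intro conjI ballI impI allI)
    fix S assume "S \<in> image \<phi> ` \<T>"
    then obtain T where T: "T \<in> \<T>" "S = \<phi> ` T" by auto
    note b = rgdd_block[OF r T(1)]
    show "S \<subseteq> \<phi> ` Y" using T b(1) by auto
    show "card S = 3" using T b(2) inj_on_subset[OF inj b(1)] by (simp add: card_image)
    show "inj_on g' S" using b(1,3) g unfolding T(2) inj_on_def by blast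
    show "c (the_inv_into Y \<phi> ` S) < k" using b(4) inv[OF T(1)] T(2) by simp
  next
    fix u v assume "u \<in> \<phi> ` Y" "v \<in> \<phi> ` Y" "g' u \<noteq> g' v"
    then obtain x y where xy: "x \<in> Y" "y \<in> Y" "u = \<phi> x" "v = \<phi> y" "g x \<noteq> g y" using g by blast
    have "(\<exists>!S. S \<in> image \<phi> ` \<T> \<and> (\<phi> x \<in> S \<and> \<phi> y \<in> S)) \<longleftrightarrow> (\<exists>!T. T \<in> \<T> \<and> (x \<in> T \<and> y \<in> T))"
      by (rule ex1_image_iff[OF injT]) (use mem xy in auto)
    then show "\<exists>!T. T \<in> image \<phi> ` \<T> \<and> u \<in> T \<and> v \<in> T" using rgdd_pair[OF r xy(1,2,5)] xy by simp
  next
    fix i u assume i: "i < k" and "u \<in> \<phi> ` Y"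
    then obtain x where x: "x \<in> Y" "u = \<phi> x" by auto
    have "(\<exists>!S. S \<in> image \<phi> ` \<T> \<and> (c (the_inv_into Y \<phi> ` S) = i \<and> \<phi> x \<in> S)) \<longleftrightarrow> (\<exists>!T. T \<in> \<T> \<and> (c T = i \<and> x \<in> T))"
      by (rule ex1_image_iff[OF injT]) (use mem x inv in auto)
    then show "\<exists>!S. S \<in> image \<phi> ` \<T> \<and> c (the_inv_into Y \<phi> ` S) = i \<and> u \<in> S" using rgdd_class[OF r i x(1)] x(2) by simp
  qed
qed

lemma quad_design_transport:
  assumes q: "quad_design X g \<B>" and inj: "inj_on \<phi> X"
    and g: "\<And>x y. x \<in> X \<Longrightarrow> y \<in> X \<Longrightarrow> g' (\<phi> x) = g' (\<phi> y) \<longleftrightarrow> g x = g y"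
  shows "quad_design (\<phi> ` X) g' (image \<phi> ` \<B>)"
    and "x \<in> X \<Longrightarrow> derived_blocks (image \<phi> ` \<B>) (\<phi> x) = image \<phi> ` derived_blocks \<B> x"
proof -
  have sub: "B \<subseteq> X" if "B \<in> \<B>" for B using q that by (auto simp: quad_design_def)
  have injB: "inj_on (image \<phi>) \<B>"
    by (rule inj_onI) (simp add: inj_on_image_eq_iff[OF inj sub sub])
  show "quad_design (\<phi> ` X) g' (image \<phi> ` \<B>)" unfolding quad_design_def
  proof (intro conjI ballI impI allI)
    show "finite (\<phi> ` X)" using q by (simp add: quad_design_def)
  next
    fix S assume "S \<in> image \<phi> ` \<B>"
    then obtain B where B: "B \<in> \<B>" "S = \<phi> ` B" by auto
    have b: "B \<subseteq> X" "card B = 4" "inj_on g B" using q B by (auto simp: quad_design_def)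
    show "S \<subseteq> \<phi> ` X" using B b(1) by auto
    show "card S = 4" using B b(2) inj_on_subset[OF inj b(1)] by (simp add: card_image)
    show "inj_on g' S" using b(1,3) g unfolding B(2) inj_on_def by blast
  next
    fix S assume S: "S \<subseteq> \<phi> ` X \<and> card S = 3 \<and> inj_on g' S"
    then obtain T where T: "T \<subseteq> X" "S = \<phi> ` T" by (meson subset_imageE)
    have cT: "card T = 3" using S T inj_on_subset[OF inj T(1)] by (simp add: card_image)
    have gT: "inj_on g T"
    proof (rule inj_onI)
      fix x y assume xy: "x \<in> T" "y \<in> T" "g x = g y"
      then have "g' (\<phi> x) = g' (\<phi> y)" using g T by blast
      then have "\<phi> x = \<phi> y" using S T xy by (meson imageI inj_onD)
      then show "x = y" using inj T xy by (meson inj_onD subsetD)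
    qed
    have "(\<exists>!S. S \<in> image \<phi> ` \<B> \<and> \<phi> ` T \<subseteq> S) \<longleftrightarrow> (\<exists>!B. B \<in> \<B> \<and> T \<subseteq> B)"
      
    proof (rule ex1_image_iff[OF injB])
      fix B assume "B \<in> \<B>"
      then have "\<phi> t \<in> \<phi> ` B \<longleftrightarrow> t \<in> B" if "t \<in> T" for t
        using inj_on_image_mem_iff[OF inj _ sub] that T(1) by blast
      then show "\<phi> ` T \<subseteq> \<phi> ` B \<longleftrightarrow> T \<subseteq> B" by (simp add: image_subset_iff subset_eq)
    qed
    then show "\<exists>!B. B \<in> image \<phi> ` \<B> \<and> S \<subseteq> B" using q T(1) cT gT unfolding T(2) quad_design_def by simp
  qed
  show "derived_blocks (image \<phi> ` \<B>) (\<phi> x) = image \<phi> ` derived_blocks \<B> x" if "x \<in> X"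
  proof -
    have 1: "\<phi> x \<in> \<phi> ` B \<longleftrightarrow> x \<in> B" "\<phi> ` B - {\<phi> x} = \<phi> ` (B - {x})" if "B \<in> \<B>" for B
      using inj_on_image_mem_iff[OF inj \<open>x \<in> X\<close> sub[OF that]]
        inj_on_image_set_diff[OF inj, of B "{x}"] sub[OF that] \<open>x \<in> X\<close> by auto
    show ?thesis
    proof (intro Set.set_eqI iffI)
      fix S assume "S \<in> derived_blocks (image \<phi> ` \<B>) (\<phi> x)"
      then obtain B where "B \<in> \<B>" "\<phi> x \<in> \<phi> ` B" "S = \<phi> ` B - {\<phi> x}" by (auto simp: derived_blocks_def)
      then show "S \<in> image \<phi> ` derived_blocks \<B> x" using 1[of B] by (auto simp: derived_blocks_def)
    next
      fix S assume "S \<in> image \<phi> ` derived_blocks \<B> x"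
      then obtain B where "B \<in> \<B>" "x \<in> B" "S = \<phi> ` (B - {x})" by (auto simp: derived_blocks_def)
      then show "S \<in> derived_blocks (image \<phi> ` \<B>) (\<phi> x)" using 1[of B] by (auto simp: derived_blocks_def)
    qed
  qed
qed

lemma card3_obtain:
  assumes "card T = 3" obtains x y z where "T = {x,y,z}" "x \<noteq> y" "x \<noteq> z" "y \<noteq> z"
  using assms by (auto simp: card_Suc_eq numeral_3_eq_3)

lemma card3_with1:
  assumes "card T = 3" "u \<in> T" obtains a b where "T = {u,a,b}" "u \<noteq> a" "u \<noteq> b" "a \<noteq> b"
proof -
  obtain x y z where *: "T = {x,y,z}" "x \<noteq> y" "x \<noteq> z" "y \<noteq> z" using card3_obtain[OF assms(1)] .
  consider "u = x" | "u = y" | "u = z" using assms(2) *(1) by blast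
  then show ?thesis
  proof cases
    case 1 then show ?thesis using that[of y z] * by blast
  next
    case 2 then show ?thesis using that[of x z] * by blast
  next
    case 3 then show ?thesis using that[of x y] * by blast
  qed
qed

lemma card3_with2:
  assumes "card T = 3" "u \<in> T" "v \<in> T" "u \<noteq> v" obtains w where "T = {u,v,w}" "u \<noteq> w" "v \<noteq> w"
proof -
  obtain a b where *: "T = {u,a,b}" "u \<noteq> a" "u \<noteq> b" "a \<noteq> b" using card3_with1[OF assms(1,2)] .
  consider "v = a" | "v = b" using assms(3,4) *(1) by blast
  then show ?thesis
  proof cases
    case 1 then show ?thesis using that[of b] * by blast
  next
    case 2 then show ?thesis using that[of a] * by blast
  qed
qed

text \<open>
  A design can be specified by its derived designs: for each point \<open>x\<close> a set \<open>D x\<close> of triples that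
  covers each pair once, subject only to the consistency condition that a block \<open>insert x T\<close> is also listed at each
  point of \<open>T\<close>.  A triple of points \<open>x, y, z\<close> is then covered once because the pair \<open>y, z\<close> is
  covered once in \<open>D x\<close>.
\<close>

lemma quad_design_of_derived:
  fixes D :: "'a \<Rightarrow> 'a set set" and g :: "'a \<Rightarrow> 'g"
  assumes fin: "finite X"
    and blk: "\<And>x T. x \<in> X \<Longrightarrow> T \<in> D x \<Longrightarrow> T \<subseteq> {y\<in>X. g y \<noteq> g x} \<and> card T = 3 \<and> inj_on g T"
    and pair: "\<And>x y z. x \<in> X \<Longrightarrow> y \<in> X \<Longrightarrow> z \<in> X \<Longrightarrow> g x \<noteq> g y \<Longrightarrow> g x \<noteq> g z \<Longrightarrow> g y \<noteq> g z
                 \<Longrightarrow> \<exists>!T. T \<in> D x \<and> y \<in> T \<and> z \<in> T"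
    and exch: "\<And>x T u. x \<in> X \<Longrightarrow> T \<in> D x \<Longrightarrow> u \<in> T \<Longrightarrow> insert x T - {u} \<in> D u"
  defines "\<B> \<equiv> {insert x T | x T. x \<in> X \<and> T \<in> D x}"
  shows "quad_design X g \<B>" and "\<And>x. x \<in> X \<Longrightarrow> derived_blocks \<B> x = D x"
proof -
  have drop: "B - {a} \<in> D a" if Ba: "B \<in> \<B>" "a \<in> B" for B a
  proof -
    obtain x T where B: "B = insert x T" "x \<in> X" "T \<in> D x" using Ba by (auto simp: \<B>_def)
    show ?thesis
    proof (cases "a = x")
      case True
      have "x \<notin> T" using blk[OF B(2,3)] by auto
      then show ?thesis using True B by simp
    next
      case False
      then show ?thesis using exch[OF B(2,3)] Ba B by auto
    qed
  qed
  show "derived_blocks \<B> x = D x" if "x \<in> X" for x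
  proof
    show "derived_blocks \<B> x \<subseteq> D x" using drop by (auto simp: derived_blocks_def)
    show "D x \<subseteq> derived_blocks \<B> x"
    proof
      fix T assume T: "T \<in> D x"
      have "x \<notin> T" using blk[OF that T] by auto
      then have "T = insert x T - {x}" by auto
      then show "T \<in> derived_blocks \<B> x" using that T by (auto simp: derived_blocks_def \<B>_def)
    qed
  qed
  show "quad_design X g \<B>" unfolding quad_design_def
  proof (intro conjI ballI impI allI fin)
    fix B assume "B \<in> \<B>"
    then obtain x T where B: "B = insert x T" "x \<in> X" "T \<in> D x" by (auto simp: \<B>_def)
    note b = blk[OF B(2,3)]
    show "B \<subseteq> X" using B b by auto
    have "x \<notin> T" "finite T" using b by (auto intro: card_ge_0_finite)
    then show "card B = 4" using B b by simp
    show "inj_on g B" using B b \<open>x \<notin> T\<close> by (force simp: inj_on_def)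
  next
    fix S assume S: "S \<subseteq> X \<and> card S = 3 \<and> inj_on g S"
    then obtain x y z where xyz: "S = {x,y,z}" "x \<noteq> y" "x \<noteq> z" "y \<noteq> z" using card3_obtain by metis
    have X: "x \<in> X" "y \<in> X" "z \<in> X" and gg: "g x \<noteq> g y" "g x \<noteq> g z" "g y \<noteq> g z"
      using S xyz by (auto simp: inj_on_def)
    from pair[OF X gg] obtain T where T: "T \<in> D x" "y \<in> T" "z \<in> T"
      and U: "\<And>T'. T' \<in> D x \<Longrightarrow> y \<in> T' \<Longrightarrow> z \<in> T' \<Longrightarrow> T' = T" by blast
    show "\<exists>!B. B \<in> \<B> \<and> S \<subseteq> B"
    proof (rule ex1I[of _ "insert x T"])
      show "insert x T \<in> \<B> \<and> S \<subseteq> insert x T" using T X xyz by (auto simp: \<B>_def)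
      fix B assume B: "B \<in> \<B> \<and> S \<subseteq> B"
      then have "B - {x} = T" using drop[of B x] U[of "B - {x}"] xyz by auto
      then show "B = insert x T" using B xyz by auto
    qed
  qed
qed

text \<open>
  The blocks of one parallel class can be turned into groups.  This is how the fibres appear in the
  derived design at the point at infinity.
\<close>

lemma rgdd_remove_class:
  fixes g :: "'a \<Rightarrow> 'g"
  defines "G \<equiv> \<lambda>Y x. {y\<in>Y. g y = g x}"
  assumes r: "rgdd (Suc k) Y (\<lambda>x. x) c \<T>" and G: "\<And>x. x \<in> Y \<Longrightarrow> G Y x \<in> \<T> \<and> c (G Y x) = k"
  shows "rgdd k Y g c (\<T> - G Y ` Y)"
  unfolding rgdd_def
proof (intro conjI ballI impI allI)
  fix T assume T: "T \<in> \<T> - G Y ` Y"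
  note b = rgdd_block[OF r DiffD1[OF T]]
  show "T \<subseteq> Y" "card T = 3" using b by blast+
  have "c T \<noteq> k"
  proof
    assume k: "c T = k"
    obtain x where x: "x \<in> T" using b(2) by fastforce
    then have xY: "x \<in> Y" using b(1) by blast
    have "x \<in> G Y x" using xY by (simp add: G_def)
    then have "T = G Y x" using rgdd_class[OF r _ xY, of k] T k x G[OF xY] by blast
    then show False using T xY by blast
  qed
  then show "c T < k" using b(4) by simp
  show "inj_on g T"
  proof (rule inj_onI, rule ccontr)
    fix u v assume uv: "u \<in> T" "v \<in> T" "g u = g v" "u \<noteq> v"
    have Y: "u \<in> Y" "v \<in> Y" using uv b(1) by blast+
    have "u \<in> G Y u" "v \<in> G Y u" using Y uv by (simp_all add: G_def)
    then have "T = G Y u" using rgdd_pair[OF r Y uv(4)] T uv G[OF Y(1)] by blast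
    then show False using T Y by blast
  qed
next
  fix x y assume xy: "x \<in> Y" "y \<in> Y" "g x \<noteq> g y"
  then have "x \<noteq> y" by blast
  obtain T where T: "T \<in> \<T> \<and> x \<in> T \<and> y \<in> T" and U: "\<And>S. S \<in> \<T> \<and> x \<in> S \<and> y \<in> S \<Longrightarrow> S = T"
    by (rule ex1_obtain[OF rgdd_pair[OF r xy(1,2) \<open>x \<noteq> y\<close>]]) blast
  have "T \<notin> G Y ` Y" using T xy(3) by (auto simp: G_def)
  then show "\<exists>!T. T \<in> \<T> - G Y ` Y \<and> x \<in> T \<and> y \<in> T" using T U by blast
next
  fix i x assume i: "i < k" and x: "x \<in> Y"
  obtain T where T: "T \<in> \<T> \<and> c T = i \<and> x \<in> T" and U: "\<And>S. S \<in> \<T> \<and> c S = i \<and> x \<in> S \<Longrightarrow> S = T"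
    by (rule ex1_obtain[OF rgdd_class[OF r less_SucI[OF i] x]]) blast
  have "T \<notin> G Y ` Y" using T i G by auto
  then show "\<exists>!T. T \<in> \<T> - G Y ` Y \<and> c T = i \<and> x \<in> T" using T U by blast
qed

lemma rgdd_recolour:
  assumes r: "rgdd K Y g c \<T>" and T: "T \<in> \<T>" and k: "k < K"
  shows "\<exists>c'. rgdd K Y g c' \<T> \<and> c' T = k"
proof -
  define s where "s i = (if i = k then c T else if i = c T then k else i)" for i
  have ss: "s (s i) = i" for i by (simp add: s_def)
  have sK: "s i < K" if "i < K" for i using rgdd_block(4)[OF r T] that k by (simp add: s_def)
  have eq: "s (c U) = i \<longleftrightarrow> c U = s i" for U i using ss by metis
  have "rgdd K Y g (\<lambda>U. s (c U)) \<T>" unfolding rgdd_def eq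
  proof (intro conjI ballI impI allI)
    fix U assume "U \<in> \<T>"
    note b = rgdd_block[OF r this]
    show "U \<subseteq> Y" "card U = 3" "inj_on g U" "s (c U) < K" using b sK by simp_all
  next
    show "\<exists>!T. T \<in> \<T> \<and> x \<in> T \<and> y \<in> T" if "x \<in> Y" "y \<in> Y" "g x \<noteq> g y" for x y
      using rgdd_pair[OF r that] .
    show "\<exists>!T. T \<in> \<T> \<and> c T = s i \<and> x \<in> T" if "i < K" "x \<in> Y" for i x
      using rgdd_class[OF r sK[OF that(1)] that(2)] .
  qed
  moreover have "s (c T) = k" by (simp add: s_def)
  ultimately show ?thesis by blast
qed

section \<open>Development of a design from the blocks through one point\<close>

text \<open>
  An abelian group \<open>A\<close> acts on itself by translation and fixes the only possible further point, the
  element of \<open>N\<close>.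
\<close>

locale development =
  fixes A N :: "'a set" and add :: "'a \<Rightarrow> 'a \<Rightarrow> 'a" and neg :: "'a \<Rightarrow> 'a" and z0 :: 'a
    and g :: "'a \<Rightarrow> 'g" and R0 RN :: "'a set set" and k :: nat
  assumes fin: "finite (A \<union> N)" and disj: "A \<inter> N = {}" and N1: "\<And>x y. x \<in> N \<Longrightarrow> y \<in> N \<Longrightarrow> x = y"
    and add_closed: "\<And>x y. x \<in> A \<Longrightarrow> y \<in> A \<Longrightarrow> add x y \<in> A"
    and add_assoc: "\<And>x y z. x \<in> A \<Longrightarrow> y \<in> A \<Longrightarrow> z \<in> A \<Longrightarrow> add x (add y z) = add (add x y) z"
    and add_comm: "\<And>x y. x \<in> A \<Longrightarrow> y \<in> A \<Longrightarrow> add x y = add y x"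
    and zero: "z0 \<in> A" "\<And>x. x \<in> A \<Longrightarrow> add z0 x = x"
    and neg: "\<And>x. x \<in> A \<Longrightarrow> neg x \<in> A" "\<And>x. x \<in> A \<Longrightarrow> add (neg x) x = z0"
begin

definition shift :: "'a \<Rightarrow> 'a \<Rightarrow> 'a" where "shift y x = (if x \<in> A then add y x else x)"

lemma shift_in: "y \<in> A \<Longrightarrow> shift y x \<in> A \<longleftrightarrow> x \<in> A" using add_closed by (auto simp: shift_def)
lemma shift_X: "y \<in> A \<Longrightarrow> x \<in> A \<union> N \<Longrightarrow> shift y x \<in> A \<union> N" using add_closed by (auto simp: shift_def)
lemma shift_shift: "y \<in> A \<Longrightarrow> u \<in> A \<Longrightarrow> shift y (shift u x) = shift (add y u) x"
  using add_closed add_assoc by (auto simp: shift_def)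
lemma shift_zero: "shift z0 x = x" using zero by (auto simp: shift_def)
lemma shift_neg:
  assumes "y \<in> A" shows "shift (neg y) (shift y x) = x" "shift y (shift (neg y) x) = x"
proof -
  have "add y (neg y) = z0" using neg[OF assms] add_comm assms by metis
  then show "shift (neg y) (shift y x) = x" "shift y (shift (neg y) x) = x"
    using neg[OF assms] assms by (simp_all add: shift_shift shift_zero)
qed
lemma shift_inj: "y \<in> A \<Longrightarrow> shift y a = shift y b \<longleftrightarrow> a = b" using shift_neg by metis
lemma shift_base: "y \<in> A \<Longrightarrow> shift y z0 = y" using zero add_comm[of y z0] by (simp add: shift_def)

end

text \<open>
  \<open>R0\<close> lists the triples that complete the neutral element to a block, and \<open>RN\<close> those that complete the
  fixed point.  The two exchange conditions say that if any other point of a listed block is translated to the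
  neutral element, then the block that results is listed as well.
\<close>

locale developed_design = development A N add neg z0 g R0 RN k
  for A N :: "'a set" and add neg z0 and g :: "'a \<Rightarrow> 'g" and R0 RN k +
  fixes c0 cN :: "'a set \<Rightarrow> nat"
  assumes ginv: "\<And>y x x'. y \<in> A \<Longrightarrow> x \<in> A \<union> N \<Longrightarrow> x' \<in> A \<union> N \<Longrightarrow> g (shift y x) = g (shift y x') \<longleftrightarrow> g x = g x'"
    and rgdd0: "rgdd k {y\<in>A \<union> N. g y \<noteq> g z0} g c0 R0"
    and rgddN: "\<And>e. e \<in> N \<Longrightarrow> rgdd k {y\<in>A \<union> N. g y \<noteq> g e} g cN RN"
    and exch0: "\<And>T u. T \<in> R0 \<Longrightarrow> u \<in> T \<Longrightarrow> u \<in> A \<Longrightarrow> shift (neg u) ` (insert z0 T - {u}) \<in> R0"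
    and exchN: "\<And>e T u. e \<in> N \<Longrightarrow> T \<in> RN \<Longrightarrow> u \<in> T \<Longrightarrow> shift (neg u) ` (insert e T - {u}) \<in> R0"
begin

abbreviation X where "X \<equiv> A \<union> N"

definition D :: "'a \<Rightarrow> 'a set set" where "D y = (if y \<in> A then image (shift y) ` R0 else RN)"

definition blocks :: "'a set set" where "blocks = {insert x T | x T. x \<in> X \<and> T \<in> D x}"

lemma groups_shift: "y \<in> A \<Longrightarrow> shift y ` {z\<in>X. g z \<noteq> g z0} = {z\<in>X. g z \<noteq> g y}"
proof (intro Set.set_eqI iffI)
  fix z assume y: "y \<in> A" and "z \<in> shift y ` {z\<in>X. g z \<noteq> g z0}"
  then obtain w where "w \<in> X" "g w \<noteq> g z0" "z = shift y w" by auto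
  then show "z \<in> {z\<in>X. g z \<noteq> g y}" using ginv[OF y, of w z0] shift_X[OF y, of w] shift_base[OF y] zero by auto
next
  fix z assume y: "y \<in> A" and z: "z \<in> {z\<in>X. g z \<noteq> g y}"
  have "z = shift y (shift (neg y) z)" using shift_neg y by simp
  moreover have "shift (neg y) z \<in> X" using shift_X neg y z by blast
  moreover have "g (shift (neg y) z) \<noteq> g z0"
    using ginv[OF neg(1)[OF y], of z y] z y shift_neg(1)[OF y, of z0] shift_base[OF y] by auto
  ultimately show "z \<in> shift y ` {z\<in>X. g z \<noteq> g z0}" by blast
qed

lemma rgdd_D: "x \<in> X \<Longrightarrow> \<exists>c. rgdd k {y\<in>X. g y \<noteq> g x} g c (D x)"
proof (cases "x \<in> A")
  case True
  have "rgdd k (shift x ` {y\<in>X. g y \<noteq> g z0}) g (\<lambda>S. c0 (the_inv_into {y\<in>X. g y \<noteq> g z0} (shift x) ` S)) (image (shift x) ` R0)"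
    by (rule rgdd_transport[OF rgdd0]) (use ginv True shift_inj in \<open>auto simp: inj_on_def\<close>)
  then show ?thesis using True groups_shift[OF True] by (auto simp: D_def)
next
  case False
  assume "x \<in> X"
  then show ?thesis using rgddN[of x] False by (auto simp: D_def)
qed

text \<open>
  Translation reduces this to the two exchange conditions, except when a block through a group
  element \<open>x\<close> is to be seen from the fixed point.  That such a translated block is listed in \<open>RN\<close> follows by uniqueness:
  \<open>RN\<close> has a triple through two of the points in question, and translating this triple back shows that it is the right one.
\<close>

lemma exch_D:
  assumes "x \<in> X" "T \<in> D x" "u \<in> T" shows "insert x T - {u} \<in> D u"
proof (cases "x \<in> A")
  case x: True
  then have "T \<in> image (shift x) ` R0" using assms(2) by (simp add: D_def)
  then obtain T0 where T': "T0 \<in> R0" "T = shift x ` T0" by blast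
  then obtain u0 where "u0 \<in> T0" "u = shift x u0" using assms(3) by blast
  note T = T' this
  have T0: "T0 \<subseteq> {y\<in>X. g y \<noteq> g z0}" "card T0 = 3" "inj_on g T0" using rgdd_block[OF rgdd0 T(1)] by auto
  have eq: "insert x T - {u} = shift x ` (insert z0 T0 - {u0})"
  proof -
    have "inj (shift x)" using shift_inj[OF x] by (simp add: inj_def)
    then have "shift x ` (insert z0 T0 - {u0}) = shift x ` insert z0 T0 - shift x ` {u0}" by (rule image_set_diff)
    then show ?thesis using T shift_base[OF x] by simp
  qed
  show ?thesis
  proof (cases "u0 \<in> A")
    case True
    then have uA: "u \<in> A" using T x shift_in by simp
    have "insert x T - {u} = shift u ` shift (neg u0) ` (insert z0 T0 - {u0})"
    proof -
      have "shift u z = shift x (shift u0 z)" for z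
        using T(4) shift_shift[OF x True] True by (simp add: shift_def)
      then show ?thesis unfolding eq image_image using shift_neg(2)[OF True] by simp
    qed
    then show ?thesis using exch0[OF T(1,3) True] uA by (auto simp: D_def)
  next
    case False
    then have e: "u0 \<in> N" "u = u0" using T0 T by (auto simp: shift_def)
    obtain a b where ab: "T0 = {u0,a,b}" "u0 \<noteq> a" "u0 \<noteq> b" "a \<noteq> b"
      using card3_with1[OF T0(2) T(3)] .
    note T0' = T0[unfolded ab(1)]
    have abX: "a \<in> X" "b \<in> X" "g a \<noteq> g z0" "g b \<noteq> g z0" using T0'(1) by auto
    have gab: "g a \<noteq> g u0" "g b \<noteq> g u0" "g u0 \<noteq> g z0" 
      using T0'(1,3) ab(2-4) by (auto simp: inj_on_def)
    have su: "shift y u0 = u0" for y using False by (simp add: shift_def)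
    have X0: "z0 \<in> X" "u0 \<in> X" using zero(1) e(1) by blast+
    have ne: "g x \<noteq> g u0" using ginv[OF x X0] shift_base[OF x] gab(3) by (simp add: su)
    have na: "g (shift x a) \<noteq> g u0" using ginv[OF x abX(1) X0(2)] gab(1) by (simp add: su)
    have nx: "g (shift x a) \<noteq> g x" using ginv[OF x abX(1) X0(1)] abX(3) shift_base[OF x] by simp
    have "\<exists>!S. S \<in> RN \<and> x \<in> S \<and> shift x a \<in> S"
      by (rule rgdd_pair[OF rgddN[OF e(1)]]) (use x ne na nx shift_X[OF x abX(1)] in simp_all)
    (* S is the triple of RN on x and the image of a; moving x back to the neutral element identifies its last point. *)
    then obtain S where S: "S \<in> RN" "x \<in> S" "shift x a \<in> S" by blast
    have S3: "card S = 3" "S \<subseteq> {y\<in>X. g y \<noteq> g u0}" using rgdd_block[OF rgddN[OF e(1)] S(1)] by auto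
    have "x \<noteq> shift x a" using nx by auto
    obtain w where w: "S = {x, shift x a, w}" "x \<noteq> w" "shift x a \<noteq> w"
      using card3_with2[OF S3(1) S(2,3) \<open>x \<noteq> shift x a\<close>] .
    have "x \<noteq> u0" using ne by blast
    then have "insert u0 S - {x} = {u0, shift x a, w}" using w(2) \<open>x \<noteq> shift x a\<close> unfolding w(1) by blast
    then have "shift (neg x) ` {u0, shift x a, w} \<in> R0" using exchN[OF e(1) S(1,2)] by simp
    then have R: "{u0, a, shift (neg x) w} \<in> R0" by (simp add: su shift_neg(1)[OF x])
    have "\<exists>!T. T \<in> R0 \<and> u0 \<in> T \<and> a \<in> T"
      by (rule rgdd_pair[OF rgdd0]) (use abX gab X0 in auto)
    then have eqT: "{u0, a, shift (neg x) w} = T0" using R T(1,3) ab(1) by blast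
    have "card {u0, a, shift (neg x) w} = 3" using rgdd_block(2)[OF rgdd0 R] .
    then have "shift (neg x) w \<noteq> u0" "shift (neg x) w \<noteq> a" by (auto simp: card_insert_if split: if_splits)
    then have "shift (neg x) w = b" using eqT ab(1) by blast
    then have wb: "w = shift x b" using shift_neg(2)[OF x] by metis
    have "insert z0 T0 - {u0} = {z0, a, b}" using T0'(1) ab(1) gab by auto
    then have "insert x T - {u} = S" unfolding eq w(1) wb using shift_base[OF x] by simp
    then show ?thesis using S(1) e False by (simp add: D_def)
  qed
next
  case False
  then have x: "x \<in> N" "T \<in> RN" using assms by (auto simp: D_def)
  have "T \<subseteq> {y\<in>X. g y \<noteq> g x}" using rgdd_block[OF rgddN[OF x(1)] x(2)] by auto
  then have "u \<in> X" "u \<noteq> x" using assms(3) by auto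
  then have u: "u \<in> A" using N1[OF _ x(1)] by blast
  have "insert x T - {u} = shift u ` shift (neg u) ` (insert x T - {u})"
    by (simp add: image_image shift_neg(2)[OF u])
  then show ?thesis using exchN[OF x assms(3)] u by (auto simp: D_def)
qed

theorem developed_quad_design: "quad_design X g blocks"
  and derived_developed: "\<And>x. x \<in> X \<Longrightarrow> derived_blocks blocks x = D x"
proof -
  have a: "T \<subseteq> {y\<in>X. g y \<noteq> g x} \<and> card T = 3 \<and> inj_on g T" if h: "x \<in> X" "T \<in> D x" for x T
  proof -
    obtain c where "rgdd k {y\<in>X. g y \<noteq> g x} g c (D x)" using rgdd_D[OF h(1)] by blast
    from rgdd_block[OF this h(2)] show ?thesis by blast
  qed
  have b: "\<exists>!T. T \<in> D x \<and> y \<in> T \<and> z \<in> T"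
    if h: "x \<in> X" "y \<in> X" "z \<in> X" "g x \<noteq> g y" "g x \<noteq> g z" "g y \<noteq> g z" for x y z
  proof -
    obtain c where "rgdd k {y\<in>X. g y \<noteq> g x} g c (D x)" using rgdd_D[OF h(1)] by blast
    from rgdd_pair[OF this, of y z] show ?thesis using h by auto
  qed
  note * = quad_design_of_derived[of X D g, OF fin a b exch_D, folded blocks_def]
  show "quad_design X g blocks" by (rule *(1))
  show "\<And>x. x \<in> X \<Longrightarrow> derived_blocks blocks x = D x" by (rule *(2))
qed

end

section \<open>Tripling a 3-design with resolvable derived designs\<close>

text \<open>
  The colour classes are the parallel classes.
\<close>

lemma resolvable_by_colouring:
  assumes blk: "\<And>T. T \<in> \<A> \<Longrightarrow> T \<subseteq> Y \<and> T \<noteq> {}"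
    and ex1: "\<And>T y. T \<in> \<A> \<Longrightarrow> y \<in> Y \<Longrightarrow> \<exists>!T'. T' \<in> \<A> \<and> c T' = c T \<and> y \<in> T'"
  shows "resolvable Y \<A>"
proof -
  define cl where "cl T = {T'\<in>\<A>. c T' = c T}" for T
  have part: "partition_on \<A> (cl ` \<A>)"
    by (rule partition_onI) (auto simp: cl_def disjnt_iff)
  have "parallel_class Y \<A> (cl T)" if T: "T \<in> \<A>" for T
  proof -
    have "partition_on Y (cl T)"
    proof (rule partition_onI)
      show "\<Union> (cl T) = Y"
      proof
        show "\<Union> (cl T) \<subseteq> Y" using blk by (auto simp: cl_def)
        show "Y \<subseteq> \<Union> (cl T)"
        proof
          fix y assume "y \<in> Y"
          from ex1[OF T this] obtain T' where "T' \<in> \<A>" "c T' = c T" "y \<in> T'" by blast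
          then show "y \<in> \<Union> (cl T)" by (auto simp: cl_def)
        qed
      qed
      fix U V assume UV: "U \<in> cl T" "V \<in> cl T" "U \<noteq> V"
      show "disjnt U V"
      proof (rule ccontr)
        assume "\<not> disjnt U V"
        then obtain y where y: "y \<in> U" "y \<in> V" by (auto simp: disjnt_iff)
        have "y \<in> Y" using y(1) UV(1) blk[of U] by (auto simp: cl_def)
        from ex1[OF T this] show False using UV y by (auto simp: cl_def)
      qed
    next
      show "{} \<notin> cl T" using blk by (auto simp: cl_def)
    qed
    then show ?thesis by (auto simp: parallel_class_def cl_def)
  qed
  then show ?thesis using part unfolding resolvable_def by blast
qed

text \<open>
  A Steiner system S(3,q+1,v) together with a resolution of each derived design: \<open>\<pi> x B\<close> names the
  parallel class of \<open>B\<close> among the blocks through \<open>x\<close>.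
\<close>

definition resolvable_3design :: "nat \<Rightarrow> 'p set \<Rightarrow> 'p set set \<Rightarrow> ('p \<Rightarrow> 'p set \<Rightarrow> 'd) \<Rightarrow> bool" where
  "resolvable_3design q P \<S> \<pi> \<longleftrightarrow> finite P \<and> (\<forall>B\<in>\<S>. B \<subseteq> P \<and> card B = Suc q) \<and>
     (\<forall>T. T \<subseteq> P \<and> card T = 3 \<longrightarrow> (\<exists>!B. B \<in> \<S> \<and> T \<subseteq> B)) \<and>
     (\<forall>x\<in>P. \<forall>B\<in>\<S>. x \<in> B \<longrightarrow> (\<forall>y\<in>P - {x}. \<exists>!B'. B' \<in> \<S> \<and> x \<in> B' \<and> y \<in> B' \<and> \<pi> x B' = \<pi> x B))"

text \<open>
  Three copies of every point, except that \<open>\<omega>\<close> has only one.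
\<close>

definition tripled :: "'p \<Rightarrow> 'p set \<Rightarrow> ('p \<times> nat) set" where
  "tripled \<omega> P = {(x,i). x \<in> P \<and> i < 3 \<and> (x = \<omega> \<longrightarrow> i = 0)}"

text \<open>
  The block that consists of the three copies of \<open>x\<close> and \<open>\<omega>\<close>.
\<close>

definition fibre :: "'p \<Rightarrow> 'p \<Rightarrow> ('p \<times> nat) set" where
  "fibre \<omega> x = {(\<omega>,0),(x,0),(x,1),(x,2)}"

text \<open>
  The quadruples over a block \<open>B\<close> are \<open>\<Q> B\<close>, and \<open>c B p\<close> colours the triples derived from them at \<open>p\<close>.  Over a
  block through \<open>\<omega>\<close> there is one more parallel class; its colour is \<open>k\<close> at the points other than \<open>\<omega>\<close>,
  and at \<open>\<omega>\<close> it has been removed, since it is the class of the fibres and belongs to all these blocks at once.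
\<close>

locale tripling =
  fixes P :: "'p set" and \<omega> :: 'p and \<S> :: "'p set set" and \<pi> :: "'p \<Rightarrow> 'p set \<Rightarrow> 'd" and q k :: nat
    and \<Q> :: "'p set \<Rightarrow> ('p \<times> nat) set set" and c :: "'p set \<Rightarrow> 'p \<times> nat \<Rightarrow> ('p \<times> nat) set \<Rightarrow> nat"
  assumes S: "resolvable_3design q P \<S> \<pi>" and inf: "\<omega> \<in> P" and P3: "3 \<le> card P"
    and Qinf: "\<And>B. B \<in> \<S> \<Longrightarrow> \<omega> \<in> B \<Longrightarrow> quad_design (tripled \<omega> B) id (\<Q> B)"
    and Qfib: "\<And>B x. B \<in> \<S> \<Longrightarrow> \<omega> \<in> B \<Longrightarrow> x \<in> B \<Longrightarrow> x \<noteq> \<omega> \<Longrightarrow> fibre \<omega> x \<in> \<Q> B"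
    and Qinf_inf: "\<And>B. B \<in> \<S> \<Longrightarrow> \<omega> \<in> B \<Longrightarrow> rgdd k {y\<in>tripled \<omega> B. fst y \<noteq> \<omega>} fst (c B (\<omega>,0))
            (derived_blocks (\<Q> B) (\<omega>,0) - {fibre \<omega> x - {(\<omega>,0)} | x. x \<in> B \<and> x \<noteq> \<omega>})"
    and Qinf_fin: "\<And>B x i. B \<in> \<S> \<Longrightarrow> \<omega> \<in> B \<Longrightarrow> (x,i) \<in> tripled \<omega> B \<Longrightarrow> x \<noteq> \<omega> \<Longrightarrow>
            rgdd (Suc k) (tripled \<omega> B - {(x,i)}) id (c B (x,i)) (derived_blocks (\<Q> B) (x,i))
            \<and> c B (x,i) (fibre \<omega> x - {(x,i)}) = k"
    and Qfin: "\<And>B. B \<in> \<S> \<Longrightarrow> \<omega> \<notin> B \<Longrightarrow> quad_design (tripled \<omega> B) fst (\<Q> B)"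
    and Qfin_fin: "\<And>B p. B \<in> \<S> \<Longrightarrow> \<omega> \<notin> B \<Longrightarrow> p \<in> tripled \<omega> B \<Longrightarrow>
            rgdd k {y\<in>tripled \<omega> B. fst y \<noteq> fst p} fst (c B p) (derived_blocks (\<Q> B) p)"
begin

abbreviation "X \<equiv> tripled \<omega> P"
definition "blocks = \<Union> (\<Q> ` \<S>)"

lemma finP: "finite P" and SP: "B \<in> \<S> \<Longrightarrow> B \<subseteq> P"
  using S by (auto simp: resolvable_3design_def)

lemma Striple: "\<forall>T. T \<subseteq> P \<and> card T = 3 \<longrightarrow> (\<exists>!B. B \<in> \<S> \<and> T \<subseteq> B)"
  and Sparallel: "\<forall>x\<in>P. \<forall>B\<in>\<S>. x \<in> B \<longrightarrow>
      (\<forall>y\<in>P - {x}. \<exists>!B'. B' \<in> \<S> \<and> x \<in> B' \<and> y \<in> B' \<and> \<pi> x B' = \<pi> x B)"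
  using S[unfolded resolvable_3design_def] by - (elim conjE, assumption)+

lemma through3:
  assumes "x \<in> P" "y \<in> P" "z \<in> P" "x \<noteq> y" "x \<noteq> z" "y \<noteq> z"
  shows "\<exists>!B. B \<in> \<S> \<and> x \<in> B \<and> y \<in> B \<and> z \<in> B"
proof -
  have "{x,y,z} \<subseteq> P \<and> card {x,y,z} = 3" using assms by simp
  then have "\<exists>!B. B \<in> \<S> \<and> {x,y,z} \<subseteq> B" by (rule Striple[rule_format])
  then show ?thesis by simp
qed

lemma through3_unique:
  assumes "B \<in> \<S>" "B' \<in> \<S>" "x \<noteq> y" "x \<noteq> z" "y \<noteq> z" "{x,y,z} \<subseteq> B" "{x,y,z} \<subseteq> B'"
  shows "B' = B"
proof -
  have "x \<in> P" "y \<in> P" "z \<in> P" using SP[OF assms(1)] assms(6) by auto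
  from through3[OF this assms(3-5)] show ?thesis using assms by auto
qed

lemma through2:
  assumes "x \<in> P" "y \<in> P" "x \<noteq> y" shows "\<exists>B\<in>\<S>. x \<in> B \<and> y \<in> B"
proof -
  have "\<not> P \<subseteq> {x,y}"
  proof
    assume "P \<subseteq> {x,y}"
    then have "card P \<le> card {x,y}" by (rule card_mono[rotated]) simp
    then show False using assms(3) P3 by simp
  qed
  then obtain z where z: "z \<in> P" "z \<noteq> x" "z \<noteq> y" by blast
  then show ?thesis using through3[OF assms(1,2) z(1) assms(3)] by metis
qed

lemma through2_parallel:
  assumes "B \<in> \<S>" "x \<in> B" "y \<in> P" "y \<noteq> x"
  shows "\<exists>!B'. B' \<in> \<S> \<and> x \<in> B' \<and> y \<in> B' \<and> \<pi> x B' = \<pi> x B"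
proof -
  have "x \<in> P" using SP assms by auto
  show ?thesis by (rule Sparallel[rule_format]) (use \<open>x \<in> P\<close> assms in simp_all)
qed

lemma tripled_mem: "B \<in> \<S> \<Longrightarrow> y \<in> tripled \<omega> B \<longleftrightarrow> y \<in> X \<and> fst y \<in> B"
  using SP by (auto simp: tripled_def)

lemma X_inf: "y \<in> X \<Longrightarrow> fst y = \<omega> \<Longrightarrow> y = (\<omega>,0)" by (auto simp: tripled_def)
lemma X_fst: "y \<in> X \<Longrightarrow> fst y \<in> P" by (auto simp: tripled_def)
lemma X_fibre: "y \<in> X \<Longrightarrow> fst y = x \<or> fst y = \<omega> \<Longrightarrow> y \<in> fibre \<omega> x"
  by (auto simp: tripled_def fibre_def)

lemma fibre_card: "x \<noteq> \<omega> \<Longrightarrow> card (fibre \<omega> x) = 4" by (simp add: fibre_def)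

lemma block:
  assumes "B \<in> \<S>" "A \<in> \<Q> B"
  shows "A \<subseteq> tripled \<omega> B" "card A = 4" "\<omega> \<notin> B \<Longrightarrow> inj_on fst A"
  using Qinf[OF assms(1)] Qfin[OF assms(1)] assms(2) by (cases "\<omega> \<in> B"; auto simp: quad_design_def)+

lemma cover:
  assumes "B \<in> \<S>" "T \<subseteq> tripled \<omega> B" "card T = 3" "inj_on fst T \<or> \<omega> \<in> B"
  shows "\<exists>!A. A \<in> \<Q> B \<and> T \<subseteq> A"
proof (cases "\<omega> \<in> B")
  case True
  then show ?thesis using Qinf[OF assms(1)] assms(2,3) unfolding quad_design_def by simp
next
  case False
  then show ?thesis using Qfin[OF assms(1)] assms(2-4) unfolding quad_design_def by simp
qed

lemma common_first:
  assumes "B \<in> \<S>" "A \<in> \<Q> B" "u \<in> A" "v \<in> A" "u \<noteq> v" "fst u = fst v"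
  shows "\<omega> \<in> B" "fst u \<noteq> \<omega>" "fst u \<in> B"
proof -
  show "\<omega> \<in> B" using block(3)[OF assms(1,2)] assms(3-6) unfolding inj_on_def by blast
  have uv: "u \<in> tripled \<omega> B" "v \<in> tripled \<omega> B" using block(1)[OF assms(1,2)] assms(3,4) by auto
  then show "fst u \<in> B" using tripled_mem[OF assms(1)] by blast
  show "fst u \<noteq> \<omega>"
  proof
    assume "fst u = \<omega>"
    then have "u = (\<omega>,0)" "v = (\<omega>,0)" using uv assms(6) X_inf tripled_mem[OF assms(1)] by metis+
    then show False using assms(5) by simp
  qed
qed

text \<open>
  Only the blocks \<open>fibre \<omega> x\<close> lie over more than one block of the base design, so every other
  quadruple determines the base block that it came from.
\<close>

lemma shared_block:
  assumes B: "B \<in> \<S>" "A \<in> \<Q> B" and B': "B' \<in> \<S>" "A \<in> \<Q> B'" and ne: "\<And>x. x \<noteq> \<omega> \<Longrightarrow> A \<noteq> fibre \<omega> x"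
  shows "B' = B"
proof (cases "inj_on fst A")
  case True
  have "card (fst ` A) = 4" using card_image[OF True] block(2)[OF B] by simp
  then obtain T where T: "T \<subseteq> fst ` A" "card T = 3" using obtain_subset_with_card_n[of 3 "fst ` A"] by auto
  obtain x y z where xyz: "T = {x,y,z}" "x \<noteq> y" "x \<noteq> z" "y \<noteq> z" using card3_obtain[OF T(2)] .
  have "fst ` A \<subseteq> B" "fst ` A \<subseteq> B'"
    using block(1)[OF B] block(1)[OF B'] tripled_mem[OF B(1)] tripled_mem[OF B'(1)] by auto
  then show ?thesis using through3_unique[OF B(1) B'(1) xyz(2-4)] T(1) xyz(1) by blast
next
  case False
  then obtain u v where uv: "u \<in> A" "v \<in> A" "u \<noteq> v" "fst u = fst v" unfolding inj_on_def by blast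
  note 1 = common_first[OF B uv] and 2 = common_first[OF B' uv]
  have AX: "w \<in> X \<and> fst w \<in> B \<and> fst w \<in> B'" if w: "w \<in> A" for w
    using block(1)[OF B] block(1)[OF B'] tripled_mem[OF B(1)] tripled_mem[OF B'(1)] w by blast
  have "\<exists>w\<in>A. fst w \<noteq> fst u \<and> fst w \<noteq> \<omega>"
  proof (rule ccontr)
    assume "\<not> ?thesis"
    then have "A \<subseteq> fibre \<omega> (fst u)" using AX X_fibre by blast
    then have "A = fibre \<omega> (fst u)"
      using card_subset_eq[of "fibre \<omega> (fst u)" A] fibre_card[OF 1(2)] block(2)[OF B] by (simp add: fibre_def)
    then show False using ne[OF 1(2)] by blast
  qed
  then obtain w where w: "w \<in> A" "fst w \<noteq> fst u" "fst w \<noteq> \<omega>" by blast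
  have "{\<omega>, fst u, fst w} \<subseteq> B" "{\<omega>, fst u, fst w} \<subseteq> B'" using 1 2 AX[OF w(1)] by auto
  then show ?thesis using through3_unique[OF B(1) B'(1)] w 1(2) by metis
qed

text \<open>
  A triple whose points have different first components lies over one base block.  Any other triple contains two
  copies of some point \<open>x\<close>, and quadruples with that property lie over base blocks through \<open>\<omega>\<close> and \<open>x\<close>; the third
  point then singles out a base block, unless the triple is contained in \<open>fibre \<omega> x\<close>.
\<close>

lemma quad_system: "steiner_quadruple_system (card X) X blocks"
  unfolding steiner_quadruple_system_def
proof (intro conjI ballI allI impI)
  show "finite X" by (rule finite_subset[of _ "P \<times> {..<3}"]) (use finP in \<open>auto simp: tripled_def\<close>)
  show "card X = card X" ..
next
  fix A assume "A \<in> blocks"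
  then obtain B where B: "B \<in> \<S>" "A \<in> \<Q> B" by (auto simp: blocks_def)
  show "A \<subseteq> X" using block(1)[OF B] tripled_mem[OF B(1)] by blast
  show "card A = 4" using block(2)[OF B] .
next
  fix T assume "T \<subseteq> X \<and> card T = 3"
  then have T: "T \<subseteq> X" "card T = 3" by auto
  have TP: "fst ` T \<subseteq> P" using T(1) X_fst by auto
  have inB: "fst ` T \<subseteq> B" if "B \<in> \<S>" "A \<in> \<Q> B" "T \<subseteq> A" for A B
    using block(1)[OF that(1,2)] that(3) tripled_mem[OF that(1)] by auto
  have TB: "T \<subseteq> tripled \<omega> B" if "B \<in> \<S>" "fst ` T \<subseteq> B" for B
    using tripled_mem[OF that(1)] that(2) T(1) by auto
  have goal: "\<exists>!A. A \<in> blocks \<and> T \<subseteq> A" 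
    if B: "B \<in> \<S>" "fst ` T \<subseteq> B" "inj_on fst T \<or> \<omega> \<in> B"
      and U: "\<And>A B'. B' \<in> \<S> \<Longrightarrow> A \<in> \<Q> B' \<Longrightarrow> T \<subseteq> A \<Longrightarrow> A \<in> \<Q> B" for B
  proof -
    from cover[OF B(1) TB[OF B(1,2)] T(2) B(3)] have e: "\<exists>!A. A \<in> \<Q> B \<and> T \<subseteq> A" .
    then obtain A where A: "A \<in> \<Q> B" "T \<subseteq> A" by blast
    show ?thesis
    proof (rule ex1I[of _ A])
      show "A \<in> blocks \<and> T \<subseteq> A" using A B by (auto simp: blocks_def)
      fix A' assume "A' \<in> blocks \<and> T \<subseteq> A'"
      then have "A' \<in> \<Q> B" "T \<subseteq> A'" using U by (auto simp: blocks_def)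
      then show "A' = A" using e A by blast
    qed
  qed
  show "\<exists>!A. A \<in> blocks \<and> T \<subseteq> A"
  proof (cases "inj_on fst T")
    case True
    then have "card (fst ` T) = 3" using card_image T(2) by metis
    then obtain x y z where xyz: "fst ` T = {x,y,z}" "x \<noteq> y" "x \<noteq> z" "y \<noteq> z" by (rule card3_obtain)
    have P: "x \<in> P" "y \<in> P" "z \<in> P" using TP unfolding xyz(1) by simp_all
    obtain B where B: "B \<in> \<S>" "x \<in> B" "y \<in> B" "z \<in> B" using through3[OF P xyz(2-4)] by blast
    show ?thesis
    proof (rule goal[OF B(1)])
      show "fst ` T \<subseteq> B" using xyz B by simp
      show "inj_on fst T \<or> \<omega> \<in> B" using True ..
      fix A B' assume A: "B' \<in> \<S>" "A \<in> \<Q> B'" "T \<subseteq> A"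
      have "B' = B" using through3_unique[OF B(1) A(1) xyz(2-4)] inB[OF A] xyz(1) B by simp
      then show "A \<in> \<Q> B" using A by simp
    qed
  next
    case False
    then obtain u v where uv: "u \<in> T" "v \<in> T" "u \<noteq> v" "fst u = fst v" unfolding inj_on_def by blast
    obtain w where w: "T = {u,v,w}" "u \<noteq> w" "v \<noteq> w" using card3_with2[OF T(2) uv(1-3)] .
    have xinf: "fst u \<noteq> \<omega>"
    proof
      assume "fst u = \<omega>"
      moreover have "u \<in> X" "v \<in> X" using uv(1,2) T(1) by blast+
      ultimately have "u = v" using X_inf[of u] X_inf[of v] uv(4) by simp
      then show False using uv by simp
    qed
    have xP: "fst u \<in> P" using uv T X_fst by blast
    show ?thesis
    proof (cases "fst w = fst u \<or> fst w = \<omega>")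
      case True
      then have Tf: "T \<subseteq> fibre \<omega> (fst u)" using X_fibre T(1) w(1) uv(4) by auto
      obtain B where B: "B \<in> \<S>" "\<omega> \<in> B" "fst u \<in> B" using through2[OF inf xP] xinf by blast
      show ?thesis
      proof (rule goal[OF B(1)])
        show "fst ` T \<subseteq> B" using w(1) True B uv(4) by auto
        show "inj_on fst T \<or> \<omega> \<in> B" using B by simp
        fix A B' assume A: "B' \<in> \<S>" "A \<in> \<Q> B'" "T \<subseteq> A"
        have "u \<in> A" "v \<in> A" using A(3) uv by auto
        note cf = common_first[OF A(1,2) this uv(3,4)]
        have "fibre \<omega> (fst u) \<in> \<Q> B'" by (rule Qfib[OF A(1) cf(1,3,2)])
        then have "A = fibre \<omega> (fst u)"
          using cover[OF A(1) TB[OF A(1) inB[OF A]] T(2)] cf(1) A Tf by blast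
        then show "A \<in> \<Q> B" using Qfib[OF B(1,2,3) xinf] by simp
      qed
    next
      case False
      have wP: "fst w \<in> P" using w(1) T X_fst by blast
      obtain B where B: "B \<in> \<S>" "\<omega> \<in> B" "fst u \<in> B" "fst w \<in> B"
        using through3[OF inf xP wP] xinf False by metis
      show ?thesis
      proof (rule goal[OF B(1)])
        show "fst ` T \<subseteq> B" using w(1) B uv(4) by auto
        show "inj_on fst T \<or> \<omega> \<in> B" using B by simp
        fix A B' assume A: "B' \<in> \<S>" "A \<in> \<Q> B'" "T \<subseteq> A"
        have "u \<in> A" "v \<in> A" using A(3) uv by auto
        note cf = common_first[OF A(1,2) this uv(3,4)]
        have "fst w \<in> B'" using inB[OF A] w(1) by simp
        then have "B' = B" using through3_unique[OF B(1) A(1), of \<omega> "fst u" "fst w"] B cf xinf False by auto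
        then show "A \<in> \<Q> B" using A by simp
      qed
    qed
  qed
qed

definition "host A = (THE B. B \<in> \<S> \<and> A \<in> \<Q> B)"

lemma host: 
  assumes "B \<in> \<S>" "A \<in> \<Q> B" "\<And>x. x \<noteq> \<omega> \<Longrightarrow> A \<noteq> fibre \<omega> x"
  shows "host A = B"
  unfolding host_def by (rule the_equality) (use assms shared_block[OF assms(1,2) _ _ assms(3)] in blast)+

lemma derived_iff: "T \<in> derived_blocks blocks p \<longleftrightarrow> (\<exists>B\<in>\<S>. T \<in> derived_blocks (\<Q> B) p)"
  by (auto simp: derived_blocks_def blocks_def)

lemma derived_block:
  assumes "B \<in> \<S>" "T \<in> derived_blocks (\<Q> B) p"
  shows "insert p T \<in> \<Q> B" "p \<notin> T" "T \<subseteq> X - {p}" "T \<noteq> {}" "fst p \<in> B" "\<And>y. y \<in> T \<Longrightarrow> fst y \<in> B"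
proof -
  obtain A where A: "A \<in> \<Q> B" "p \<in> A" "T = A - {p}" using assms(2) by (auto simp: derived_blocks_def)
  have i: "insert p T = A" using A by auto
  show "insert p T \<in> \<Q> B" using A i by simp
  show "p \<notin> T" using A by simp
  have AX: "w \<in> X \<and> fst w \<in> B" if w: "w \<in> A" for w
    using block(1)[OF assms(1) A(1)] tripled_mem[OF assms(1)] w by blast
  show "T \<subseteq> X - {p}" using AX A by auto
  show "T \<noteq> {}" 
  proof
    assume "T = {}"
    then have "A = {p}" using i by simp
    then show False using block(2)[OF assms(1) A(1)] by simp
  qed
  show "fst p \<in> B" using AX A by auto
  show "fst y \<in> B" if "y \<in> T" for y using AX A that by auto
qed

text \<open>
  One parallel class consists of the fibres.  The others are given by a direction of base blocks through \<open>\<omega>\<close>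
  and a colour: the base blocks of one direction partition the points other than \<open>\<omega>\<close>.
\<close>

lemma resolvable_at_infinity: "resolvable (X - {(\<omega>,0)}) (derived_blocks blocks (\<omega>,0))"
proof (rule resolvable_by_colouring[where c = "\<lambda>T. if inj_on fst T then
      Some (\<pi> \<omega> (host (insert (\<omega>,0) T)), c (host (insert (\<omega>,0) T)) (\<omega>,0) T) else None"])
  let ?p = "(\<omega>,0) :: 'p \<times> nat"
  let ?G = "\<lambda>x. fibre \<omega> x - {?p}"
  let ?c = "\<lambda>T. if inj_on fst T then
      Some (\<pi> \<omega> (host (insert ?p T)), c (host (insert ?p T)) ?p T) else None"
  let ?R = "\<lambda>B. derived_blocks (\<Q> B) ?p - {?G x | x. x \<in> B \<and> x \<noteq> \<omega>}"
  have G: "?G x = {(x,0),(x,1),(x,2)}" if "x \<noteq> \<omega>" for x using that by (auto simp: fibre_def)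
  have Gni: "\<not> inj_on fst (?G x)" if "x \<noteq> \<omega>" for x unfolding G[OF that] by (auto simp: inj_on_def)
  have R: "inj_on fst T" "host (insert ?p T) = B" if BT: "B \<in> \<S>" "\<omega> \<in> B" "T \<in> ?R B" for B T
  proof -
    show i: "inj_on fst T" by (rule rgdd_block(3)[OF Qinf_inf[OF BT(1,2)] BT(3)])
    have d: "T \<in> derived_blocks (\<Q> B) ?p" using BT(3) by blast
    show "host (insert ?p T) = B"
    proof (rule host[OF BT(1) derived_block(1)[OF BT(1) d]])
      fix x assume x: "x \<noteq> \<omega>"
      show "insert ?p T \<noteq> fibre \<omega> x"
      proof
        assume "insert ?p T = fibre \<omega> x"
        then have "T = ?G x" using derived_block(2)[OF BT(1) d] by blast
        then show False using i Gni[OF x] by simp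
      qed
    qed
  qed
  show "T \<subseteq> X - {?p} \<and> T \<noteq> {}" if T: "T \<in> derived_blocks blocks ?p" for T
    using T derived_iff derived_block(3,4) by metis
  fix T y assume T: "T \<in> derived_blocks blocks ?p" and y: "y \<in> X - {?p}"
  have yP: "fst y \<in> P" "fst y \<noteq> \<omega>" using y X_fst[of y] X_inf[of y] by auto
  obtain B where B: "B \<in> \<S>" "T \<in> derived_blocks (\<Q> B) ?p" using T derived_iff by blast
  have infB: "\<omega> \<in> B" using derived_block(5)[OF B] by simp
  show "\<exists>!T'. T' \<in> derived_blocks blocks ?p \<and> ?c T' = ?c T \<and> y \<in> T'"
  proof (cases "inj_on fst T")
    case True
    then have TR: "T \<in> ?R B" using Gni B(2) by blast
    let ?i = "c B ?p T"
    have cT: "?c T = Some (\<pi> \<omega> B, ?i)" using True R(2)[OF B(1) infB TR] by simp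
    have i: "?i < k" using rgdd_block(4)[OF Qinf_inf[OF B(1) infB] TR] .
    obtain B' where B0: "B' \<in> \<S> \<and> \<omega> \<in> B' \<and> fst y \<in> B' \<and> \<pi> \<omega> B' = \<pi> \<omega> B"
      and UB: "\<And>B''. B'' \<in> \<S> \<and> \<omega> \<in> B'' \<and> fst y \<in> B'' \<and> \<pi> \<omega> B'' = \<pi> \<omega> B \<Longrightarrow> B'' = B'"
      by (rule ex1_obtain[OF through2_parallel[OF B(1) infB yP]]) blast
    have B': "B' \<in> \<S>" "\<omega> \<in> B'" "fst y \<in> B'" "\<pi> \<omega> B' = \<pi> \<omega> B" using B0 by simp_all
    have yB': "y \<in> {y\<in>tripled \<omega> B'. fst y \<noteq> \<omega>}" using y yP tripled_mem[OF B'(1)] B'(3) by simp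
    obtain T' where T0: "T' \<in> ?R B' \<and> c B' ?p T' = ?i \<and> y \<in> T'"
      and UT: "\<And>T''. T'' \<in> ?R B' \<and> c B' ?p T'' = ?i \<and> y \<in> T'' \<Longrightarrow> T'' = T'"
      by (rule ex1_obtain[OF rgdd_class[OF Qinf_inf[OF B'(1,2)] i yB']]) blast
    have T': "T' \<in> ?R B'" "c B' ?p T' = ?i" "y \<in> T'" using T0 by blast+
    show ?thesis unfolding cT
    proof (rule ex1I[of _ T'])
      have "T' \<in> derived_blocks blocks ?p" using T'(1) B'(1) derived_iff by blast
      then show "T' \<in> derived_blocks blocks ?p \<and> ?c T' = Some (\<pi> \<omega> B, ?i) \<and> y \<in> T'"
        using R[OF B'(1,2) T'(1)] T' B'(4) by simp
      fix U assume U: "U \<in> derived_blocks blocks ?p \<and> ?c U = Some (\<pi> \<omega> B, ?i) \<and> y \<in> U"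
      then obtain B'' where B'': "B'' \<in> \<S>" "U \<in> derived_blocks (\<Q> B'') ?p" using derived_iff by blast
      have infB'': "\<omega> \<in> B''" using derived_block(5)[OF B''] by simp
      have "inj_on fst U" using U by (auto split: if_splits)
      then have UR: "U \<in> ?R B''" using Gni B''(2) by blast
      have c: "\<pi> \<omega> B'' = \<pi> \<omega> B" "c B'' ?p U = ?i" using U R[OF B''(1) infB'' UR] by auto
      have "fst y \<in> B''" using derived_block(6)[OF B''] U by blast
      then have "B'' = B'" using UB[of B''] B''(1) infB'' c(1) by simp
      then show "U = T'" using UT[of U] UR c(2) U by simp
    qed
  next
    case False
    then have cT: "?c T = None" by simp
    have None_fibre: "U = ?G (fst y)" if U: "U \<in> derived_blocks blocks ?p" "\<not> inj_on fst U" "y \<in> U" for U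
    proof -
      obtain B'' where B'': "B'' \<in> \<S>" "U \<in> derived_blocks (\<Q> B'') ?p" using U derived_iff by blast
      have infB'': "\<omega> \<in> B''" using derived_block(5)[OF B''] by simp
      have "U \<notin> ?R B''" using R(1)[OF B''(1) infB''] U(2) by blast
      then obtain x where x: "x \<noteq> \<omega>" "U = ?G x" using B''(2) by blast
      then have "fst y = x" using U(3) G by auto
      then show ?thesis using x by simp
    qed
    show ?thesis unfolding cT
    proof (rule ex1I[of _ "?G (fst y)"])
      obtain B' where B': "B' \<in> \<S>" "\<omega> \<in> B'" "fst y \<in> B'" using through2[OF inf yP(1)] yP(2) by metis
      have "?p \<in> fibre \<omega> (fst y)" by (simp add: fibre_def)
      then have "?G (fst y) \<in> derived_blocks (\<Q> B') ?p" using Qfib[OF B' yP(2)] by (auto simp: derived_blocks_def)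
      then have "?G (fst y) \<in> derived_blocks blocks ?p" using B'(1) derived_iff by blast
      moreover have "y \<in> ?G (fst y)" using X_fibre[of y] y by blast
      ultimately show "?G (fst y) \<in> derived_blocks blocks ?p \<and> ?c (?G (fst y)) = None \<and> y \<in> ?G (fst y)"
        using Gni[OF yP(2)] by simp
      fix U assume "U \<in> derived_blocks blocks ?p \<and> ?c U = None \<and> y \<in> U"
      then show "U = ?G (fst y)" using None_fibre by (auto split: if_splits)
    qed
  qed
qed

text \<open>
  The base blocks of one direction through \<open>x\<close> partition the points other than \<open>x\<close>, and just one of them
  contains \<open>\<omega>\<close>; that one takes care of the two other copies of \<open>x\<close> and of \<open>\<omega>\<close>.  Hence a direction and a colour below
  \<open>k\<close> give a parallel class.  The colour \<open>k\<close> occurs only over base blocks through \<open>\<omega>\<close> and \<open>x\<close>, which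
  partition all other points; in each of them the triple completing the fibre has that colour, so the triples of
  colour \<open>k\<close> over all these base blocks form a single class.
\<close>

lemma resolvable_at_finite:
  assumes p: "(x,i) \<in> X" "x \<noteq> \<omega>"
  shows "resolvable (X - {(x,i)}) (derived_blocks blocks (x,i))"
proof -
  let ?p = "(x,i)"
  let ?S = "fibre \<omega> x - {?p}"
  define h where "h T = host (insert ?p T)" for T
  define col where "col T = (if T = ?S \<or> (\<omega> \<in> h T \<and> c (h T) ?p T = k) then None else Some (\<pi> x (h T), c (h T) ?p T))" for T
  have pf: "?p \<in> fibre \<omega> x" using X_fibre[OF p(1)] by simp
  have xP: "x \<in> P" using X_fst[OF p(1)] by simp
  have infS: "(\<omega>,0) \<in> ?S" using p(2) by (simp add: fibre_def)
  have pB: "?p \<in> tripled \<omega> B" if "B \<in> \<S>" "x \<in> B" for B using tripled_mem[OF that(1)] that(2) p(1) by simp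
  have hT: "h T = B" if BT: "B \<in> \<S>" "T \<in> derived_blocks (\<Q> B) ?p" "T \<noteq> ?S" for B T
    unfolding h_def
  proof (rule host[OF BT(1) derived_block(1)[OF BT(1,2)]])
    fix z assume z: "z \<noteq> \<omega>"
    show "insert ?p T \<noteq> fibre \<omega> z"
    proof
      assume e: "insert ?p T = fibre \<omega> z"
      then have "?p \<in> fibre \<omega> z" by blast
      then have "z = x" using p(2) by (auto simp: fibre_def)
      then show False using e BT(3) derived_block(2)[OF BT(1,2)] by blast
    qed
  qed
  have Sd: "?S \<in> derived_blocks (\<Q> B) ?p" if "B \<in> \<S>" "\<omega> \<in> B" "x \<in> B" for B
    using Qfib[OF that p(2)] pf by (auto simp: derived_blocks_def)
  have Sn: "\<omega> \<in> B" if "B \<in> \<S>" "?S \<in> derived_blocks (\<Q> B) ?p" for B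
    using derived_block(6)[OF that infS] by simp
  have rg1: "rgdd (Suc k) (tripled \<omega> B - {?p}) id (c B ?p) (derived_blocks (\<Q> B) ?p)" "c B ?p ?S = k"
    if "B \<in> \<S>" "\<omega> \<in> B" "x \<in> B" for B
    using Qinf_fin[OF that(1,2) pB[OF that(1,3)] p(2)] by auto
  have rg2: "rgdd k {y\<in>tripled \<omega> B. fst y \<noteq> x} fst (c B ?p) (derived_blocks (\<Q> B) ?p)"
    if "B \<in> \<S>" "\<omega> \<notin> B" "x \<in> B" for B
    using Qfin_fin[OF that(1,2) pB[OF that(1,3)]] by simp
  have class1: "\<exists>!T. T \<in> derived_blocks (\<Q> B) ?p \<and> c B ?p T = j \<and> y \<in> T"
    if "B \<in> \<S>" "\<omega> \<in> B" "x \<in> B" "y \<in> X - {?p}" "fst y \<in> B" "j \<le> k" for B y j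
    by (rule rgdd_class[OF rg1(1)[OF that(1-3)]]) (use that tripled_mem[OF that(1)] in auto)
  have class2: "\<exists>!T. T \<in> derived_blocks (\<Q> B) ?p \<and> c B ?p T = j \<and> y \<in> T"
    if "B \<in> \<S>" "\<omega> \<notin> B" "x \<in> B" "y \<in> X - {?p}" "fst y \<in> B" "fst y \<noteq> x" "j < k" for B y j
    by (rule rgdd_class[OF rg2[OF that(1-3)]]) (use that tripled_mem[OF that(1)] in auto)
  show ?thesis
  proof (rule resolvable_by_colouring[where c = col])
    show "T \<subseteq> X - {?p} \<and> T \<noteq> {}" if T: "T \<in> derived_blocks blocks ?p" for T
      using T derived_iff derived_block(3,4) by metis
    fix T y assume T: "T \<in> derived_blocks blocks ?p" and y: "y \<in> X - {?p}"
    (* The copies of x, like the point at infinity, are looked for over the base block through infinity. *)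
    define w where "w = (if fst y = x then \<omega> else fst y)"
    have w: "w \<in> P" "w \<noteq> x" using y X_fst inf p(2) by (auto simp: w_def)
    have wB: "w \<in> B" if BU: "B \<in> \<S>" "U \<in> derived_blocks (\<Q> B) ?p" "y \<in> U" for B U
    proof (cases "fst y = x")
      case True
      have "\<omega> \<in> B" by (rule common_first(1)[OF BU(1) derived_block(1)[OF BU(1,2)], of ?p y]) (use True y BU(3) in auto)
      then show ?thesis using True by (simp add: w_def)
    next
      case False
      then show ?thesis using derived_block(6)[OF BU] by (simp add: w_def)
    qed
    show "\<exists>!T'. T' \<in> derived_blocks blocks ?p \<and> col T' = col T \<and> y \<in> T'"
    proof (cases "col T")
      case None
      show ?thesis
      proof (cases "y \<in> ?S")
        case True
        show ?thesis unfolding None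
        proof (rule ex1I[of _ ?S])
          obtain B where B: "B \<in> \<S>" "\<omega> \<in> B" "x \<in> B" using through2[OF inf xP] p(2) by metis
          show "?S \<in> derived_blocks blocks ?p \<and> col ?S = None \<and> y \<in> ?S"
            using Sd[OF B] B(1) derived_iff True by (auto simp: col_def)
          fix U assume U: "U \<in> derived_blocks blocks ?p \<and> col U = None \<and> y \<in> U"
          show "U = ?S"
          proof (rule ccontr)
            assume ne: "U \<noteq> ?S"
            obtain B where B: "B \<in> \<S>" "U \<in> derived_blocks (\<Q> B) ?p" using U derived_iff by blast
            have "\<omega> \<in> B" "c B ?p U = k" using U ne hT[OF B ne] by (auto simp: col_def split: if_splits)
            moreover have xB: "x \<in> B" using derived_block(5)[OF B] by simp
            moreover have "fst y \<in> B" using derived_block(6)[OF B] U by blast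
            ultimately show False
              using class1[OF B(1) _ xB y _ order.refl] Sd[OF B(1)] rg1(2)[OF B(1)] B(2) U True ne by blast
          qed
        qed
      next
        case False
        have yx: "fst y \<noteq> x" "fst y \<noteq> \<omega>" using False y X_fibre[of y x] by auto
        have yP: "fst y \<in> P" using y X_fst by blast
        obtain B where B: "B \<in> \<S>" "\<omega> \<in> B" "x \<in> B" "fst y \<in> B"
          using through3[OF inf xP yP] p(2) yx by metis
        obtain T' where T0: "T' \<in> derived_blocks (\<Q> B) ?p \<and> c B ?p T' = k \<and> y \<in> T'"
          and UT: "\<And>U. U \<in> derived_blocks (\<Q> B) ?p \<and> c B ?p U = k \<and> y \<in> U \<Longrightarrow> U = T'"
          by (rule ex1_obtain[OF class1[OF B(1-3) y B(4) order.refl]]) blast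
        have T': "T' \<in> derived_blocks (\<Q> B) ?p" "c B ?p T' = k" "y \<in> T'" using T0 by simp_all
        show ?thesis unfolding None
        proof (rule ex1I[of _ T'])
          have "T' \<noteq> ?S" using T'(3) False by blast
          then have "h T' = B" using hT[OF B(1) T'(1)] by blast
          then have "col T' = None" using T'(2) B(2) by (simp add: col_def)
          then show "T' \<in> derived_blocks blocks ?p \<and> col T' = None \<and> y \<in> T'" using T' B(1) derived_iff by blast
          fix U assume U: "U \<in> derived_blocks blocks ?p \<and> col U = None \<and> y \<in> U"
          then have ne: "U \<noteq> ?S" using False by blast
          obtain B' where B': "B' \<in> \<S>" "U \<in> derived_blocks (\<Q> B') ?p" using U derived_iff by blast
          have "\<omega> \<in> B'" "c B' ?p U = k" using U ne hT[OF B' ne] by (auto simp: col_def split: if_splits)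
          moreover have xB: "x \<in> B'" using derived_block(5)[OF B'] by simp
          moreover have "fst y \<in> B'" using derived_block(6)[OF B'] U by blast
          ultimately have "B' = B" using through3_unique[OF B(1) B'(1), of \<omega> x "fst y"] B p(2) yx by auto
          then show "U = T'" using UT[of U] B'(2) \<open>c B' ?p U = k\<close> U by simp
        qed
      qed
    next
      case (Some dj)
      obtain B where B: "B \<in> \<S>" "T \<in> derived_blocks (\<Q> B) ?p" using T derived_iff by blast
      have ne: "T \<noteq> ?S" using Some by (auto simp: col_def)
      note hB = hT[OF B ne]
      let ?j = "c B ?p T"
      have dj: "dj = (\<pi> x B, ?j)" and jk: "\<omega> \<in> B \<Longrightarrow> ?j \<noteq> k" using Some hB by (auto simp: col_def split: if_splits)
      have xB: "x \<in> B" using derived_block(5)[OF B] by simp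
      have j: "?j < k"
      proof (cases "\<omega> \<in> B")
        case True
        then show ?thesis using rgdd_block(4)[OF rg1(1)[OF B(1) True xB] B(2)] jk by simp
      next
        case False
        then show ?thesis using rgdd_block(4)[OF rg2[OF B(1) False xB] B(2)] by simp
      qed
      obtain B' where B0: "B' \<in> \<S> \<and> x \<in> B' \<and> w \<in> B' \<and> \<pi> x B' = \<pi> x B"
        and UB: "\<And>B''. B'' \<in> \<S> \<and> x \<in> B'' \<and> w \<in> B'' \<and> \<pi> x B'' = \<pi> x B \<Longrightarrow> B'' = B'"
        by (rule ex1_obtain[OF through2_parallel[OF B(1) xB w]]) blast
      have B': "B' \<in> \<S>" "x \<in> B'" "w \<in> B'" "\<pi> x B' = \<pi> x B" using B0 by simp_all
      have yB': "fst y \<in> B'" using B' by (auto simp: w_def split: if_splits)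
      have "\<exists>!U. U \<in> derived_blocks (\<Q> B') ?p \<and> c B' ?p U = ?j \<and> y \<in> U"
      proof (cases "\<omega> \<in> B'")
        case True
        then show ?thesis using class1[OF B'(1) True B'(2) y yB'] j by simp
      next
        case False
        then have "fst y \<noteq> x" using B'(3) by (auto simp: w_def)
        then show ?thesis using class2[OF B'(1) False B'(2) y yB' _ j] by simp
      qed
      then obtain T' where T0: "T' \<in> derived_blocks (\<Q> B') ?p \<and> c B' ?p T' = ?j \<and> y \<in> T'"
        and UT: "\<And>U. U \<in> derived_blocks (\<Q> B') ?p \<and> c B' ?p U = ?j \<and> y \<in> U \<Longrightarrow> U = T'"
        by (rule ex1_obtain) blast
      have T': "T' \<in> derived_blocks (\<Q> B') ?p" "c B' ?p T' = ?j" "y \<in> T'" using T0 by simp_all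
      show ?thesis unfolding Some dj
      proof (rule ex1I[of _ T'])
        (* The triple ?S has colour k, which differs from the colour of T. *)
        have neS: "T' \<noteq> ?S"
        proof
          assume e: "T' = ?S"
          then have "\<omega> \<in> B'" using Sn[OF B'(1)] T'(1) by blast
          from rg1(2)[OF B'(1) this B'(2)] have "?j = k" using T'(2) unfolding e by simp
          then show False using j by simp
        qed
        have "col T' = Some (\<pi> x B, ?j)" using hT[OF B'(1) T'(1) neS] neS T'(2) B'(4) j by (simp add: col_def)
        then show "T' \<in> derived_blocks blocks ?p \<and> col T' = Some (\<pi> x B, ?j) \<and> y \<in> T'" using T' B'(1) derived_iff by blast
        fix U assume U: "U \<in> derived_blocks blocks ?p \<and> col U = Some (\<pi> x B, ?j) \<and> y \<in> U"
        then have neU: "U \<noteq> ?S" by (auto simp: col_def)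
        obtain B'' where B'': "B'' \<in> \<S>" "U \<in> derived_blocks (\<Q> B'') ?p" using U derived_iff by blast
        have cU: "\<pi> x B'' = \<pi> x B" "c B'' ?p U = ?j" using U hT[OF B'' neU] by (auto simp: col_def split: if_splits)
        have "x \<in> B''" using derived_block(5)[OF B''] by simp
        moreover have "w \<in> B''" using wB[OF B''] U by blast
        ultimately have "B'' = B'" using UB[of B''] B''(1) cU(1) by simp
        then show "U = T'" using UT[of U] B''(2) cU(2) U by simp
      qed
    qed
  qed
qed

theorem RDSQS_blocks: "RDSQS (card X) X blocks"
proof -
  have "resolvable (X - {p}) (derived_blocks blocks p)" if p: "p \<in> X" for p
  proof (cases "fst p = \<omega>")
    case True
    then have "p = (\<omega>,0)" using X_inf p by blast
    then show ?thesis using resolvable_at_infinity by simp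
  next
    case False
    then show ?thesis using resolvable_at_finite[of "fst p" "snd p"] p by simp
  qed
  then show ?thesis using quad_system by (simp add: RDSQS_def)
qed

end

section \<open>Spherical geometries\<close>

locale field_tower =
  fixes K F :: "'a::field set"
  assumes KF: "K \<subseteq> F" and fin: "finite F"
    and F0: "0 \<in> F" and F_add: "\<And>x y. x \<in> F \<Longrightarrow> y \<in> F \<Longrightarrow> x + y \<in> F" and F_uminus: "\<And>x. x \<in> F \<Longrightarrow> - x \<in> F"
    and F_mult: "\<And>x y. x \<in> F \<Longrightarrow> y \<in> F \<Longrightarrow> x * y \<in> F" and F_inverse: "\<And>x. x \<in> F \<Longrightarrow> inverse x \<in> F"
    and K1: "1 \<in> K" and K_add: "\<And>x y. x \<in> K \<Longrightarrow> y \<in> K \<Longrightarrow> x + y \<in> K" and K_uminus: "\<And>x. x \<in> K \<Longrightarrow> - x \<in> K"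
    and K_mult: "\<And>x y. x \<in> K \<Longrightarrow> y \<in> K \<Longrightarrow> x * y \<in> K" and K_inverse: "\<And>x. x \<in> K \<Longrightarrow> inverse x \<in> K"
begin

lemma F_diff: "x \<in> F \<Longrightarrow> y \<in> F \<Longrightarrow> x - y \<in> F" using F_add[of x "- y"] F_uminus by simp
lemma K_diff: "x \<in> K \<Longrightarrow> y \<in> K \<Longrightarrow> x - y \<in> K" using K_add[of x "- y"] K_uminus by simp
lemma F_div: "x \<in> F \<Longrightarrow> y \<in> F \<Longrightarrow> x / y \<in> F" using F_mult F_inverse by (simp add: divide_inverse)
lemma K0: "0 \<in> K" using K_diff[OF K1 K1] by simp

definition points :: "'a option set" where "points = insert None (Some ` F)"

definition line :: "'a \<Rightarrow> 'a \<Rightarrow> 'a option set" where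
  "line a b = insert None ((\<lambda>t. Some (b + a * t)) ` K)"

text \<open>
  The image of the projective line over \<open>K\<close> under \<open>t \<mapsto> b + a / (t - c)\<close>.  It is a line if \<open>c \<in> K\<close>; for \<open>c\<close>
  outside \<open>K\<close> it avoids the point at infinity.
\<close>

definition circle :: "'a \<Rightarrow> 'a \<Rightarrow> 'a \<Rightarrow> 'a option set" where
  "circle a b c = insert (Some b) ((\<lambda>t. Some (b + a / (t - c))) ` K)"

definition circles :: "'a option set set" where
  "circles = {line a b | a b. a \<in> F \<and> a \<noteq> 0 \<and> b \<in> F} \<union>
     {circle a b c | a b c. a \<in> F \<and> a \<noteq> 0 \<and> b \<in> F \<and> c \<in> F \<and> c \<notin> K}"

lemma line_circles: "a \<in> F \<Longrightarrow> a \<noteq> 0 \<Longrightarrow> b \<in> F \<Longrightarrow> line a b \<in> circles" unfolding circles_def by blast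
lemma circle_circles: "a \<in> F \<Longrightarrow> a \<noteq> 0 \<Longrightarrow> b \<in> F \<Longrightarrow> c \<in> F \<Longrightarrow> c \<notin> K \<Longrightarrow> circle a b c \<in> circles" unfolding circles_def by blast

lemma circles_cases:
  assumes "B \<in> circles"
  obtains a b where "B = line a b" "a \<in> F" "a \<noteq> 0" "b \<in> F"
    | a b c where "B = circle a b c" "a \<in> F" "a \<noteq> 0" "b \<in> F" "c \<in> F" "c \<notin> K"
  using assms unfolding circles_def by blast

lemma through_None:
  assumes "B \<in> circles" "None \<in> B" obtains a b where "B = line a b" "a \<in> F" "a \<noteq> 0" "b \<in> F"
  using assms(1)
proof (cases rule: circles_cases)
  case (1 a b) then show ?thesis by (rule that)
next
  case (2 a b c) then show ?thesis using assms(2) by (auto simp: circle_def)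
qed

lemma circles_points: "B \<in> circles \<Longrightarrow> B \<subseteq> points"
  by (erule circles_cases) (use KF F_add F_mult F_diff F_div in \<open>auto simp: line_def circle_def points_def\<close>)

lemma finK: "finite K" using KF fin finite_subset by blast

lemma card_circles: 
  assumes "B \<in> circles" shows "card B = Suc (card K)"
  using assms
proof (cases rule: circles_cases)
  case (1 a b)
  have "inj_on (\<lambda>t. Some (b + a * t)) K" using 1 by (auto simp: inj_on_def)
  then have "card ((\<lambda>t. Some (b + a * t)) ` K) = card K" by (rule card_image)
  then show ?thesis using 1(1) finK by (auto simp: line_def card_insert_if)
next
  case (2 a b c)
  have ne: "t - c \<noteq> 0" if "t \<in> K" for t using 2 that by auto
  have "inj_on (\<lambda>t. Some (b + a / (t - c))) K"
  proof (rule inj_onI)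
    fix s t assume st: "s \<in> K" "t \<in> K" "Some (b + a / (s - c)) = Some (b + a / (t - c))"
    then have "a / (s - c) = a / (t - c)" by simp
    then have "s - c = t - c" using ne[OF st(1)] ne[OF st(2)] 2(3) by (simp add: frac_eq_eq)
    then show "s = t" by simp
  qed
  then have "card ((\<lambda>t. Some (b + a / (t - c))) ` K) = card K" by (rule card_image)
  moreover have "Some b \<notin> (\<lambda>t. Some (b + a / (t - c))) ` K" using ne 2(3) by auto
  ultimately show ?thesis using 2(1) finK by (simp add: circle_def)
qed

lemma line_rebase:
  assumes "Some y \<in> line a b" shows "line a b = line a y"
proof -
  obtain s where s: "s \<in> K" "y = b + a * s" using assms by (auto simp: line_def)
  have 1: "line a (b + a * s) \<subseteq> line a b" if "s \<in> K" for b s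
  proof
    fix z assume "z \<in> line a (b + a * s)"
    then consider "z = None" | t where "t \<in> K" "z = Some (b + a * s + a * t)" by (auto simp: line_def)
    then show "z \<in> line a b"
    proof cases
      case 1 then show ?thesis by (simp add: line_def)
    next
      case 2
      then have "z = Some (b + a * (s + t))" by (simp add: algebra_simps)
      then show ?thesis using K_add[OF that 2(1)] by (auto simp: line_def)
    qed
  qed
  have "line a b \<subseteq> line a y" using 1[of "- s" y] K_uminus[OF s(1)] s(2) by simp
  then show ?thesis using 1[OF s(1), of b] s(2) by blast
qed

lemma line_rescale:
  assumes "s \<in> K" "s \<noteq> 0" shows "line (a * s) b = line a b"
proof -
  have 1: "line (a * s) b \<subseteq> line a b" if "s \<in> K" for a s
  proof
    fix z assume "z \<in> line (a * s) b"
    then consider "z = None" | t where "t \<in> K" "z = Some (b + a * s * t)" by (auto simp: line_def)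
    then show "z \<in> line a b"
    proof cases
      case 1 then show ?thesis by (simp add: line_def)
    next
      case 2
      then have "z = Some (b + a * (s * t))" by (simp add: algebra_simps)
      then show ?thesis using K_mult[OF that 2(1)] by (auto simp: line_def)
    qed
  qed
  have "line a b \<subseteq> line (a * s) b" using 1[of "inverse s" "a * s"] K_inverse assms by (simp add: mult.assoc)
  then show ?thesis using 1[OF assms(1), of a] by blast
qed

lemma line_two_points:
  assumes "Some y \<in> line a b" "Some z \<in> line a b" "y \<noteq> z" shows "line a b = line (z - y) y"
proof -
  have 1: "line a b = line a y" by (rule line_rebase[OF assms(1)])
  then obtain s where s: "s \<in> K" "z = y + a * s" using assms(2) by (auto simp: line_def)
  have "s \<noteq> 0" using s assms(3) by auto
  then have "line (a * s) y = line a y" by (rule line_rescale[OF s(1)])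
  then show ?thesis using 1 s(2) by simp
qed

text \<open>
  Blocks through infinity are the lines of the affine space of \<open>F\<close> over \<open>K\<close>.
\<close>

lemma unique_line:
  assumes "y \<in> F" "z \<in> F" "y \<noteq> z"
  shows "\<exists>!B. B \<in> circles \<and> None \<in> B \<and> Some y \<in> B \<and> Some z \<in> B"
proof (rule ex1I[of _ "line (z - y) y"])
  have "Some y \<in> line (z - y) y" using K0 by (force simp: line_def)
  moreover have "Some z \<in> line (z - y) y" using K1 by (force simp: line_def)
  ultimately show "line (z - y) y \<in> circles \<and> None \<in> line (z - y) y \<and> Some y \<in> line (z - y) y \<and> Some z \<in> line (z - y) y"
    using line_circles[OF F_diff[OF assms(2,1)] _ assms(1)] assms(3) by (auto simp: line_def)
  fix B assume B: "B \<in> circles \<and> None \<in> B \<and> Some y \<in> B \<and> Some z \<in> B"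
  then obtain a b where "B = line a b" by (elim conjE through_None)
  then show "B = line (z - y) y" using line_two_points B assms(3) by simp
qed

definition direction :: "'a option set \<Rightarrow> 'a set" where
  "direction B = {z - y | y z. Some y \<in> B \<and> Some z \<in> B}"

lemma direction_line: "direction (line a b) = (*) a ` K"
proof
  show "direction (line a b) \<subseteq> (*) a ` K"
  proof
    fix d assume "d \<in> direction (line a b)"
    then obtain s t where "s \<in> K" "t \<in> K" "d = (b + a * t) - (b + a * s)" by (auto simp: direction_def line_def)
    then have "d = a * (t - s)" "t - s \<in> K" using K_diff by (auto simp: algebra_simps)
    then show "d \<in> (*) a ` K" by blast
  qed
  show "(*) a ` K \<subseteq> direction (line a b)"
  proof
    fix d assume "d \<in> (*) a ` K"
    then obtain t where t: "t \<in> K" "d = (b + a * t) - b" by auto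
    have "Some b \<in> line a b" using K0 by (force simp: line_def)
    moreover have "Some (b + a * t) \<in> line a b" using t(1) by (auto simp: line_def)
    ultimately show "d \<in> direction (line a b)" using t(2) unfolding direction_def by blast
  qed
qed

lemma unique_parallel:
  assumes "B \<in> circles" "None \<in> B" "y \<in> F"
  shows "\<exists>!B'. B' \<in> circles \<and> None \<in> B' \<and> Some y \<in> B' \<and> direction B' = direction B"
proof -
  obtain a b where B: "B = line a b" "a \<in> F" "a \<noteq> 0" "b \<in> F" using through_None[OF assms(1,2)] .
  show ?thesis
  proof (rule ex1I[of _ "line a y"])
    have "Some y \<in> line a y" using K0 by (force simp: line_def)
    then show "line a y \<in> circles \<and> None \<in> line a y \<and> Some y \<in> line a y \<and> direction (line a y) = direction B"
      using line_circles[OF B(2,3) assms(3)] B(1) direction_line by (auto simp: line_def)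
    fix B' assume B': "B' \<in> circles \<and> None \<in> B' \<and> Some y \<in> B' \<and> direction B' = direction B"
    then obtain a' b' where "B' = line a' b'" by (elim conjE through_None)
    then have l: "B' = line a' y" using line_rebase B' by simp
    have "(*) a' ` K = (*) a ` K" using B' B(1) l direction_line by simp
    moreover have "line c y = insert None ((\<lambda>d. Some (y + d)) ` ((*) c ` K))" for c
      by (simp add: line_def image_image)
    ultimately show "B' = line a y" using l by simp
  qed
qed

definition invert :: "'a option \<Rightarrow> 'a option" where
  "invert p = (case p of None \<Rightarrow> Some 0 | Some z \<Rightarrow> if z = 0 then None else Some (inverse z))"

definition translate :: "'a \<Rightarrow> 'a option \<Rightarrow> 'a option" where
  "translate x = map_option (\<lambda>z. z - x)"

lemma invert_invert: "invert (invert p) = p" by (auto simp: invert_def split: option.splits)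
lemma translate_translate: "translate (- x) (translate x p) = p" by (cases p) (simp_all add: translate_def)

lemma invert_simps: "invert None = Some 0" "z \<noteq> 0 \<Longrightarrow> invert (Some z) = Some (inverse z)" "invert (Some 0) = None"
  by (simp_all add: invert_def)

lemma image_eq_involution: "(\<And>p. f (f p) = p) \<Longrightarrow> f ` A \<subseteq> B \<Longrightarrow> f ` B \<subseteq> A \<Longrightarrow> f ` A = B"
  by (metis image_eqI subsetI subset_antisym image_subset_iff)

lemma invert_line0:
  assumes "a \<noteq> 0" shows "invert ` line a 0 = line (inverse a) 0"
proof -
  have 1: "invert ` line a 0 \<subseteq> line (inverse a) 0" if "a \<noteq> 0" for a
  proof (rule image_subsetI)
    fix z assume "z \<in> line a 0"
    then consider "z = None" | t where "t \<in> K" "z = Some (a * t)" by (auto simp: line_def)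
    then show "invert z \<in> line (inverse a) 0"
    proof cases
      case 1 then show ?thesis using K0 by (force simp: line_def invert_simps)
    next
      case 2
      show ?thesis
      proof (cases "t = 0")
        case True then show ?thesis using 2 by (simp add: invert_simps line_def)
      next
        case False
        then have "invert z = Some (0 + inverse a * inverse t)" using 2 that by (simp add: invert_simps)
        then show ?thesis unfolding line_def using K_inverse[OF 2(1)] by blast
      qed
    qed
  qed
  show ?thesis
    by (rule image_eq_involution[OF invert_invert 1[OF assms]]) (use 1[of "inverse a"] assms in simp)
qed

text \<open>
  A line through 0 is mapped to a line through 0, any other line to a circle through 0.
\<close>

lemma invert_circles1:
  assumes a: "a \<in> F" "a \<noteq> 0" "b \<in> F" shows "invert ` line a b \<in> circles"
proof (cases "Some 0 \<in> line a b")
  case True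
  then have "line a b = line a 0" by (rule line_rebase)
  then show ?thesis using invert_line0[OF a(2)] line_circles[OF F_inverse[OF a(1)] _ F0] a(2) by simp
next
  case False
  have c: "- (b / a) \<notin> K"
  proof
    assume "- (b / a) \<in> K"
    then have "Some (b + a * - (b / a)) \<in> line a b" unfolding line_def by blast
    then show False using False a(2) by simp
  qed
  have "invert (Some (b + a * t)) = Some (0 + inverse a / (t - - (b / a)))" if "t \<in> K" for t
  proof -
    have ne: "b + a * t \<noteq> 0" using False that by (force simp: line_def)
    have "a * (t - - (b / a)) = b + a * t" using a(2) by (simp add: field_simps)
    then have "inverse a / (t - - (b / a)) = inverse (b + a * t)"
      by (metis divide_inverse inverse_mult_distrib)
    then show ?thesis using ne by (simp add: invert_simps)
  qed
  then have "invert ` line a b = circle (inverse a) 0 (- (b / a))"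
    by (simp add: line_def circle_def image_image invert_simps(1) cong: image_cong)
  then show ?thesis
    using circle_circles[OF F_inverse[OF a(1)] _ F0 F_uminus[OF F_div[OF a(3,1)]] c] a(2) by simp
qed

text \<open>
  With \<open>e = c - a / b\<close> the inverse of \<open>b + a / (t - c)\<close> is \<open>1 / b - (a / b\<^sup>2) / (t - e)\<close>.  Hence the image is a
  circle if \<open>e \<notin> K\<close> and a line if \<open>e \<in> K\<close>.  For \<open>b = 0\<close> the circle passes through 0, and its image is a line.
\<close>

lemma invert_circles2:
  assumes a: "a \<in> F" "a \<noteq> 0" "b \<in> F" and c: "c \<in> F" "c \<notin> K"
  shows "invert ` circle a b c \<in> circles"
proof -
  have nc: "t - c \<noteq> 0" if "t \<in> K" for t using c that by auto
  show ?thesis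
  proof (cases "b = 0")
    case True
    have "invert (Some (b + a / (t - c))) = Some (- (c / a) + inverse a * t)" if "t \<in> K" for t
    proof -
      have "inverse (a / (t - c)) = - (c / a) + inverse a * t" using nc[OF that] a(2) by (simp add: field_simps)
      then show ?thesis using nc[OF that] a(2) True by (simp add: invert_simps)
    qed
    then have "invert ` circle a b c = line (inverse a) (- (c / a))"
      using True by (simp add: line_def circle_def image_image invert_simps(3) cong: image_cong)
    then show ?thesis using line_circles[OF F_inverse[OF a(1)] _ F_uminus[OF F_div[OF c(1) a(1)]]] a(2) by simp
  next
    case b: False
    define e where "e = c - a / b"
    have eF: "e \<in> F" unfolding e_def by (intro F_diff F_div a c)
    define a' where "a' = - (a / (b * b))"
    have a': "a' \<in> F" "a' \<noteq> 0" unfolding a'_def using a b by (auto intro!: F_uminus F_div F_mult)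
    have val: "b + a / (t - c) = b * (t - e) / (t - c)" if "t \<in> K" for t
      using nc[OF that] b by (simp add: e_def field_simps)
    have inv: "invert (Some (b + a / (t - c))) = Some (inverse b + a' / (t - e))" if t: "t \<in> K" "t \<noteq> e" for t
    proof -
      have te: "t - e \<noteq> 0" using t(2) by simp
      have tc: "t - c = (t - e) - a / b" by (simp add: e_def)
      have "((t - e) - a / b) / (b * (t - e)) = inverse b + a' / (t - e)"
        using te b by (simp add: a'_def field_simps)
      then have "inverse (b + a / (t - c)) = inverse b + a' / (t - e)"
        unfolding val[OF t(1)] inverse_divide unfolding tc .
      moreover have "b + a / (t - c) \<noteq> 0" unfolding val[OF t(1)] using nc[OF t(1)] te b by simp
      ultimately show ?thesis by (simp add: invert_simps)
    qed
    have ivb: "invert (Some b) = Some (inverse b)" using b by (simp add: invert_simps)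
    show ?thesis
    proof (cases "e \<in> K")
      case False
      then have "invert (Some (b + a / (t - c))) = Some (inverse b + a' / (t - e))" if "t \<in> K" for t
        using inv[OF that] that by auto
      then have "invert ` circle a b c = circle a' (inverse b) e"
        by (simp add: circle_def image_image ivb cong: image_cong)
      then show ?thesis using circle_circles[OF a' F_inverse[OF a(3)] eF False] by simp
    next
      case True
      have "invert ` circle a b c = line a' (inverse b)"
      proof
        show "invert ` circle a b c \<subseteq> line a' (inverse b)"
        proof (rule image_subsetI)
          fix z assume "z \<in> circle a b c"
          then consider "z = Some b" | t where "t \<in> K" "z = Some (b + a / (t - c))" by (auto simp: circle_def)
          then show "invert z \<in> line a' (inverse b)"
          proof cases
            case 1 then show ?thesis using K0 ivb by (force simp: line_def)
          next
            case 2
            show ?thesis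
            proof (cases "t = e")
              case True
              then have "z = Some 0" using 2 val[OF 2(1)] by simp
              then show ?thesis by (simp add: invert_simps line_def)
            next
              case False
              then have "invert z = Some (inverse b + a' * inverse (t - e))" using inv 2 by (simp add: divide_inverse)
              then show ?thesis unfolding line_def using K_inverse[OF K_diff[OF 2(1) True]] by blast
            qed
          qed
        qed
        show "line a' (inverse b) \<subseteq> invert ` circle a b c"
        proof
          fix z assume "z \<in> line a' (inverse b)"
          then consider "z = None" | "z = Some (inverse b)" | s where "s \<in> K" "s \<noteq> 0" "z = Some (inverse b + a' * s)"
            by (force simp: line_def)
          then show "z \<in> invert ` circle a b c"
          proof cases
            case 1
            have "b + a / (e - c) = 0" using val[OF True] by simp
            then have "invert (Some (b + a / (e - c))) = z" using 1 by (simp add: invert_simps)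
            then show ?thesis unfolding circle_def using True by blast
          next
            case 2
            then have "invert (Some b) = z" using ivb by simp
            then show ?thesis unfolding circle_def by blast
          next
            case 3
            have "e + inverse s \<in> K" using K_add[OF True K_inverse[OF 3(1)]] .
            moreover have "invert (Some (b + a / (e + inverse s - c))) = z"
              using inv[OF calculation] 3 by (simp add: divide_inverse)
            ultimately show ?thesis unfolding circle_def by blast
          qed
        qed
      qed
      then show ?thesis using line_circles[OF a' F_inverse[OF a(3)]] by simp
    qed
  qed
qed

lemma invert_circles: "B \<in> circles \<Longrightarrow> invert ` B \<in> circles"
  by (erule circles_cases) (simp_all add: invert_circles1 invert_circles2)

lemma translate_circles: 
  assumes "B \<in> circles" "x \<in> F" shows "translate x ` B \<in> circles"
  using assms(1)
proof (cases rule: circles_cases)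
  case (1 a b)
  have "translate x ` B = line a (b - x)" unfolding 1(1) by (simp add: line_def translate_def image_image algebra_simps)
  then show ?thesis using line_circles[OF 1(2,3) F_diff[OF 1(4) assms(2)]] by simp
next
  case (2 a b c)
  have "translate x ` B = circle a (b - x) c" unfolding 2(1) by (simp add: circle_def translate_def image_image algebra_simps)
  then show ?thesis using circle_circles[OF 2(2,3) F_diff[OF 2(4) assms(2)] 2(5,6)] by simp
qed

text \<open>
  An automorphism of the geometry that takes \<open>x\<close> to infinity, where all statements about blocks through a
  point become statements about lines.
\<close>

definition to_None :: "'a \<Rightarrow> 'a option \<Rightarrow> 'a option" where "to_None x p = invert (translate x p)"

lemma to_None_inverse: "translate (- x) (invert (to_None x p)) = p"
  by (simp add: to_None_def invert_invert translate_translate)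

lemma inj_to_None: "inj (to_None x)"
  by (rule inj_on_inverseI[where g = "\<lambda>p. translate (- x) (invert p)"]) (rule to_None_inverse)

lemma to_None_self: "to_None x (Some x) = None" by (simp add: to_None_def translate_def invert_simps)

lemma to_None_points: "x \<in> F \<Longrightarrow> p \<in> points \<Longrightarrow> to_None x p \<in> points"
  using F_diff F_inverse F0 by (auto simp: to_None_def translate_def points_def invert_def split: if_splits)

lemma to_None_circles: 
  assumes "x \<in> F" shows "image (to_None x) ` circles = circles"
proof
  show "image (to_None x) ` circles \<subseteq> circles"
  proof (rule image_subsetI)
    fix B assume "B \<in> circles"
    from invert_circles[OF translate_circles[OF this assms]] show "to_None x ` B \<in> circles"
      by (simp add: to_None_def image_image)
  qed
  show "circles \<subseteq> image (to_None x) ` circles"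
  proof
    fix B assume "B \<in> circles"
    then have "translate (- x) ` invert ` B \<in> circles" using translate_circles invert_circles F_uminus assms by blast
    moreover have "to_None x ` translate (- x) ` invert ` B = B"
      using translate_translate[of "- x"] by (simp add: to_None_def image_image invert_invert)
    ultimately show "B \<in> image (to_None x) ` circles" by (metis image_eqI)
  qed
qed

definition dir_at :: "'a option \<Rightarrow> 'a option set \<Rightarrow> 'a set" where
  "dir_at p B = (case p of None \<Rightarrow> direction B | Some x \<Rightarrow> direction (to_None x ` B))"

lemma ex1_to_None:
  assumes "x \<in> F" "\<exists>!B. B \<in> circles \<and> P B"
  shows "\<exists>!B. B \<in> circles \<and> P (to_None x ` B)"
proof -
  have "inj_on (image (to_None x)) circles" 
    using inj_to_None[of x] by (simp add: inj_on_def inj_image_eq_iff)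
  from ex1_image_iff[OF this, where P = P and Q = "\<lambda>B. P (to_None x ` B)"] show ?thesis
    using assms(2) to_None_circles[OF assms(1)] by simp
qed

theorem spherical_geometry: "resolvable_3design (card K) points circles dir_at"
  unfolding resolvable_3design_def
proof (intro conjI ballI allI impI)
  show "finite points" using fin by (simp add: points_def)
  show "B \<subseteq> points" "card B = Suc (card K)" if "B \<in> circles" for B
    using circles_points[OF that] card_circles[OF that] by blast+
next
  have tN: "\<exists>!B. B \<in> circles \<and> None \<in> B \<and> p \<in> B \<and> r \<in> B" 
    if pr: "p \<in> points" "r \<in> points" "p \<noteq> None" "r \<noteq> None" "p \<noteq> r" for p r
  proof -
    obtain y z where "p = Some y" "r = Some z" "y \<in> F" "z \<in> F" using pr(1-4) by (auto simp: points_def)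
    then show ?thesis using unique_line[of y z] pr(5) by simp
  qed
  fix T assume T: "T \<subseteq> points \<and> card T = 3"
  have "\<not> T \<subseteq> {None}" using T card_mono[of "{None}" T] by auto
  then obtain u where u: "u \<in> T" "u \<noteq> None" by blast
  show "\<exists>!B. B \<in> circles \<and> T \<subseteq> B"
  proof (cases "None \<in> T")
    case True
    obtain p r where pr: "T = {None,p,r}" "None \<noteq> p" "None \<noteq> r" "p \<noteq> r"
      using card3_with1[of T None] T True by metis
    then show ?thesis using tN[of p r] T by simp
  next
    case False
    obtain x where x: "u = Some x" using u(2) by auto
    obtain p r where pr: "T = {Some x,p,r}" "Some x \<noteq> p" "Some x \<noteq> r" "p \<noteq> r"
      using card3_with1[of T "Some x"] T u x by metis
    have xF: "x \<in> F" using T u x by (auto simp: points_def)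
    have "\<exists>!B. B \<in> circles \<and> None \<in> B \<and> to_None x p \<in> B \<and> to_None x r \<in> B"
    proof (rule tN)
      show "to_None x p \<in> points" "to_None x r \<in> points" using to_None_points[OF xF] T pr(1) by simp_all
      show "to_None x p \<noteq> None" "to_None x r \<noteq> None" "to_None x p \<noteq> to_None x r"
        using inj_to_None[of x] pr(2-4) to_None_self[of x] by (metis injD)+
    qed
    from ex1_to_None[OF xF this] have "\<exists>!B. B \<in> circles \<and> None \<in> to_None x ` B \<and> to_None x p \<in> to_None x ` B \<and> to_None x r \<in> to_None x ` B" .
    moreover have "to_None x s \<in> to_None x ` B \<longleftrightarrow> s \<in> B" for s B using inj_to_None by (rule inj_image_mem_iff)
    moreover have "None \<in> to_None x ` B \<longleftrightarrow> Some x \<in> B" for B using calculation(2)[of "Some x"] to_None_self by simp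
    ultimately show ?thesis using pr(1) by simp
  qed
next
  fix p B y assume p: "p \<in> points" and B: "B \<in> circles" "p \<in> B" and y: "y \<in> points - {p}"
  show "\<exists>!B'. B' \<in> circles \<and> p \<in> B' \<and> y \<in> B' \<and> dir_at p B' = dir_at p B"
  proof (cases p)
    case None
    then obtain z where "y = Some z" "z \<in> F" using y by (auto simp: points_def)
    then show ?thesis using unique_parallel[OF B(1)] B(2) None by (simp add: dir_at_def)
  next
    case (Some x)
    have xF: "x \<in> F" using p Some by (auto simp: points_def)
    have mem: "to_None x s \<in> to_None x ` B \<longleftrightarrow> s \<in> B" for s B using inj_to_None by (rule inj_image_mem_iff)
    have memN: "None \<in> to_None x ` B \<longleftrightarrow> Some x \<in> B" for B using mem[of "Some x"] to_None_self by simp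
    have "to_None x y \<noteq> None" using y Some inj_to_None[of x] to_None_self[of x] by (metis DiffD2 injD singletonI)
    moreover have "to_None x y \<in> points" using to_None_points[OF xF] y by blast
    ultimately obtain z where z: "to_None x y = Some z" "z \<in> F" by (auto simp: points_def)
    have "to_None x ` B \<in> circles" using to_None_circles[OF xF] B(1) by blast
    moreover have "None \<in> to_None x ` B" using memN B(2) Some by simp
    ultimately have "\<exists>!B'. B' \<in> circles \<and> None \<in> B' \<and> Some z \<in> B' \<and> direction B' = direction (to_None x ` B)"
      using unique_parallel z(2) by blast
    from ex1_to_None[OF xF this] show ?thesis
      unfolding Some dir_at_def option.case memN z(1)[symmetric] mem .
  qed
qed

lemma card_points: "card points = Suc (card F)"
  using fin by (simp add: points_def card_image)

end

section \<open>Finite fields inside an algebraic closure\<close>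

definition roots_of_frobenius :: "nat \<Rightarrow> 'a::field set" where
  "roots_of_frobenius q = {x. x ^ q = x}"

text \<open>
  The polynomial \<open>X ^ q - X\<close> has derivative -1 in characteristic dividing \<open>q\<close>; it has
  no repeated roots, and so it has as many roots as its degree in an algebraically closed field.
\<close>

lemma card_fixed_frobenius:
  assumes p: "prime CHAR('a::alg_closed_field)" and n: "0 < n"
  shows "card (roots_of_frobenius (CHAR('a) ^ n) :: 'a set) = CHAR('a) ^ n"
proof -
  let ?q = "CHAR('a) ^ n"
  have q1: "1 < ?q" using p n by (metis one_less_power prime_gt_1_nat)
  define f :: "'a poly" where "f = monom 1 ?q - monom 1 1"
  have "degree (- monom (1::'a) 1) < degree (monom (1::'a) ?q)" using q1 by (simp add: degree_monom_eq)
  then have "degree (monom (1::'a) ?q + - monom 1 1) = degree (monom (1::'a) ?q)" by (rule degree_add_eq_left)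
  then have "degree f = degree (monom (1::'a) ?q)" unfolding f_def diff_conv_add_uminus .
  then have deg: "degree f = ?q" by (simp add: degree_monom_eq)
  have "(of_nat ?q :: 'a) = 0" using n by (simp add: power_0_left)
  then have "pderiv f = - 1" using n by (simp add: f_def pderiv_diff pderiv_monom monom_0 one_pCons power_0_left)
  then have simple: "poly (pderiv f) x \<noteq> 0" for x by simp
  have f0: "f \<noteq> 0"
  proof
    assume "f = 0"
    then have "degree f = 0" by simp
    then show False using deg q1 by linarith
  qed
  obtain A where A: "size A = degree f" "f = Polynomial.smult (lead_coeff f) (\<Prod>x\<in>#A. [:- x, 1:])"
    using alg_closed_imp_factorization[OF f0] by blast
  (* A root of multiplicity two would be a root of the derivative. *)
  have "count A x \<le> 1" for x
  proof (rule ccontr)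
    assume "\<not> count A x \<le> 1"
    then have "replicate_mset 2 x \<subseteq># A" by (simp add: count_le_replicate_mset_subset_eq[symmetric])
    then obtain C where "A = replicate_mset 2 x + C" by (metis subset_mset.le_iff_add)
    then have "f = [:- x, 1:] * ([:- x, 1:] * Polynomial.smult (lead_coeff f) (\<Prod>x\<in>#C. [:- x, 1:]))"
      using A(2) by (simp add: numeral_2_eq_2 mult.assoc)
    then obtain h where "f = [:- x, 1:] * ([:- x, 1:] * h)" by blast
    then have "poly (pderiv f) x = 0" by (simp only: pderiv_mult poly_add poly_mult) simp
    then show False using simple by blast
  qed
  then have "count A x = 1" if "x \<in># A" for x
    using that by (metis One_nat_def count_greater_zero_iff le_antisym Suc_leI)
  then have "size A = card (set_mset A)" by (simp add: size_multiset_overloaded_eq)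
  moreover have "set_mset A = {x. poly f x = 0}"
  proof -
    have "poly f x = 0 \<longleftrightarrow> x \<in># A" for x
    proof -
      have "poly f x = lead_coeff f * (\<Prod>y\<in>#A. x - y)"
        by (subst A(2)) (simp add: poly_prod_mset image_mset.compositionality o_def)
      then show ?thesis using f0 by (auto simp: prod_mset_zero_iff)
    qed
    then show ?thesis by blast
  qed
  ultimately have "card {x. poly f x = 0} = degree f" using A(1) by simp
  moreover have "{x. poly f x = 0} = (roots_of_frobenius ?q :: 'a set)"
    by (auto simp: f_def poly_monom roots_of_frobenius_def)
  ultimately show ?thesis using deg by simp
qed

lemma frobenius_closed:
  fixes n :: nat and x y :: "'a::field"
  assumes p: "prime CHAR('a)"
  defines "F \<equiv> roots_of_frobenius (CHAR('a) ^ n) :: 'a set"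
  shows "0 \<in> F" "1 \<in> F" "x \<in> F \<Longrightarrow> y \<in> F \<Longrightarrow> x + y \<in> F" "x \<in> F \<Longrightarrow> - x \<in> F"
    "x \<in> F \<Longrightarrow> y \<in> F \<Longrightarrow> x * y \<in> F" "x \<in> F \<Longrightarrow> inverse x \<in> F"
proof -
  have add: "(x + y) ^ (CHAR('a) ^ n) = x ^ (CHAR('a) ^ n) + y ^ (CHAR('a) ^ n)" for x y :: 'a
    by (rule freshmans_dream'[OF p refl])
  have z: "(0::'a) ^ (CHAR('a) ^ n) = 0" using p by (simp add: power_0_left prime_gt_0_nat)
  show "0 \<in> F" "1 \<in> F" using z by (simp_all add: F_def roots_of_frobenius_def)
  show "x \<in> F \<Longrightarrow> y \<in> F \<Longrightarrow> x + y \<in> F" by (simp add: F_def roots_of_frobenius_def add)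
  show "- x \<in> F" if "x \<in> F"
  proof -
    have "x + (- x) ^ (CHAR('a) ^ n) = 0" using add[of x "- x"] that z by (simp add: F_def roots_of_frobenius_def)
    then show ?thesis by (simp add: F_def roots_of_frobenius_def add_eq_0_iff)
  qed
  show "x \<in> F \<Longrightarrow> y \<in> F \<Longrightarrow> x * y \<in> F" by (simp add: F_def roots_of_frobenius_def power_mult_distrib)
  show "x \<in> F \<Longrightarrow> inverse x \<in> F" by (simp add: F_def roots_of_frobenius_def power_inverse)
qed

lemma frobenius_mono: "roots_of_frobenius (q ^ 1) \<subseteq> roots_of_frobenius (q ^ n)"
proof
  fix x assume "x \<in> roots_of_frobenius (q ^ 1)"
  then have "x ^ (q ^ n) = x" by (induction n) (simp_all add: roots_of_frobenius_def power_mult)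
  then show "x \<in> roots_of_frobenius (q ^ n)" by (simp add: roots_of_frobenius_def)
qed

text \<open>
  Index types for the fields of residues modulo 7 and 13.
\<close>

typedef seven = "{..<7::nat}" by (rule exI[of _ 0]) simp
typedef thirteen = "{..<13::nat}" by (rule exI[of _ 0]) simp

lemma card_seven: "CARD(seven) = 7" using type_definition.card[OF type_definition_seven] by simp
lemma card_thirteen: "CARD(thirteen) = 13" using type_definition.card[OF type_definition_thirteen] by simp

instance seven :: prime_card by standard (simp add: card_seven)
instance thirteen :: prime_card by standard (simp add: card_thirteen)

lemma CHAR_mod_ring: "CHAR('a::prime_card mod_ring) = CARD('a)"
proof (rule CHAR_eqI)
  show "of_nat CARD('a) = (0 :: 'a mod_ring)" by simp
  show "CARD('a) dvd n" if "of_nat n = (0 :: 'a mod_ring)" for n using of_nat_0_mod_ring_dvd[OF that] .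
qed

section \<open>Recognising a resolvable design from a list of its classes\<close>

type_synonym triple = "int \<times> int \<times> int"

fun points :: "triple \<Rightarrow> int set" where "points (x,y,z) = {x,y,z}"

fun on :: "int \<Rightarrow> triple \<Rightarrow> bool" where "on a (x,y,z) \<longleftrightarrow> a = x \<or> a = y \<or> a = z"

lemma on_points: "on a t \<longleftrightarrow> a \<in> points t" by (cases t) simp

definition sorted_transverse :: "int \<Rightarrow> (int \<Rightarrow> int) \<Rightarrow> int \<Rightarrow> triple \<Rightarrow> bool" where
  "sorted_transverse v g p t = (case t of (x,y,z) \<Rightarrow> 0 \<le> x \<and> x < y \<and> y < z \<and> z < v \<and>
     g x \<noteq> g y \<and> g x \<noteq> g z \<and> g y \<noteq> g z \<and> g x \<noteq> g p \<and> g y \<noteq> g p \<and> g z \<noteq> g p)"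

text \<open>
  The list \<open>rows\<close> holds the triples through \<open>a\<close>, class by class.
\<close>

definition row_ok :: "(int \<Rightarrow> int) \<Rightarrow> int list \<Rightarrow> int \<Rightarrow> triple list list \<Rightarrow> bool" where
  "row_ok g Y a rows \<longleftrightarrow> list_all (\<lambda>l. length l = 1) rows \<and>
     list_all (\<lambda>b. g b = g a \<or> list_ex (list_ex (on b)) rows) Y \<and>
     length (filter (\<lambda>b. g b \<noteq> g a) Y) = length rows + length rows"

definition others :: "int \<Rightarrow> (int \<Rightarrow> int) \<Rightarrow> int \<Rightarrow> int list" where
  "others v g p = filter (\<lambda>y. g y \<noteq> g p) [0..v - 1]"

definition check_rows :: "(int \<Rightarrow> int) \<Rightarrow> int list \<Rightarrow> triple list list \<Rightarrow> bool" where
  "check_rows g Y R \<longleftrightarrow> list_all (\<lambda>a. row_ok g Y a (map (filter (on a)) R)) Y"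

definition check_triples :: "int \<Rightarrow> (int \<Rightarrow> int) \<Rightarrow> int \<Rightarrow> triple list list \<Rightarrow> bool" where
  "check_triples v g p R \<longleftrightarrow> list_all (list_all (sorted_transverse v g p)) R"

definition triples :: "triple list list \<Rightarrow> int set set" where
  "triples R = (\<Union>C\<in>set R. points ` set C)"

definition class_index :: "triple list list \<Rightarrow> int set \<Rightarrow> nat" where
  "class_index R T = (THE i. i < length R \<and> T \<in> points ` set (R ! i))"

lemma triples_nth: "T \<in> triples R \<longleftrightarrow> (\<exists>i<length R. T \<in> points ` set (R ! i))"
proof -
  have "T \<in> triples R \<longleftrightarrow> (\<exists>C\<in>set R. T \<in> points ` set C)" by (simp add: triples_def)
  also have "\<dots> \<longleftrightarrow> (\<exists>i<length R. T \<in> points ` set (R ! i))" by (metis in_set_conv_nth)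
  finally show ?thesis .
qed

text \<open>
  The list \<open>R\<close> contains the parallel classes.  The check for a point \<open>a\<close> demands one triple through \<open>a\<close> in every
  class, that these triples reach every point of another group, and that there are exactly two such points for each
  class.  By counting, no point is reached twice, which gives uniqueness of the triple on a pair.
\<close>

lemma check_rgdd:
  assumes ct: "check_triples v g p R" and cr: "check_rows g (others v g p) R"
  shows "rgdd (length R) {y\<in>{0..<v}. g y \<noteq> g p} g (class_index R) (triples R)"
    and "\<And>i t. i < length R \<Longrightarrow> t \<in> set (R ! i) \<Longrightarrow> class_index R (points t) = i"
proof -
  let ?Y = "{y\<in>{0..<v}. g y \<noteq> g p}" and ?k = "length R"
  have Y: "set (others v g p) = ?Y" "distinct (others v g p)" by (auto simp: others_def)
  have good: "sorted_transverse v g p t" if "i < ?k" "t \<in> set (R ! i)" for i t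
    using ct nth_mem[OF that(1)] that(2) unfolding check_triples_def list_all_iff by blast
  have pt: "points t \<subseteq> ?Y" "card (points t) = 3" "inj_on g (points t)" if "i < ?k" "t \<in> set (R ! i)" for i t
    using good[OF that] by (auto simp: sorted_transverse_def split: prod.splits)
  have row: "row_ok g (others v g p) a (map (filter (on a)) R)" if "a \<in> ?Y" for a
    using cr that Y(1) unfolding check_rows_def list_all_iff by blast
  have ex1: "\<exists>t. filter (on a) (R ! i) = [t]" if "a \<in> ?Y" "i < ?k" for a i
    using row[OF that(1)] that(2) unfolding row_ok_def list_all_length by (auto simp: length_Suc_conv)
  define \<tau> where "\<tau> a i = (SOME t. filter (on a) (R ! i) = [t])" for a i
  have \<tau>: "filter (on a) (R ! i) = [\<tau> a i]" if "a \<in> ?Y" "i < ?k" for a i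
    unfolding \<tau>_def by (rule someI_ex[OF ex1[OF that]])
  have \<tau>_in: "\<tau> a i \<in> set (R ! i)" "a \<in> points (\<tau> a i)" if "a \<in> ?Y" "i < ?k" for a i
  proof -
    have "\<tau> a i \<in> set (filter (on a) (R ! i))" unfolding \<tau>[OF that] by simp
    then show "\<tau> a i \<in> set (R ! i)" "a \<in> points (\<tau> a i)" by (simp_all add: on_points)
  qed
  have \<tau>_eq: "t = \<tau> a i" if "a \<in> ?Y" "i < ?k" "t \<in> set (R ! i)" "a \<in> points t" for a i t
  proof -
    have "t \<in> set (filter (on a) (R ! i))" using that by (simp add: on_points)
    then show ?thesis unfolding \<tau>[OF that(1,2)] by simp
  qed
  define E where "E a = {b\<in>?Y. g b \<noteq> g a}" for a
  have finE: "finite (E a)" for a by (rule finite_subset[of _ "{0..<v}"]) (auto simp: E_def)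
  have cardE: "card (E a) = ?k + ?k" if "a \<in> ?Y" for a
  proof -
    have "set (filter (\<lambda>b. g b \<noteq> g a) (others v g p)) = E a" using Y(1) by (auto simp: E_def)
    then have "card (E a) = length (filter (\<lambda>b. g b \<noteq> g a) (others v g p))"
      using distinct_card[OF distinct_filter[OF Y(2)], of "\<lambda>b. g b \<noteq> g a"] by simp
    then show ?thesis using row[OF that] by (simp add: row_ok_def)
  qed
  have E_ex: "\<exists>i<?k. b \<in> points (\<tau> a i)" if a: "a \<in> ?Y" and b: "b \<in> E a" for a b
  proof -
    have "b \<in> set (others v g p)" "g b \<noteq> g a" using b Y(1) by (auto simp: E_def)
    then have "list_ex (list_ex (on b)) (map (filter (on a)) R)"
      using row[OF a] unfolding row_ok_def list_all_iff by blast
    then obtain C t where t: "C \<in> set R" "t \<in> set C" "on a t" "on b t"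
      unfolding list_ex_iff by auto
    obtain i where i: "i < ?k" "R ! i = C" using t(1) by (auto simp: in_set_conv_nth)
    have "t = \<tau> a i" using \<tau>_eq[OF a i(1)] t i(2) by (simp add: on_points)
    then show ?thesis using i(1) t(4) on_points by blast
  qed
  have E_unique: "i = j" if a: "a \<in> ?Y" and b: "b \<in> E a"
    and ij: "i < ?k" "j < ?k" "b \<in> points (\<tau> a i)" "b \<in> points (\<tau> a j)" for a b i j
  proof (rule ccontr)
    assume "i \<noteq> j"
    let ?I = "\<lambda>b. {i\<in>{..<?k}. b \<in> points (\<tau> a i)}"
    have ge: "1 \<le> card (?I b')" if "b' \<in> E a" for b'
    proof -
      have "?I b' \<noteq> {}" using E_ex[OF a that] by blast
      then show ?thesis by (simp add: Suc_leI card_gt_0_iff)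
    qed
    have "card {i,j} \<le> card (?I b)" by (rule card_mono) (use ij in auto)
    then have gt: "1 < card (?I b)" using \<open>i \<noteq> j\<close> by simp
    (* The triples on a have 2 * k places besides a, and E a has 2 * k points, so no place is spared for a repetition. *)
    have "(\<Sum>b'\<in>E a. 1) < (\<Sum>b'\<in>E a. card (?I b'))"
      by (rule sum_strict_mono_ex1[OF finE]) (use ge gt b in auto)
    moreover have "(\<Sum>b'\<in>E a. card (?I b')) = (\<Sum>i<?k. card {b'\<in>E a. b' \<in> points (\<tau> a i)})"
      by (rule sum_multicount_gen) (use finE in auto)
    moreover have "(\<Sum>i<?k. card {b'\<in>E a. b' \<in> points (\<tau> a i)}) \<le> (\<Sum>i<?k. 2)"
    proof (rule sum_mono)
      fix l assume "l \<in> {..<?k}"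
      then have l: "l < ?k" by simp
      have "{b'\<in>E a. b' \<in> points (\<tau> a l)} \<subseteq> points (\<tau> a l) - {a}" by (auto simp: E_def)
      moreover have "card (points (\<tau> a l) - {a}) = 2" "finite (points (\<tau> a l))"
        using pt(2)[OF l \<tau>_in(1)[OF a l]] \<tau>_in(2)[OF a l] by (simp_all add: card_Diff_singleton) (auto intro: card_ge_0_finite)
      ultimately show "card {b'\<in>E a. b' \<in> points (\<tau> a l)} \<le> 2" by (metis card_mono finite_Diff)
    qed
    ultimately show False using cardE[OF a] by simp
  qed
  have same_class: "i = j" if it: "i < ?k" "t \<in> set (R ! i)" and jt: "j < ?k" "t' \<in> set (R ! j)" and eq: "points t = points t'" for i j t t'
  proof -
    obtain a b z where abz: "points t = {a,b,z}" "a \<noteq> b" "a \<noteq> z" "b \<noteq> z" using card3_obtain[OF pt(2)[OF it]] .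
    have a: "a \<in> ?Y" "b \<in> ?Y" using pt(1)[OF it] abz(1) by auto
    have "g a \<noteq> g b" using pt(3)[OF it] abz(1,2) by (auto simp: inj_on_def)
    then have b: "b \<in> E a" using a by (auto simp: E_def)
    have "t = \<tau> a i" "t' = \<tau> a j" using \<tau>_eq[OF a(1) it] \<tau>_eq[OF a(1) jt] abz(1) eq by auto
    moreover have "b \<in> points t" "b \<in> points t'" using abz(1) eq by auto
    ultimately show ?thesis using E_unique[OF a(1) b it(1) jt(1)] by simp
  qed
  show cls: "class_index R (points t) = i" if "i < ?k" "t \<in> set (R ! i)" for i t
    unfolding class_index_def by (rule the_equality) (use that same_class in blast)+
  show "rgdd ?k ?Y g (class_index R) (triples R)" unfolding rgdd_def
  proof (intro conjI ballI impI allI)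
    fix T assume "T \<in> triples R"
    then obtain i t where it: "i < ?k" "t \<in> set (R ! i)" "T = points t" unfolding triples_nth by blast
    show "T \<subseteq> ?Y" "card T = 3" "inj_on g T" using pt[OF it(1,2)] it(3) by simp_all
    show "class_index R T < ?k" using cls[OF it(1,2)] it(1,3) by simp
  next
    fix a b assume ab: "a \<in> ?Y" "b \<in> ?Y" "g a \<noteq> g b"
    then have b: "b \<in> E a" by (auto simp: E_def)
    obtain i where i: "i < ?k" "b \<in> points (\<tau> a i)" using E_ex[OF ab(1) b] by blast
    show "\<exists>!T. T \<in> triples R \<and> a \<in> T \<and> b \<in> T"
    proof (rule ex1I[of _ "points (\<tau> a i)"])
      show "points (\<tau> a i) \<in> triples R \<and> a \<in> points (\<tau> a i) \<and> b \<in> points (\<tau> a i)"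
        using i \<tau>_in[OF ab(1) i(1)] unfolding triples_nth by blast
      fix T assume T: "T \<in> triples R \<and> a \<in> T \<and> b \<in> T"
      then obtain j t where jt: "j < ?k" "t \<in> set (R ! j)" "T = points t" unfolding triples_nth by blast
      have t: "t = \<tau> a j" using \<tau>_eq[OF ab(1) jt(1,2)] T jt(3) by simp
      then have "j = i" using E_unique[OF ab(1) b jt(1) i(1)] T jt(3) i(2) by simp
      then show "T = points (\<tau> a i)" using t jt(3) by simp
    qed
  next
    fix i a assume i: "i < ?k" and a: "a \<in> ?Y"
    show "\<exists>!T. T \<in> triples R \<and> class_index R T = i \<and> a \<in> T"
    proof (rule ex1I[of _ "points (\<tau> a i)"])
      show "points (\<tau> a i) \<in> triples R \<and> class_index R (points (\<tau> a i)) = i \<and> a \<in> points (\<tau> a i)"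
        using \<tau>_in[OF a i] cls[OF i \<tau>_in(1)[OF a i]] i unfolding triples_nth by blast
      fix T assume T: "T \<in> triples R \<and> class_index R T = i \<and> a \<in> T"
      then obtain j t where jt: "j < ?k" "t \<in> set (R ! j)" "T = points t" unfolding triples_nth by blast
      have "j = i" using cls[OF jt(1,2)] T jt(3) by simp
      then show "T = points (\<tau> a i)" using \<tau>_eq[OF a jt(1,2)] T jt(3) by simp
    qed
  qed
qed

text \<open>
  For a block \<open>{0, x, y, z}\<close> with \<open>0 < x < y < z\<close>, the translation by \<open>- x\<close> gives a block through 0 whose other points
  come out in increasing order again.  Iterating this map moves each point of the block to 0 in turn.  The value \<open>m\<close>
  stands for the fixed point.
\<close>

fun cyc_exch :: "int \<Rightarrow> triple \<Rightarrow> triple" where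
  "cyc_exch m (x,y,z) = (if z < m then (y - x, z - x, m - x) else (y - x, m - x, z))"

definition listed :: "triple list list \<Rightarrow> triple \<Rightarrow> bool" where
  "listed R t = list_ex (\<lambda>C. List.member C t) R"

definition check_exch :: "int \<Rightarrow> triple list list \<Rightarrow> bool" where
  "check_exch m R \<longleftrightarrow> list_all (list_all (\<lambda>t. listed R (cyc_exch m t))) R"

text \<open>
  The triples with the fixed point; restricting the search to them keeps the verification by rewriting short.
\<close>

definition at_fixed :: "int \<Rightarrow> triple list list \<Rightarrow> triple list list" where
  "at_fixed m R = map (filter (\<lambda>(x,y,z). z = m)) R"

definition check_fixed :: "int \<Rightarrow> triple list list \<Rightarrow> triple list list \<Rightarrow> bool" where
  "check_fixed m F R' \<longleftrightarrow> list_all (list_all (\<lambda>(x,y,z). listed F (y - x, z - x, m))) R'"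

lemma listed_triples: "listed R t \<Longrightarrow> points t \<in> triples R"
  by (auto simp: listed_def triples_def list_ex_iff)

lemma listed_set: "C \<in> set R \<Longrightarrow> t \<in> set C \<Longrightarrow> listed R t"
  by (auto simp: listed_def list_ex_iff)

lemma listed_exch: "check_exch m R \<Longrightarrow> listed R t \<Longrightarrow> listed R (cyc_exch m t)"
  by (auto simp: check_exch_def listed_def list_ex_iff list_all_iff)

lemma listed_sorted: "check_triples v g p R \<Longrightarrow> listed R t \<Longrightarrow> sorted_transverse v g p t"
  by (auto simp: check_triples_def listed_def list_ex_iff list_all_iff)

lemma sub_mod:
  assumes "0 \<le> u" "u < m" "0 \<le> w" "w < (m::int)"
  shows "((- u) mod m + w) mod m = (if u \<le> w then w - u else m + w - u)"
proof -
  have "((- u) mod m + w) mod m = (w - u) mod m" by (simp add: mod_add_left_eq)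
  also have "\<dots> = (if u \<le> w then w - u else m + w - u)"
  proof (cases "u \<le> w")
    case True
    then show ?thesis using assms by simp
  next
    case False
    have "(w - u) mod m = (w - u + m) mod m" by simp
    also have "\<dots> = w - u + m" by (rule mod_pos_pos_trivial) (use False assms in auto)
    finally show ?thesis using False by simp
  qed
  finally show ?thesis .
qed

lemma cyclic_development:
  assumes "0 < (m::int)" "N \<subseteq> {m}"
  shows "development {0..<m} N (\<lambda>x y. (x + y) mod m) (\<lambda>x. (- x) mod m) 0"
proof
  show "finite ({0..<m} \<union> N)" using assms(2) finite_subset by auto
  show "{0..<m} \<inter> N = {}" "\<And>x y. x \<in> N \<Longrightarrow> y \<in> N \<Longrightarrow> x = y" using assms by auto
  show "\<And>x y z. (x + (y + z) mod m) mod m = ((x + y) mod m + z) mod m"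
    by (simp add: mod_simps add.assoc)
qed (use assms in \<open>auto simp: add.commute mod_simps\<close>)

lemma cyclic_exchange:
  assumes m: "0 < m" and N: "N \<subseteq> {m}" and v: "v \<le> m + 1" and ct: "check_triples v g 0 R" and ce: "check_exch m R"
    and T: "T \<in> triples R" "u \<in> T" "u \<in> {0..<m}"
  shows "development.shift {0..<m} (\<lambda>x y. (x + y) mod m) ((- u) mod m) ` (insert 0 T - {u}) \<in> triples R"
proof -
  interpret development "{0..<m}" N "\<lambda>x y. (x + y) mod m" "\<lambda>x. (- x) mod m" 0
    by (rule cyclic_development[OF m N])
  obtain C x y z where t: "C \<in> set R" "(x,y,z) \<in> set C" "T = {x,y,z}" using T(1) by (auto simp: triples_def)
  have L0: "listed R (x,y,z)" using listed_set t by blast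
  note L1 = listed_exch[OF ce L0]
  note L2 = listed_exch[OF ce L1]
  note L3 = listed_exch[OF ce L2]
  have s: "0 < x" "x < y" "y < z" "z < v"
    using listed_sorted[OF ct L0] by (auto simp: sorted_transverse_def intro: le_neq_trans)
  have sh: "shift ((- u) mod m) w = (if w < m then if u \<le> w then w - u else m + w - u else w)" if "0 \<le> w" "w \<le> m" for w
    using sub_mod[of u m w] T(3) that by (simp add: shift_def)
  consider "u = x" | "u = y" | "u = z" "z < m" using T(2,3) t(3) by auto
  then show ?thesis
  proof cases
    case 1
    then have e: "insert 0 T - {u} = {0,y,z}" using t(3) s by auto
    have "shift ((- u) mod m) ` {0,y,z} = points (cyc_exch m (x,y,z))"
      using sh[of 0] sh[of y] sh[of z] s v m 1 by auto
    then show ?thesis unfolding e using listed_triples[OF L1] by simp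
  next
    case 2
    then have e: "insert 0 T - {u} = {0,x,z}" using t(3) s by auto
    have "shift ((- u) mod m) ` {0,x,z} = points (cyc_exch m (cyc_exch m (x,y,z)))"
      using sh[of 0] sh[of x] sh[of z] s v m 2 by auto
    then show ?thesis unfolding e using listed_triples[OF L2] by simp
  next
    case 3
    then have e: "insert 0 T - {u} = {0,x,y}" using t(3) s by auto
    have "shift ((- u) mod m) ` {0,x,y} = points (cyc_exch m (cyc_exch m (cyc_exch m (x,y,z))))"
      using sh[of 0] sh[of x] sh[of y] s v m 3 by auto
    then show ?thesis unfolding e using listed_triples[OF L3] by simp
  qed
qed

lemma fixed_exchange:
  assumes m: "0 < m" and ct: "check_triples (m + 1) (\<lambda>x. x) m R'" and ce: "check_exch m R" 
    and cf: "check_fixed m (at_fixed m R) R'" and T: "T \<in> triples R'" "u \<in> T"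
  shows "development.shift {0..<m} (\<lambda>x y. (x + y) mod m) ((- u) mod m) ` (insert m T - {u}) \<in> triples R"
proof -
  interpret development "{0..<m}" "{m}" "\<lambda>x y. (x + y) mod m" "\<lambda>x. (- x) mod m" 0
    by (rule cyclic_development[OF m]) simp
  obtain C x y z where t: "C \<in> set R'" "(x,y,z) \<in> set C" "T = {x,y,z}" using T(1) by (auto simp: triples_def)
  have "listed (at_fixed m R) (y - x, z - x, m)" using cf t unfolding check_fixed_def list_all_iff by fastforce
  then have L0: "listed R (y - x, z - x, m)" by (auto simp: listed_def at_fixed_def list_ex_iff)
  note L1 = listed_exch[OF ce L0]
  note L2 = listed_exch[OF ce L1]
  have s: "0 \<le> x" "x < y" "y < z" "z < m"
    using listed_sorted[OF ct listed_set[OF t(1,2)]] by (auto simp: sorted_transverse_def)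
  then have u: "0 \<le> u" "u < m" using T(2) t(3) by auto
  have sh: "shift ((- u) mod m) w = (if w < m then if u \<le> w then w - u else m + w - u else w)" if "0 \<le> w" "w \<le> m" for w
    using sub_mod[of u m w] u that by (simp add: shift_def)
  consider "u = x" | "u = y" | "u = z" using T(2) t(3) by auto
  then show ?thesis
  proof cases
    case 1
    then have e: "insert m T - {u} = {m,y,z}" using t(3) s by auto
    have "shift ((- u) mod m) ` {m,y,z} = points (y - x, z - x, m)"
      using sh[of m] sh[of y] sh[of z] s m 1 by auto
    then show ?thesis unfolding e using listed_triples[OF L0] by simp
  next
    case 2
    then have e: "insert m T - {u} = {m,x,z}" using t(3) s by auto
    have "shift ((- u) mod m) ` {m,x,z} = points (cyc_exch m (y - x, z - x, m))"
      using sh[of m] sh[of x] sh[of z] s m 2 by auto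
    then show ?thesis unfolding e using listed_triples[OF L1] by simp
  next
    case 3
    then have e: "insert m T - {u} = {m,x,y}" using t(3) s by auto
    have "shift ((- u) mod m) ` {m,x,y} = points (cyc_exch m (cyc_exch m (y - x, z - x, m)))"
      using sh[of m] sh[of x] sh[of y] s m 3 by auto
    then show ?thesis unfolding e using listed_triples[OF L2] by simp
  qed
qed

definition check_last :: "int \<Rightarrow> triple list \<Rightarrow> bool" where
  "check_last q C \<longleftrightarrow> list_all (\<lambda>x. List.member C (x, x + q, x + 2 * q)) [0..q - 1]"

text \<open>
  The group of order 24 that is the product of an elementary abelian group of order 8 and a cyclic group of order
  3: the residue modulo 8 and the quotient are the two components.
\<close>

definition xadd :: "int \<Rightarrow> int \<Rightarrow> int" where
  "xadd x y = xor (x mod 8) (y mod 8) + 8 * ((x div 8 + y div 8) mod 3)"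
definition xneg :: "int \<Rightarrow> int" where
  "xneg x = x mod 8 + 8 * ((- (x div 8)) mod 3)"

definition some_on :: "triple list list \<Rightarrow> int \<Rightarrow> int \<Rightarrow> int \<Rightarrow> bool" where
  "some_on R a b c = list_ex (list_ex (\<lambda>t. on a t \<and> on b t \<and> on c t)) R"

definition check_xexch :: "triple list list \<Rightarrow> bool" where
  "check_xexch R = list_all (list_all (\<lambda>(x,y,z).
     some_on R (xadd (xneg x) 0) (xadd (xneg x) y) (xadd (xneg x) z) \<and>
     some_on R (xadd (xneg y) 0) (xadd (xneg y) x) (xadd (xneg y) z) \<and>
     some_on R (xadd (xneg z) 0) (xadd (xneg z) x) (xadd (xneg z) y))) R"

section \<open>The small designs with fibres of three points\<close>

text \<open>
  The points are numbered so that the fibre of a point is its residue modulo \<open>n\<close>.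
\<close>

definition fibred_design :: "nat \<Rightarrow> nat \<Rightarrow> bool" where
  "fibred_design n k \<longleftrightarrow> (\<exists>\<H>. quad_design {0..<3 * int n} (\<lambda>x. x mod int n) \<H> \<and>
     (\<forall>p\<in>{0..<3 * int n}. \<exists>c. rgdd k {y\<in>{0..<3 * int n}. y mod int n \<noteq> p mod int n} (\<lambda>x. x mod int n) c (derived_blocks \<H> p)))"

text \<open>
  The number \<open>3 * q\<close> plays the role of the point at infinity, and the residues modulo \<open>q\<close> are the fibres.
\<close>

definition fibred_SQS :: "nat \<Rightarrow> nat \<Rightarrow> bool" where
  "fibred_SQS q k \<longleftrightarrow> (\<exists>\<Q>. quad_design {0..3 * int q} (\<lambda>x. x) \<Q> \<and>
     (\<forall>x\<in>{0..<int q}. {3 * int q, x, x + int q, x + 2 * int q} \<in> \<Q>) \<and>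
     (\<exists>c. rgdd k {0..<3 * int q} (\<lambda>x. x mod int q) c
        (derived_blocks \<Q> (3 * int q) - (\<lambda>x. {x, x + int q, x + 2 * int q}) ` {0..<int q})) \<and>
     (\<forall>p\<in>{0..<3 * int q}. \<exists>c. rgdd (Suc k) ({0..3 * int q} - {p}) (\<lambda>x. x) c (derived_blocks \<Q> p)))"

lemma mod_shift_eq: "(y + x) mod n = (y + x') mod (n::int) \<longleftrightarrow> x mod n = x' mod n"
  by (simp add: mod_eq_dvd_iff)

lemma fibred_design_cyclic:
  assumes n: "0 < n" and m: "m = 3 * int n"
    and ct: "check_triples m (\<lambda>x. x mod int n) 0 R" and cr: "check_rows (\<lambda>x. x mod int n) (others m (\<lambda>x. x mod int n) 0) R"
    and ce: "check_exch m R"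
  shows "fibred_design n (length R)"
proof -
  let ?g = "\<lambda>x. x mod int n"
  have m0: "0 < m" using n m by simp
  interpret development "{0..<m}" "{}" "\<lambda>x y. (x + y) mod m" "\<lambda>x. (- x) mod m" 0 ?g "triples R" "{}" "length R"
    by (rule cyclic_development[OF m0]) simp
  interpret developed_design "{0..<m}" "{}" "\<lambda>x y. (x + y) mod m" "\<lambda>x. (- x) mod m" 0 ?g "triples R" "{}" "length R" "class_index R" "class_index R"
  proof
    show "?g (shift y x) = ?g (shift y x') \<longleftrightarrow> ?g x = ?g x'" if "y \<in> {0..<m}" "x \<in> {0..<m} \<union> {}" "x' \<in> {0..<m} \<union> {}" for y x x'
    proof -
      have "?g (shift y z) = (y + z) mod int n" if "z \<in> {0..<m}" for z
      proof -
        have "shift y z = (y + z) mod m" using that by (simp only: shift_def if_True)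
        then show ?thesis using m by (simp add: mod_mod_cancel)
      qed
      then show ?thesis using that mod_shift_eq by simp
    qed
    show "rgdd (length R) {y\<in>{0..<m} \<union> {}. ?g y \<noteq> ?g 0} ?g (class_index R) (triples R)"
      using check_rgdd(1)[OF ct cr] by simp
    show "shift ((- u) mod m) ` (insert 0 T - {u}) \<in> triples R" if "T \<in> triples R" "u \<in> T" "u \<in> {0..<m}" for T u
      by (rule cyclic_exchange[OF m0 _ _ ct ce that, of "{}"]) simp_all
  qed auto
  have D: "\<exists>c. rgdd (length R) {y\<in>{0..<m}. ?g y \<noteq> ?g p} ?g c (derived_blocks blocks p)" if "p \<in> {0..<m}" for p
    using rgdd_D[of p] derived_developed[of p] that by simp
  have Q: "quad_design {0..<m} ?g blocks" using developed_quad_design by simp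
  show ?thesis unfolding fibred_design_def m[symmetric] using Q D by blast
qed

text \<open>
  The last class of \<open>R'\<close> consists of the cosets of the subgroup of order three of the integers modulo \<open>3 * q\<close>;
  these cosets are the fibres.
\<close>

lemma fibred_SQS_cyclic:
  assumes q: "0 < q" and m: "m = 3 * int q" and len: "length R = Suc k" "length R' = Suc k"
    and ct: "check_triples (m + 1) (\<lambda>x. x) 0 R" and cr: "check_rows (\<lambda>x. x) (others (m + 1) (\<lambda>x. x) 0) R"
    and ce: "check_exch m R"
    and ct': "check_triples (m + 1) (\<lambda>x. x) m R'" and cr': "check_rows (\<lambda>x. x) (others (m + 1) (\<lambda>x. x) m) R'"
    and cf: "check_fixed m (at_fixed m R) R'"
    and last: "check_last (int q) (last R')"
  shows "fibred_SQS q k"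
proof -
  let ?g = "\<lambda>x::int. x"
  have m0: "0 < m" using q m by simp
  have X: "{0..<m} \<union> {m} = {0..m}" "{0..<m + 1} = {0..m}" using m0 by auto
  interpret development "{0..<m}" "{m}" "\<lambda>x y. (x + y) mod m" "\<lambda>x. (- x) mod m" 0 ?g "triples R" "triples R'" "Suc k"
    by (rule cyclic_development[OF m0]) simp
  note r' = check_rgdd[OF ct' cr']
  interpret developed_design "{0..<m}" "{m}" "\<lambda>x y. (x + y) mod m" "\<lambda>x. (- x) mod m" 0 ?g "triples R" "triples R'" "Suc k" "class_index R" "class_index R'"
  proof
    show "?g (shift y x) = ?g (shift y x') \<longleftrightarrow> ?g x = ?g x'" if "y \<in> {0..<m}" for y x x'
      by (rule shift_inj[OF that])
    show "rgdd (Suc k) {y\<in>{0..<m} \<union> {m}. ?g y \<noteq> ?g 0} ?g (class_index R) (triples R)"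
      using check_rgdd(1)[OF ct cr] unfolding X len .
    show "rgdd (Suc k) {y\<in>{0..<m} \<union> {m}. ?g y \<noteq> ?g e} ?g (class_index R') (triples R')" if "e \<in> {m}" for e
      using r'(1) that unfolding X len by simp
    show "shift ((- u) mod m) ` (insert 0 T - {u}) \<in> triples R" if "T \<in> triples R" "u \<in> T" "u \<in> {0..<m}" for T u
      by (rule cyclic_exchange[OF m0 _ _ ct ce that, of "{m}"]) simp_all
    show "shift ((- u) mod m) ` (insert e T - {u}) \<in> triples R" if "e \<in> {m}" "T \<in> triples R'" "u \<in> T" for e T u
      using fixed_exchange[OF m0 ct' ce cf that(2,3)] that(1) by simp
  qed
  let ?G = "\<lambda>x. {x, x + int q, x + 2 * int q}"
  have Dm: "derived_blocks blocks m = triples R'" using derived_developed[of m] by (simp add: D_def)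
  have Y: "{y\<in>{0..<m + 1}. y \<noteq> m} = {0..<m}" by auto
  have Glast: "?G x \<in> triples R' \<and> class_index R' (?G x) = k" if "x \<in> {0..<int q}" for x
  proof -
    have i: "k < length R'" using len by simp
    have "last R' = R' ! k" using len(2) last_conv_nth[of R'] by fastforce
    then have t: "(x, x + int q, x + 2 * int q) \<in> set (R' ! k)"
      using last that unfolding check_last_def list_all_iff by simp
    have "?G x \<in> triples R'" unfolding triples_nth
      by (intro exI[of _ k] conjI i) (use imageI[OF t, of points] in simp)
    then show ?thesis using r'(2)[OF i t] by simp
  qed
  have G: "{y\<in>{0..<m}. y mod int q = x mod int q} = ?G (x mod int q)" for x
  proof -
    let ?r = "x mod int q"
    have r: "0 \<le> ?r" "?r < int q" using q by simp_all
    have 1: "y \<in> ?G ?r" if y: "0 \<le> y" "y < m" "y mod int q = ?r" for y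
    proof -
      have eq: "y = int q * (y div int q) + ?r" using y(3) by (metis mult_div_mod_eq)
      have "0 \<le> y div int q" using y(1) q by (simp add: pos_imp_zdiv_nonneg_iff)
      moreover have "y div int q < 3"
      proof (rule ccontr)
        assume "\<not> y div int q < 3"
        then have "int q * 3 \<le> int q * (y div int q)" by (intro mult_left_mono) simp_all
        then show False using eq r(1) y(2) m by linarith
      qed
      ultimately have "y div int q = 0 \<or> y div int q = 1 \<or> y div int q = 2" by linarith
      moreover note eq
      ultimately show ?thesis by (elim disjE) simp_all
    qed
    have 2: "y \<in> {0..<m} \<and> y mod int q = ?r" if "y \<in> ?G ?r" for y
      using that r m by auto
    show ?thesis
    proof (intro Set.set_eqI iffI)
      fix y assume "y \<in> {y\<in>{0..<m}. y mod int q = ?r}"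
      then show "y \<in> ?G ?r" using 1[of y] by simp
    next
      fix y assume "y \<in> ?G ?r"
      from 2[OF this] show "y \<in> {y\<in>{0..<m}. y mod int q = ?r}" by simp
    qed
  qed
  have r1: "rgdd (Suc k) {0..<m} ?g (class_index R') (triples R')" using r'(1) unfolding Y len .
  have "rgdd k {0..<m} (\<lambda>x. x mod int q) (class_index R') (triples R' - (\<lambda>x. {y\<in>{0..<m}. y mod int q = x mod int q}) ` {0..<m})"
    by (rule rgdd_remove_class[OF r1]) (unfold G, rule Glast, use q in simp)
  moreover have "(\<lambda>x. {y\<in>{0..<m}. y mod int q = x mod int q}) ` {0..<m} = ?G ` {0..<int q}"
  proof -
    have "(\<lambda>x. x mod int q) ` {0..<m} = {0..<int q}"
    proof
      show "{0..<int q} \<subseteq> (\<lambda>x. x mod int q) ` {0..<m}"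
      proof
        fix x assume "x \<in> {0..<int q}"
        then have "x = x mod int q" "x \<in> {0..<m}" using m by auto
        then show "x \<in> (\<lambda>x. x mod int q) ` {0..<m}" by blast
      qed
    qed (use q in auto)
    then show ?thesis unfolding G image_image[of ?G "\<lambda>x. x mod int q", symmetric] by simp
  qed
  ultimately have 3: "rgdd k {0..<m} (\<lambda>x. x mod int q) (class_index R') (derived_blocks blocks m - ?G ` {0..<int q})"
    unfolding Dm by simp
  have 2: "{m, x, x + int q, x + 2 * int q} \<in> blocks" if "x \<in> {0..<int q}" for x
  proof -
    have "?G x \<in> D m" using Glast[OF that] by (simp add: D_def)
    then show ?thesis unfolding blocks_def by blast
  qed
  have 4: "\<exists>c. rgdd (Suc k) ({0..m} - {p}) ?g c (derived_blocks blocks p)" if "p \<in> {0..<m}" for p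
  proof -
    have "{y\<in>{0..<m} \<union> {m}. y \<noteq> p} = {0..m} - {p}" unfolding X by auto
    then show ?thesis using rgdd_D[of p] derived_developed[of p] that by simp
  qed
  have 1: "quad_design {0..m} ?g blocks" using developed_quad_design unfolding X .
  show ?thesis unfolding fibred_SQS_def m[symmetric] using 1 2 3 4 by blast
qed

section \<open>The explicit stars\<close>

text \<open>
  The following lists give the triples derived at 0 (star) and at the fixed point (fixed), one line of triples or
  more for each parallel class.  The designs with 22 and 40 points are invariant under the integers modulo 21 and 39 and have the
  fixed points 21 and 39.  The design with 42 points is invariant under the integers modulo 42, with fibres given
  by the residues modulo 14, and the design with 24 points is invariant under the translations of \<open>xadd\<close>, with fibres given by the residues modulo 8.
\<close>

definition star22 :: "triple list list" where
  "star22 =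
   [[(1,2,11),(3,9,21),(4,17,19),(5,16,20),(6,10,15),(7,13,18),(8,12,14)],
    [(1,3,13),(2,4,8),(5,11,17),(6,7,20),(9,14,16),(10,18,19),(12,15,21)],
    [(1,4,16),(2,12,20),(3,5,18),(6,11,14),(7,9,10),(8,19,21),(13,15,17)],
    [(1,5,21),(2,6,19),(3,7,17),(4,9,15),(8,16,18),(10,11,12),(13,14,20)],
    [(1,6,17),(2,10,21),(3,15,20),(4,14,18),(5,7,12),(8,9,11),(13,16,19)],
    [(1,7,8),(2,5,13),(3,4,12),(6,18,21),(9,19,20),(10,14,17),(11,15,16)],
    [(1,9,18),(2,3,14),(4,5,10),(6,12,16),(7,15,19),(8,17,20),(11,13,21)],
    [(1,10,20),(2,15,18),(3,6,8),(4,7,11),(5,14,19),(9,12,13),(16,17,21)],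
    [(1,12,19),(2,9,17),(3,10,16),(4,6,13),(5,8,15),(7,14,21),(11,18,20)],
    [(1,14,15),(2,7,16),(3,11,19),(4,20,21),(5,6,9),(8,10,13),(12,17,18)]]"

definition fixed22 :: "triple list list" where
  "fixed22 =
   [[(0,1,5),(2,18,19),(3,4,8),(6,7,11),(9,10,14),(12,13,17),(15,16,20)],
    [(0,2,10),(1,12,14),(3,5,13),(4,15,17),(6,8,16),(7,18,20),(9,11,19)],
    [(0,3,9),(1,17,18),(2,8,20),(4,7,13),(5,6,10),(11,12,16),(14,15,19)],
    [(0,4,20),(1,7,19),(2,14,17),(3,6,12),(5,16,18),(8,9,13),(10,11,15)],
    [(0,6,18),(1,9,20),(2,4,12),(3,14,16),(5,7,15),(8,11,17),(10,13,19)],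
    [(0,8,19),(1,3,11),(2,13,15),(4,6,14),(5,17,20),(7,10,16),(9,12,18)],
    [(0,11,13),(1,2,6),(3,15,18),(4,16,19),(5,8,14),(7,9,17),(10,12,20)],
    [(0,12,15),(1,13,16),(2,3,7),(4,5,9),(6,17,19),(8,10,18),(11,14,20)],
    [(0,16,17),(1,4,10),(2,5,11),(3,19,20),(6,9,15),(7,8,12),(13,14,18)],
    [(0,7,14),(1,8,15),(2,9,16),(3,10,17),(4,11,18),(5,12,19),(6,13,20)]]"

definition star24 :: "triple list list" where
  "star24 =
   [[(1,2,3),(4,5,18),(6,9,20),(7,17,21),(10,14,15),(11,12,23),(13,19,22)],
    [(1,4,22),(2,5,12),(3,9,18),(6,7,10),(11,14,21),(13,17,23),(15,19,20)],
    [(1,5,23),(2,15,22),(3,10,17),(4,9,14),(6,11,13),(7,12,19),(18,20,21)],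
    [(1,6,12),(2,7,14),(3,21,22),(4,19,23),(5,10,20),(9,13,15),(11,17,18)],
    [(1,7,13),(2,4,21),(3,20,23),(5,11,22),(6,15,18),(9,10,19),(12,14,17)],
    [(1,10,11),(2,13,20),(3,12,15),(4,6,17),(5,14,19),(7,18,22),(9,21,23)],
    [(1,14,20),(2,9,11),(3,4,7),(5,15,17),(6,19,21),(10,22,23),(12,13,18)],
    [(1,15,21),(2,17,19),(3,5,6),(4,10,13),(7,11,20),(9,12,22),(14,18,23)],
    [(1,18,19),(2,6,23),(3,13,14),(4,11,15),(5,7,9),(10,12,21),(17,20,22)]]"

definition star40 :: "triple list list" where
  "star40 =
   [[(1,2,33),(3,7,22),(4,27,28),(5,13,17),(6,16,39),(8,15,20),(9,31,32),(10,14,19),(11,24,34),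
     (12,18,30),(21,35,38),(23,26,37),(25,29,36)],
    [(1,3,23),(2,15,31),(4,19,36),(5,24,32),(6,11,25),(7,16,38),(8,13,35),(9,21,27),(10,33,39),
     (12,22,37),(14,17,18),(20,30,34),(26,28,29)],
    [(1,4,13),(2,18,37),(3,8,21),(5,30,38),(6,12,32),(7,27,39),(9,17,25),(10,15,26),(11,19,35),
     (14,28,34),(16,20,31),(22,24,29),(23,33,36)],
    [(1,5,7),(2,14,24),(3,15,18),(4,16,32),(6,13,21),(8,10,23),(9,19,20),(11,27,29),(12,28,35),
     (17,33,38),(22,26,34),(25,30,37),(31,36,39)],
    [(1,6,31),(2,3,13),(4,11,14),(5,19,33),(7,10,35),(8,26,32),(9,18,22),(12,24,25),(15,28,30),
     (16,23,27),(17,21,39),(20,36,37),(29,34,38)],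
    [(1,8,17),(2,25,28),(3,24,27),(4,33,35),(5,6,23),(7,18,29),(9,12,26),(10,21,37),(11,22,32),
     (13,20,38),(14,15,39),(16,34,36),(19,30,31)],
    [(1,9,28),(2,12,23),(3,34,39),(4,26,31),(5,16,29),(6,14,35),(7,30,32),(8,19,25),(10,20,22),
     (11,15,38),(13,18,33),(17,27,37),(21,24,36)],
    [(1,10,24),(2,19,29),(3,17,30),(4,22,39),(5,12,14),(6,20,28),(7,11,23),(8,27,38),(9,35,36),
     (13,31,34),(15,16,25),(18,21,26),(32,33,37)],
    [(1,11,37),(2,4,20),(3,10,31),(5,25,35),(6,17,22),(7,9,34),(8,29,33),(12,15,36),(13,14,32),
     (16,18,28),(19,21,23),(24,38,39),(26,27,30)],
    [(1,12,16),(2,5,21),(3,20,35),(4,7,24),(6,34,37),(8,11,18),(9,23,38),(10,25,27),(13,26,39),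
     (14,29,30),(15,19,22),(17,32,36),(28,31,33)],
    [(1,14,21),(2,27,32),(3,19,37),(4,5,34),(6,9,15),(7,28,36),(8,22,31),(10,13,16),(11,12,20),
     (17,26,35),(18,25,38),(23,29,39),(24,30,33)],
    [(1,15,27),(2,22,38),(3,28,32),(4,21,30),(5,20,26),(6,7,8),(9,24,37),(10,12,29),(11,13,36),
     (14,23,31),(16,17,19),(18,35,39),(25,33,34)],
    [(1,18,34),(2,8,36),(3,5,11),(4,9,29),(6,19,24),(7,15,33),(10,17,28),(12,13,27),(14,26,38),
     (16,35,37),(20,32,39),(21,25,31),(22,23,30)],
    [(1,19,26),(2,34,35),(3,4,25),(5,15,37),(6,18,27),(7,12,31),(8,16,30),(9,11,39),(10,36,38),
     (13,23,28),(14,22,33),(17,20,24),(21,29,32)],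
    [(1,20,29),(2,6,10),(3,26,36),(4,12,17),(5,8,39),(7,14,37),(9,13,30),(11,16,33),(15,21,34),
     (18,24,31),(19,28,38),(22,27,35),(23,25,32)],
    [(1,22,36),(2,30,39),(3,14,16),(4,6,38),(5,9,10),(7,25,26),(8,24,28),(11,17,31),(12,21,33),
     (13,29,37),(15,32,35),(18,20,23),(19,27,34)],
    [(1,25,39),(2,9,16),(3,12,38),(4,8,37),(5,22,28),(6,26,33),(7,20,21),(10,11,30),(13,15,24),
     (14,27,36),(17,23,34),(18,19,32),(29,31,35)],
    [(1,30,35),(2,7,17),(3,6,29),(4,15,23),(5,18,36),(8,9,14),(10,32,34),(11,21,28),(12,19,39),
     (13,22,25),(16,24,26),(20,27,33),(31,37,38)],
    [(1,32,38),(2,11,26),(3,9,33),(4,10,18),(5,27,31),(6,30,36),(7,13,19),(8,12,34),(14,20,25),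
     (15,17,29),(16,21,22),(23,24,35),(28,37,39)]]"

definition fixed40 :: "triple list list" where
  "fixed40 =
   [[(0,1,25),(2,8,18),(3,15,22),(4,24,36),(5,11,21),(6,13,33),(7,19,26),(9,10,34),(12,17,20),
     (14,28,29),(16,30,31),(23,37,38),(27,32,35)],
    [(0,2,30),(1,4,35),(3,26,32),(5,17,24),(6,23,27),(7,14,34),(8,25,29),(9,13,31),(10,19,21),
     (11,15,33),(12,18,28),(16,20,38),(22,36,37)],
    [(0,3,34),(1,6,9),(2,14,21),(4,7,38),(5,12,32),(8,13,16),(10,15,18),(11,23,30),(17,29,36),
     (19,24,27),(20,25,28),(22,31,33),(26,35,37)],
    [(0,4,22),(1,21,33),(2,16,17),(3,13,36),(5,15,38),(6,18,25),(7,9,37),(8,14,24),(10,11,35),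
     (12,26,27),(19,28,30),(20,29,31),(23,32,34)],
    [(0,5,8),(1,10,12),(2,33,38),(3,20,24),(4,18,19),(6,11,14),(7,21,22),(9,26,30),(13,17,35),
     (15,32,36),(16,25,27),(23,28,31),(29,34,37)],
    [(0,6,16),(1,19,36),(2,12,35),(3,10,30),(4,11,31),(5,25,37),(7,8,32),(9,21,28),(13,22,24),
     (14,26,33),(15,20,23),(17,34,38),(18,27,29)],
    [(0,7,27),(1,29,38),(2,25,31),(3,8,11),(4,10,20),(5,22,26),(6,15,17),(9,23,24),(12,13,37),
     (14,18,36),(16,28,35),(19,33,34),(21,30,32)],
    [(0,9,11),(1,5,23),(2,6,24),(3,4,28),(7,16,18),(8,15,35),(10,14,32),(12,29,33),(13,30,34),
     (17,22,25),(19,31,38),(20,26,36),(21,27,37)],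
    [(0,10,33),(1,8,28),(2,22,34),(3,7,25),(4,13,15),(5,19,20),(6,26,38),(9,16,36),(11,17,27),
     (12,21,23),(14,31,35),(18,30,37),(24,29,32)],
    [(0,12,19),(1,11,34),(2,5,36),(3,21,38),(4,8,26),(6,7,31),(9,18,20),(10,17,37),(13,27,28),
     (14,23,25),(15,29,30),(16,22,32),(24,33,35)],
    [(0,14,15),(1,2,26),(3,17,18),(4,21,25),(5,6,30),(7,24,28),(8,22,23),(9,32,38),(10,27,31),
     (11,12,36),(13,19,29),(16,33,37),(20,34,35)],
    [(0,17,21),(1,13,20),(2,4,32),(3,9,19),(5,14,16),(6,12,22),(7,11,29),(8,31,37),(10,24,25),
     (15,27,34),(18,23,26),(28,33,36),(30,35,38)],
    [(0,18,35),(1,15,16),(2,19,23),(3,6,37),(4,27,33),(5,28,34),(7,30,36),(8,10,38),(9,14,17),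
     (11,20,22),(12,24,31),(13,25,32),(21,26,29)],
    [(0,20,32),(1,3,31),(2,7,10),(4,14,37),(5,9,27),(6,29,35),(8,12,30),(11,16,19),(13,18,21),
     (15,24,26),(17,23,33),(22,28,38),(25,34,36)],
    [(0,23,29),(1,7,17),(2,20,37),(3,5,33),(4,9,12),(6,8,36),(10,16,26),(11,28,32),(13,14,38),
     (15,21,31),(18,24,34),(19,25,35),(22,27,30)],
    [(0,24,38),(1,18,22),(2,3,27),(4,5,29),(6,10,28),(7,13,23),(8,9,33),(11,25,26),(12,16,34),
     (14,20,30),(15,19,37),(17,31,32),(21,35,36)],
    [(0,28,37),(1,24,30),(2,11,13),(3,12,14),(4,16,23),(5,7,35),(6,20,21),(8,17,19),(9,15,25),
     (10,22,29),(18,32,33),(26,31,34),(27,36,38)],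
    [(0,31,36),(1,32,37),(2,9,29),(3,23,35),(4,6,34),(5,10,13),(7,12,15),(8,20,27),(11,18,38),
     (14,19,22),(16,21,24),(17,26,28),(25,30,33)],
    [(0,13,26),(1,14,27),(2,15,28),(3,16,29),(4,17,30),(5,18,31),(6,19,32),(7,20,33),(8,21,34),
     (9,22,35),(10,23,36),(11,24,37),(12,25,38)]]"

definition star42 :: "triple list list" where
  "star42 =
   [[(1,2,7),(3,6,38),(4,21,31),(5,17,37),(8,16,19),(9,10,13),(11,12,22),(15,25,33),(18,23,30),
     (20,24,36),(26,39,41),(27,34,35),(29,32,40)],
    [(1,3,24),(2,12,36),(4,23,34),(5,10,22),(6,26,30),(7,9,33),(8,17,32),(11,20,38),(13,18,39),
     (15,21,27),(16,35,40),(19,29,31),(25,37,41)],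
    [(1,4,33),(2,3,29),(5,12,24),(6,8,18),(7,13,26),(9,27,31),(10,21,25),(11,19,23),(15,22,35),
     (16,38,41),(17,30,34),(20,37,40),(32,36,39)],
    [(1,5,36),(2,20,33),(3,32,41),(4,15,24),(6,19,35),(7,22,29),(8,10,39),(9,21,30),(11,16,27),
     (12,13,34),(17,18,26),(23,25,40),(31,37,38)],
    [(1,6,41),(2,5,9),(3,7,40),(4,26,27),(8,33,37),(10,29,35),(11,15,32),(12,16,17),(13,22,24),
     (18,19,21),(20,25,30),(23,31,39),(34,36,38)],
    [(1,8,35),(2,21,38),(3,11,13),(4,37,39),(5,26,29),(6,10,17),(7,12,25),(9,36,41),(15,20,23),
     (16,33,34),(18,31,40),(19,22,27),(24,30,32)],
    [(1,9,25),(2,26,35),(3,15,18),(4,7,10),(5,40,41),(6,21,36),(8,11,34),(12,32,37),(13,31,33),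
     (16,23,29),(17,20,22),(19,30,38),(24,27,39)],
    [(1,10,37),(2,22,39),(3,26,34),(4,13,19),(5,7,23),(6,12,27),(8,25,38),(9,16,18),(11,17,35),
     (15,30,36),(20,31,32),(21,29,41),(24,33,40)],
    [(1,11,31),(2,6,40),(3,33,36),(4,12,29),(5,18,35),(7,20,27),(8,24,41),(9,15,38),(10,16,32),
     (13,30,37),(17,21,23),(19,34,39),(22,25,26)],
    [(1,12,19),(2,31,34),(3,22,37),(4,38,40),(5,11,21),(6,9,39),(7,8,15),(10,30,41),(13,17,25),
     (16,26,36),(18,20,29),(23,24,35),(27,32,33)],
    [(1,13,21),(2,25,27),(3,35,39),(4,9,17),(5,32,34),(6,16,37),(7,18,24),(8,29,30),(10,11,33),
     (12,20,41),(15,26,31),(19,36,40),(22,23,38)],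
    [(1,16,20),(2,4,8),(3,27,30),(5,13,38),(6,24,31),(7,17,36),(9,32,35),(10,12,23),(11,26,37),
     (15,19,41),(18,22,33),(21,39,40),(25,29,34)],
    [(1,17,39),(2,23,41),(3,10,19),(4,11,36),(5,8,27),(6,29,33),(7,30,31),(9,22,40),(12,18,38),
     (13,20,35),(15,34,37),(16,24,25),(21,26,32)],
    [(1,18,34),(2,10,15),(3,5,25),(4,35,41),(6,22,32),(7,16,39),(8,12,31),(9,19,20),(11,30,40),
     (13,29,36),(17,27,38),(21,24,37),(23,26,33)],
    [(1,22,30),(2,11,24),(3,4,20),(5,16,31),(6,13,23),(7,34,41),(8,9,26),(10,18,27),(12,21,33),
     (15,17,40),(19,25,32),(29,38,39),(35,36,37)],
    [(1,23,32),(2,17,19),(3,16,21),(4,5,30),(6,7,11),(8,13,40),(9,24,34),(10,20,26),(12,15,39),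
     (18,25,36),(22,31,41),(27,29,37),(33,35,38)],
    [(1,26,38),(2,13,32),(3,9,12),(4,16,22),(5,6,15),(7,19,37),(8,20,21),(10,34,40),(11,18,41),
     (17,24,29),(23,27,36),(25,31,35),(30,33,39)],
    [(1,27,40),(2,18,37),(3,8,23),(4,6,25),(5,20,39),(7,32,38),(9,11,29),(10,31,36),(12,30,35),
     (13,15,16),(17,33,41),(19,24,26),(21,22,34)]]"

lemma tri22: "check_triples 22 (\<lambda>x. x) 0 star22" "check_triples 22 (\<lambda>x. x) 21 fixed22" by code_simp+
lemma row22: "check_rows (\<lambda>x. x) (others 22 (\<lambda>x. x) 0) star22" by code_simp
lemma row22': "check_rows (\<lambda>x. x) (others 22 (\<lambda>x. x) 21) fixed22" by code_simp
lemma ex22: "check_exch 21 star22" by code_simp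
lemma fix22: "check_fixed 21 (at_fixed 21 star22) fixed22" by code_simp
lemma tri24: "check_triples 24 (\<lambda>x. x mod 8) 0 star24" by code_simp
lemma row24: "check_rows (\<lambda>x. x mod 8) (others 24 (\<lambda>x. x mod 8) 0) star24" by code_simp
lemma ex24: "check_xexch star24" by code_simp

lemma tri40: "check_triples 40 (\<lambda>x. x) 0 star40" "check_triples 40 (\<lambda>x. x) 39 fixed40" by code_simp+
lemma tri42: "check_triples 42 (\<lambda>x. x mod 14) 0 star42" by code_simp
lemma row40: "check_rows (\<lambda>x. x) (others 40 (\<lambda>x. x) 0) star40" by code_simp
lemma row40': "check_rows (\<lambda>x. x) (others 40 (\<lambda>x. x) 39) fixed40" by code_simp
lemma fix40: "check_fixed 39 (at_fixed 39 star40) fixed40" by code_simp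
lemma ex40: "check_exch 39 star40" by code_simp
lemma row42: "check_rows (\<lambda>x. x mod 14) (others 42 (\<lambda>x. x mod 14) 0) star42" by code_simp
lemma ex42: "check_exch 42 star42" by code_simp

lemma last22: "check_last 7 (last fixed22)" by code_simp
lemma last40: "check_last 13 (last fixed40)" by code_simp

lemma xadd_mod_div:
  "xadd x y mod 8 = xor (x mod 8) (y mod 8)" "xadd x y div 8 = (x div 8 + y div 8) mod 3"
proof -
  have 8: "z mod 8 = take_bit 3 z" for z :: int by (simp add: take_bit_eq_mod)
  have "xor (x mod 8) (y mod 8) = take_bit 3 (xor x y)" unfolding 8 by simp
  then have "0 \<le> xor (x mod 8) (y mod 8)" "xor (x mod 8) (y mod 8) < 8" unfolding 8[symmetric] by simp_all
  then show "xadd x y mod 8 = xor (x mod 8) (y mod 8)" "xadd x y div 8 = (x div 8 + y div 8) mod 3"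
    by (simp_all add: xadd_def)
qed

lemma xadd_range: "xadd x y \<in> {0..<24}"
proof -
  have "xadd x y = 8 * (xadd x y div 8) + xadd x y mod 8" by simp
  moreover have "0 \<le> xadd x y div 8" "xadd x y div 8 < 3" unfolding xadd_mod_div by simp_all
  moreover have "0 \<le> xadd x y mod 8" "xadd x y mod 8 < 8" by simp_all
  ultimately show ?thesis unfolding atLeastLessThan_iff by linarith
qed

lemma eq_by_mod_div: "x mod 8 = y mod 8 \<Longrightarrow> x div 8 = y div 8 \<Longrightarrow> x = (y::int)"
  by (metis mult_div_mod_eq)

lemma xneg_mod_div: "xneg x mod 8 = x mod 8" "xneg x div 8 = (- (x div 8)) mod 3"
  by (simp_all add: xneg_def)

lemma xneg_range: "xneg x \<in> {0..<24}"
proof -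
  have "xneg x = 8 * (xneg x div 8) + xneg x mod 8" by simp
  moreover have "0 \<le> xneg x div 8" "xneg x div 8 < 3" unfolding xneg_mod_div by simp_all
  moreover have "0 \<le> xneg x mod 8" "xneg x mod 8 < 8" by simp_all
  ultimately show ?thesis unfolding atLeastLessThan_iff by linarith
qed

lemma xadd_development: "development {0..<24} {} xadd xneg 0"
proof
  show "xadd x (xadd y z) = xadd (xadd x y) z" for x y z
    by (rule eq_by_mod_div) (simp_all add: xadd_mod_div xor.assoc mod_simps add.assoc)
  show "xadd x y = xadd y x" for x y
    by (rule eq_by_mod_div) (simp_all add: xadd_mod_div xor.commute add.commute)
  show "xadd 0 x = x" if "x \<in> {0..<24}" for x
  proof (rule eq_by_mod_div)
    have "0 \<le> x div 8" "x div 8 < 3" using that by auto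
    then show "xadd 0 x div 8 = x div 8" by (simp add: xadd_mod_div)
  qed (simp add: xadd_mod_div)
  show "xadd (xneg x) x = 0" for x
    by (rule eq_by_mod_div) (simp_all add: xadd_mod_div xneg_mod_div mod_simps)
qed (use xadd_range xneg_range in auto)

lemma some_on_triples:
  assumes ct: "check_triples v g p R" and s: "some_on R a b c" and d: "a \<noteq> b" "a \<noteq> c" "b \<noteq> c"
  shows "{a,b,c} \<in> triples R"
proof -
  obtain C t where t: "C \<in> set R" "t \<in> set C" "on a t" "on b t" "on c t"
    using s unfolding some_on_def list_ex_iff by blast
  obtain x y z where xyz: "t = (x,y,z)" by (cases t)
  have "{x,y,z} = {a,b,c}" using t(3-5) d unfolding xyz by auto
  then have "points t = {a,b,c}" unfolding xyz by simp
  then show ?thesis using t(1,2) unfolding triples_def by blast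
qed

lemma fibred_design_8: "fibred_design 8 9"
proof -
  let ?g = "\<lambda>x::int. x mod 8"
  have len: "length star24 = 9" by (simp add: star24_def)
  interpret development "{0..<24}" "{}" xadd xneg 0 ?g "triples star24" "{}" 9
    by (rule xadd_development)
  have sh: "shift y x = xadd y x" if "x \<in> {0..<24}" for x y using that by (simp add: shift_def)
  interpret developed_design "{0..<24}" "{}" xadd xneg 0 ?g "triples star24" "{}" 9 "class_index star24" "class_index star24"
  proof
    show "?g (shift y x) = ?g (shift y x') \<longleftrightarrow> ?g x = ?g x'" if "y \<in> {0..<24}" "x \<in> {0..<24} \<union> {}" "x' \<in> {0..<24} \<union> {}" for y x x'
    proof -
      have "xor (y mod 8) (xor (y mod 8) z) = z" for z by (simp flip: xor.assoc)
      then have "xor (y mod 8) a = xor (y mod 8) b \<longleftrightarrow> a = b" for a b by metis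
      then show ?thesis using that by (simp add: sh xadd_mod_div)
    qed
    show "rgdd 9 {y\<in>{0..<24} \<union> {}. ?g y \<noteq> ?g 0} ?g (class_index star24) (triples star24)"
      using check_rgdd(1)[OF tri24 row24] unfolding len by simp
    show "shift (xneg u) ` (insert 0 T - {u}) \<in> triples star24" if T: "T \<in> triples star24" "u \<in> T" "u \<in> {0..<24}" for T u
    proof -
      obtain C x y z where t: "C \<in> set star24" "(x,y,z) \<in> set C" "T = {x,y,z}" using T(1) by (auto simp: triples_def)
      have "sorted_transverse 24 ?g 0 (x,y,z)" using listed_sorted[OF tri24 listed_set[OF t(1,2)]] .
      then have s: "0 < x" "x < y" "y < z" "z < 24" by (auto simp: sorted_transverse_def intro: le_neq_trans)
      have ex: "some_on star24 (xadd (xneg x) 0) (xadd (xneg x) y) (xadd (xneg x) z)"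
        "some_on star24 (xadd (xneg y) 0) (xadd (xneg y) x) (xadd (xneg y) z)"
        "some_on star24 (xadd (xneg z) 0) (xadd (xneg z) x) (xadd (xneg z) y)"
      proof -
        have "case (x,y,z) of (x,y,z) \<Rightarrow>
           some_on star24 (xadd (xneg x) 0) (xadd (xneg x) y) (xadd (xneg x) z) \<and>
           some_on star24 (xadd (xneg y) 0) (xadd (xneg y) x) (xadd (xneg y) z) \<and>
           some_on star24 (xadd (xneg z) 0) (xadd (xneg z) x) (xadd (xneg z) y)"
          using ex24 t(1,2) unfolding check_xexch_def list_all_iff by blast
        then show "some_on star24 (xadd (xneg x) 0) (xadd (xneg x) y) (xadd (xneg x) z)"
          "some_on star24 (xadd (xneg y) 0) (xadd (xneg y) x) (xadd (xneg y) z)"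
          "some_on star24 (xadd (xneg z) 0) (xadd (xneg z) x) (xadd (xneg z) y)" by simp_all
      qed
      have tr: "shift (xneg u) ` {a,b,c} \<in> triples star24"
        if "some_on star24 (xadd (xneg u) a) (xadd (xneg u) b) (xadd (xneg u) c)" "a \<noteq> b" "a \<noteq> c" "b \<noteq> c"
          "a \<in> {0..<24}" "b \<in> {0..<24}" "c \<in> {0..<24}" for a b c
      proof -
        have n: "xneg u \<in> {0..<24}" by (rule xneg_range)
        have "{shift (xneg u) a, shift (xneg u) b, shift (xneg u) c} \<in> triples star24"
        proof (rule some_on_triples[OF tri24])
          show "some_on star24 (shift (xneg u) a) (shift (xneg u) b) (shift (xneg u) c)"
            using that(1) by (simp only: sh[OF that(5)] sh[OF that(6)] sh[OF that(7)])
        qed (use that(2-4) shift_inj[OF n] in blast)+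
        then show ?thesis by simp
      qed
      consider "u = x" | "u = y" | "u = z" using T(2) t(3) by blast
      then show ?thesis
      proof cases
        case 1
        then have "insert 0 T - {u} = {0,y,z}" using t(3) s by auto
        then show ?thesis using tr[of 0 y z] ex(1) 1 s by simp
      next
        case 2
        then have "insert 0 T - {u} = {0,x,z}" using t(3) s by auto
        then show ?thesis using tr[of 0 x z] ex(2) 2 s by simp
      next
        case 3
        then have "insert 0 T - {u} = {0,x,y}" using t(3) s by auto
        then show ?thesis using tr[of 0 x y] ex(3) 3 s by simp
      qed
    qed
  qed auto
  have D: "\<exists>c. rgdd 9 {y\<in>{0..<24}. ?g y \<noteq> ?g p} ?g c (derived_blocks blocks p)" if "p \<in> {0..<24}" for p
    using rgdd_D[of p] derived_developed[of p] that by simp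
  have Q: "quad_design {0..<24} ?g blocks" using developed_quad_design by simp
  show ?thesis unfolding fibred_design_def by (rule exI[of _ blocks]) (use Q D in simp)
qed

lemma fibred_SQS_7: "fibred_SQS 7 9"
proof (rule fibred_SQS_cyclic[of 7 21 star22 9 fixed22])
  show "length star22 = Suc 9" "length fixed22 = Suc 9" by (simp_all add: star22_def fixed22_def)
  show "check_last (int 7) (last fixed22)" using last22 by simp
qed (simp_all add: tri22 row22 row22' ex22 fix22)

lemma fibred_design_14: "fibred_design 14 18"
proof -
  have len: "length star42 = 18" by (simp add: star42_def)
  have "fibred_design 14 (length star42)"
    by (rule fibred_design_cyclic[of 14 42]) (simp_all add: tri42 row42 ex42)
  then show ?thesis unfolding len .
qed

lemma fibred_SQS_13: "fibred_SQS 13 18"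
proof (rule fibred_SQS_cyclic[of 13 39 star40 18 fixed40])
  show "length star40 = Suc 18" "length fixed40 = Suc 18" by (simp_all add: star40_def fixed40_def)
  show "check_last (int 13) (last fixed40)" using last40 by simp
qed (simp_all add: tri40 row40 row40' ex40 fix40)

section \<open>Assembling the quadruple systems\<close>

text \<open>
  A number below \<open>3 * n\<close> has a residue modulo \<open>n\<close>, which selects a point of the base block, and a quotient, which selects
  one of the three copies.
\<close>

definition coords :: "(nat \<Rightarrow> 'p) \<Rightarrow> nat \<Rightarrow> int \<Rightarrow> 'p \<times> nat" where
  "coords h n r = (h (nat (r mod int n)), nat (r div int n))"

lemma coords_at: "j < n \<Longrightarrow> coords h n (int n * int i + int j) = (h j, i)"
  by (simp add: coords_def)

lemma range_split:
  assumes "r \<in> {0..<3 * int n}"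
  obtains i j where "r = int n * int i + int j" "j < n" "i < 3"
proof
  have n: "0 < int n" using assms by auto
  show "r = int n * int (nat (r div int n)) + int (nat (r mod int n))"
    using assms n by (simp add: pos_imp_zdiv_nonneg_iff)
  show "nat (r mod int n) < n" using n by (simp add: nat_less_iff)
  have "r div int n < 3"
  proof (rule ccontr)
    assume "\<not> r div int n < 3"
    then have "int n * 3 \<le> int n * (r div int n)" by (intro mult_left_mono) simp_all
    moreover have "r = int n * (r div int n) + r mod int n" by simp
    moreover have "0 \<le> r mod int n" using n by simp
    ultimately show False using assms unfolding atLeastLessThan_iff by linarith
  qed
  then show "nat (r div int n) < 3" by simp
qed

lemma coords_bij:
  assumes h: "bij_betw h {0..<n} M"
  shows "inj_on (coords h n) {0..<3 * int n}" "coords h n ` {0..<3 * int n} = M \<times> {..<3}"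
    "\<And>r s. r \<in> {0..<3 * int n} \<Longrightarrow> s \<in> {0..<3 * int n} \<Longrightarrow> fst (coords h n r) = fst (coords h n s) \<longleftrightarrow> r mod int n = s mod int n"
proof -
  have hi: "h j = h j' \<longleftrightarrow> j = j'" if "j < n" "j' < n" for j j'
    using h that by (auto simp: bij_betw_def inj_on_def)
  show "inj_on (coords h n) {0..<3 * int n}"
  proof (rule inj_onI)
    fix r s assume rs: "r \<in> {0..<3 * int n}" "s \<in> {0..<3 * int n}" "coords h n r = coords h n s"
    obtain i j where r: "r = int n * int i + int j" "j < n" "i < 3" using range_split[OF rs(1)] .
    obtain i' j' where s: "s = int n * int i' + int j'" "j' < n" "i' < 3" using range_split[OF rs(2)] .
    show "r = s" using rs(3) r s hi by (simp add: coords_at)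
  qed
  show "coords h n ` {0..<3 * int n} = M \<times> {..<3}"
  proof
    show "coords h n ` {0..<3 * int n} \<subseteq> M \<times> {..<3}"
    proof (rule image_subsetI)
      fix r assume "r \<in> {0..<3 * int n}"
      then obtain i j where r: "r = int n * int i + int j" "j < n" "i < 3" by (rule range_split)
      then show "coords h n r \<in> M \<times> {..<3}" using bij_betw_apply[OF h, of j] by (simp add: coords_at)
    qed
    show "M \<times> {..<3} \<subseteq> coords h n ` {0..<3 * int n}"
    proof (rule subrelI)
      fix x i assume "(x,i) \<in> M \<times> {..<3::nat}"
      then obtain j where j: "j < n" "x = h j" "i < 3" using h by (auto simp: bij_betw_def)
      have "int n * int i \<le> int n * 2" using j(3) by (intro mult_left_mono) auto
      moreover have "0 \<le> int n * int i" by simp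
      ultimately have "int n * int i + int j \<in> {0..<3 * int n}" using j(1) unfolding atLeastLessThan_iff by linarith
      then show "(x,i) \<in> coords h n ` {0..<3 * int n}" using coords_at[OF j(1), of h i] j(2) by (metis image_eqI)
    qed
  qed
  show "fst (coords h n r) = fst (coords h n s) \<longleftrightarrow> r mod int n = s mod int n"
    if rs: "r \<in> {0..<3 * int n}" "s \<in> {0..<3 * int n}" for r s
  proof -
    obtain i j where r: "r = int n * int i + int j" "j < n" "i < 3" using range_split[OF rs(1)] .
    obtain i' j' where s: "s = int n * int i' + int j'" "j' < n" "i' < 3" using range_split[OF rs(2)] .
    show ?thesis using r s hi by (simp add: coords_at)
  qed
qed

lemma tripled_without: "\<omega> \<notin> B \<Longrightarrow> tripled \<omega> B = B \<times> {..<3}" by (auto simp: tripled_def)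
lemma tripled_with: "\<omega> \<in> B \<Longrightarrow> tripled \<omega> B = insert (\<omega>,0) ((B - {\<omega>}) \<times> {..<3})" by (auto simp: tripled_def)

lemma fibred_design_on:
  assumes H: "fibred_design n k" and B: "finite B" "card B = n" "\<omega> \<notin> B"
  shows "\<exists>Q. quad_design (tripled \<omega> B) fst Q \<and>
     (\<forall>p\<in>tripled \<omega> B. \<exists>c. rgdd k {y\<in>tripled \<omega> B. fst y \<noteq> fst p} fst c (derived_blocks Q p))"
proof -
  let ?X = "{0..<3 * int n}" and ?g = "\<lambda>x. x mod int n"
  obtain \<H> where \<H>: "quad_design ?X ?g \<H>"
    and D: "\<And>p. p \<in> ?X \<Longrightarrow> \<exists>c. rgdd k {y\<in>?X. ?g y \<noteq> ?g p} ?g c (derived_blocks \<H> p)"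
    using H unfolding fibred_design_def by blast
  obtain h where h: "bij_betw h {0..<n} B" using ex_bij_betw_nat_finite[OF B(1)] B(2) by blast
  note co = coords_bij[OF h]
  let ?f = "coords h n"
  have X: "?f ` ?X = tripled \<omega> B" using co(2) tripled_without[OF B(3)] by simp
  have tr1: "quad_design (?f ` ?X) fst (image ?f ` \<H>)"
    by (rule quad_design_transport(1)[OF \<H> co(1)]) (rule co(3))
  have tr2: "derived_blocks (image ?f ` \<H>) (?f r) = image ?f ` derived_blocks \<H> r" if "r \<in> ?X" for r
    by (rule quad_design_transport(2)[where g' = fst, OF \<H> co(1) _ that]) (rule co(3))
  have "\<exists>c. rgdd k {y\<in>tripled \<omega> B. fst y \<noteq> fst p} fst c (derived_blocks (image ?f ` \<H>) p)" if p: "p \<in> tripled \<omega> B" for p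
  proof -
    obtain r where r: "r \<in> ?X" "p = ?f r" using p unfolding X[symmetric] by blast
    obtain c where c: "rgdd k {y\<in>?X. ?g y \<noteq> ?g r} ?g c (derived_blocks \<H> r)" using D[OF r(1)] by blast
    have sub: "inj_on ?f {y\<in>?X. ?g y \<noteq> ?g r}" by (rule inj_on_subset[OF co(1)]) blast
    have im: "?f ` {y\<in>?X. ?g y \<noteq> ?g r} = {y\<in>tripled \<omega> B. fst y \<noteq> fst p}"
      unfolding X[symmetric] r(2) using co(3)[OF _ r(1)] by blast
    have "rgdd k (?f ` {y\<in>?X. ?g y \<noteq> ?g r}) fst (\<lambda>S. c (the_inv_into {y\<in>?X. ?g y \<noteq> ?g r} ?f ` S)) (image ?f ` derived_blocks \<H> r)"
      by (rule rgdd_transport[OF c sub]) (rule co(3); simp)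
    then show ?thesis unfolding im unfolding r(2) tr2[OF r(1)] by blast
  qed
  then show ?thesis using tr1 unfolding X by blast
qed

text \<open>
  The copy at infinity has number \<open>3 * q\<close>.  The triple completing the fibre at a point can be given
  the colour \<open>k\<close> by exchanging two colours.
\<close>

lemma fibred_SQS_on:
  assumes H: "fibred_SQS q k" and B: "finite B" "card B = Suc q" "\<omega> \<in> B"
  shows "\<exists>Q. quad_design (tripled \<omega> B) id Q \<and> (\<forall>x\<in>B - {\<omega>}. fibre \<omega> x \<in> Q) \<and>
     (\<exists>c. rgdd k {y\<in>tripled \<omega> B. fst y \<noteq> \<omega>} fst c
        (derived_blocks Q (\<omega>,0) - {fibre \<omega> x - {(\<omega>,0)} | x. x \<in> B \<and> x \<noteq> \<omega>})) \<and>
     (\<forall>x i. (x,i) \<in> tripled \<omega> B \<and> x \<noteq> \<omega> \<longrightarrow>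
        (\<exists>c. rgdd (Suc k) (tripled \<omega> B - {(x,i)}) id c (derived_blocks Q (x,i)) \<and> c (fibre \<omega> x - {(x,i)}) = k))"
proof -
  let ?m = "3 * int q"
  let ?X = "{0..?m}" and ?A = "{0..<?m}" and ?G = "\<lambda>x. {x, x + int q, x + 2 * int q}"
  obtain \<Q> where \<Q>: "quad_design ?X (\<lambda>x. x) \<Q>" and F: "\<And>x. x \<in> {0..<int q} \<Longrightarrow> insert ?m (?G x) \<in> \<Q>"
    and N: "\<exists>c. rgdd k ?A (\<lambda>x. x mod int q) c (derived_blocks \<Q> ?m - ?G ` {0..<int q})"
    and D: "\<And>p. p \<in> ?A \<Longrightarrow> \<exists>c. rgdd (Suc k) (?X - {p}) (\<lambda>x. x) c (derived_blocks \<Q> p)"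
    using H unfolding fibred_SQS_def by blast
  have "card (B - {\<omega>}) = q" using B by simp
  then obtain h where h: "bij_betw h {0..<q} (B - {\<omega>})" using ex_bij_betw_nat_finite[of "B - {\<omega>}"] B(1) by auto
  note co = coords_bij[OF h]
  define f where "f r = (if r = ?m then (\<omega>,0) else coords h q r)" for r
  have fA: "f r = coords h q r" if "r \<in> ?A" for r using that by (simp add: f_def)
  have fm: "f ?m = (\<omega>,0)" by (simp add: f_def)
  have "f ` ?A = coords h q ` ?A" by (rule image_cong[OF refl fA])
  then have imA: "f ` ?A = (B - {\<omega>}) \<times> {..<3}" using co(2) by simp
  have XA: "?X = insert ?m ?A" by auto
  have imX: "f ` ?X = tripled \<omega> B" unfolding XA image_insert imA fm tripled_with[OF B(3)] ..
  have injA: "inj_on f ?A" using co(1) inj_on_cong[of ?A f "coords h q"] fA by blast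
  have inj: "inj_on f ?X" unfolding XA inj_on_insert using injA imA fm by auto
  have fst_eq: "fst (f r) = fst (f s) \<longleftrightarrow> r mod int q = s mod int q" if "r \<in> ?A" "s \<in> ?A" for r s
    using co(3)[OF that] fA that by simp
  let ?Q = "image f ` \<Q>"
  have idf: "id (f x) = id (f y) \<longleftrightarrow> x = y" if "x \<in> ?X" "y \<in> ?X" for x y
    using inj_on_eq_iff[OF inj that] by simp
  have tr1: "quad_design (f ` ?X) id ?Q"
    by (rule quad_design_transport(1)[OF \<Q> inj]) (rule idf)
  have tr2: "derived_blocks ?Q (f r) = image f ` derived_blocks \<Q> r" if "r \<in> ?X" for r
    by (rule quad_design_transport(2)[where g' = id, OF \<Q> inj _ that]) (rule idf)
  have fib: "f ` ?G (int j) = fibre \<omega> (h j) - {(\<omega>,0)}" "f ` insert ?m (?G (int j)) = fibre \<omega> (h j)" if j: "j < q" for j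
  proof -
    have "h j \<noteq> \<omega>" using bij_betw_apply[OF h, of j] j by auto
    have "f (int j) = (h j, 0)" "f (int j + int q) = (h j, 1)" "f (int j + 2 * int q) = (h j, 2)"
      using coords_at[OF j, of h 0] coords_at[OF j, of h 1] coords_at[OF j, of h 2] j
      by (simp_all add: fA algebra_simps)
    then have 1: "f ` ?G (int j) = {(h j,0),(h j,1),(h j,2)}" by simp
    then show "f ` ?G (int j) = fibre \<omega> (h j) - {(\<omega>,0)}" using \<open>h j \<noteq> \<omega>\<close> by (auto simp: fibre_def)
    show "f ` insert ?m (?G (int j)) = fibre \<omega> (h j)" unfolding image_insert[of f ?m] 1 fm by (simp add: fibre_def)
  qed
  have hx: "\<exists>j<q. x = h j" if "x \<in> B - {\<omega>}" for x
  proof -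
    have "x \<in> h ` {0..<q}" using that h by (simp add: bij_betw_def)
    then show ?thesis by auto
  qed
  have fibQ: "fibre \<omega> x \<in> ?Q" if x: "x \<in> B - {\<omega>}" for x
  proof -
    obtain j where j: "j < q" "x = h j" using hx[OF x] by blast
    have "insert ?m (?G (int j)) \<in> \<Q>" by (rule F) (use j in simp)
    then show ?thesis using fib(2)[OF j(1)] j(2) by (metis imageI)
  qed
  have 3: "\<exists>c. rgdd k {y\<in>tripled \<omega> B. fst y \<noteq> \<omega>} fst c
        (derived_blocks ?Q (\<omega>,0) - {fibre \<omega> x - {(\<omega>,0)} | x. x \<in> B \<and> x \<noteq> \<omega>})"
  proof -
    obtain c where c: "rgdd k ?A (\<lambda>x. x mod int q) c (derived_blocks \<Q> ?m - ?G ` {0..<int q})" using N by blast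
    have t: "rgdd k (f ` ?A) fst (\<lambda>S. c (the_inv_into ?A f ` S)) (image f ` (derived_blocks \<Q> ?m - ?G ` {0..<int q}))"
      by (rule rgdd_transport[OF c injA]) (rule fst_eq)
    have A: "f ` ?A = {y\<in>tripled \<omega> B. fst y \<noteq> \<omega>}" unfolding imA tripled_with[OF B(3)] by auto
    have sub: "T \<subseteq> ?X" if "T \<in> derived_blocks \<Q> ?m" for T
      using that \<Q> by (auto simp: derived_blocks_def quad_design_def)
    have subG: "?G x \<subseteq> ?X" if "x \<in> {0..<int q}" for x using that by auto
    have "inj_on (image f) (Pow ?X)" by (rule inj_on_image_Pow[OF inj])
    then have "image f ` (derived_blocks \<Q> ?m - ?G ` {0..<int q}) = image f ` derived_blocks \<Q> ?m - image f ` ?G ` {0..<int q}"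
      by (rule inj_on_image_set_diff) (use sub subG in blast)+
    moreover have "image f ` derived_blocks \<Q> ?m = derived_blocks ?Q (\<omega>,0)" using tr2[of ?m] fm by simp
    moreover have "image f ` ?G ` {0..<int q} = {fibre \<omega> x - {(\<omega>,0)} | x. x \<in> B \<and> x \<noteq> \<omega>}"
    proof (intro Set.set_eqI iffI)
      fix S assume "S \<in> image f ` ?G ` {0..<int q}"
      then obtain z where z: "z \<in> {0..<int q}" "S = f ` ?G z" by blast
      then have j: "nat z < q" "z = int (nat z)" by auto
      have "S = fibre \<omega> (h (nat z)) - {(\<omega>,0)}" using fib(1)[OF j(1)] z(2) j(2) by simp
      moreover have "h (nat z) \<in> B - {\<omega>}" using bij_betw_apply[OF h, of "nat z"] j(1) by simp
      ultimately show "S \<in> {fibre \<omega> x - {(\<omega>,0)} | x. x \<in> B \<and> x \<noteq> \<omega>}" by blast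
    next
      fix S assume "S \<in> {fibre \<omega> x - {(\<omega>,0)} | x. x \<in> B \<and> x \<noteq> \<omega>}"
      then obtain x where x: "x \<in> B - {\<omega>}" "S = fibre \<omega> x - {(\<omega>,0)}" by blast
      obtain j where j: "j < q" "x = h j" using hx[OF x(1)] by blast
      have "S = f ` ?G (int j)" using fib(1)[OF j(1)] x(2) j(2) by simp
      moreover have "int j \<in> {0..<int q}" using j(1) by simp
      ultimately show "S \<in> image f ` ?G ` {0..<int q}" by blast
    qed
    ultimately show ?thesis using t unfolding A by auto
  qed
  have 4: "\<exists>c. rgdd (Suc k) (tripled \<omega> B - {(x,i)}) id c (derived_blocks ?Q (x,i)) \<and> c (fibre \<omega> x - {(x,i)}) = k"
    if xi: "(x,i) \<in> tripled \<omega> B" "x \<noteq> \<omega>" for x i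
  proof -
    have "(x,i) \<in> f ` ?A" unfolding imA using xi by (auto simp: tripled_def)
    then obtain r where r: "r \<in> ?A" "(x,i) = f r" by blast
    have rX: "r \<in> ?X" using r(1) by auto
    obtain c where c: "rgdd (Suc k) (?X - {r}) (\<lambda>x. x) c (derived_blocks \<Q> r)" using D[OF r(1)] by blast
    have injr: "inj_on f (?X - {r})" by (rule inj_on_subset[OF inj]) blast
    have "rgdd (Suc k) (f ` (?X - {r})) id (\<lambda>S. c (the_inv_into (?X - {r}) f ` S)) (image f ` derived_blocks \<Q> r)"
      by (rule rgdd_transport[OF c injr]) (rule idf; simp)
    moreover have "f ` (?X - {r}) = tripled \<omega> B - {(x,i)}"
      using inj_on_image_set_diff[OF inj, of ?X "{r}"] rX unfolding imX by (simp add: r(2))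
    ultimately have R: "rgdd (Suc k) (tripled \<omega> B - {(x,i)}) id (\<lambda>S. c (the_inv_into (?X - {r}) f ` S)) (derived_blocks ?Q (x,i))"
      using tr2[OF rX] r(2) by simp
    have xB: "x \<in> B - {\<omega>}" using xi by (auto simp: tripled_def)
    have "(x,i) \<in> fibre \<omega> x" using xi by (auto simp: tripled_def fibre_def)
    then have "fibre \<omega> x - {(x,i)} \<in> derived_blocks ?Q (x,i)" using fibQ[OF xB] unfolding derived_blocks_def by blast
    then show ?thesis using rgdd_recolour[OF R, of _ k] by blast
  qed
  show ?thesis using tr1 fibQ 3 4 unfolding imX by blast
qed

text \<open>
  The small designs are transported to each base block separately; no compatibility
  between the choices is required, because different base blocks share no triple from three fibres.
\<close>

lemma tripling_exists:
  assumes H: "fibred_design (Suc q) k" and Q: "fibred_SQS q k"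
    and S: "resolvable_3design q P \<S> \<pi>" and \<omega>: "\<omega> \<in> P" and P3: "3 \<le> card P"
  shows "\<exists>\<B>. RDSQS (card (tripled \<omega> P)) (tripled \<omega> P) \<B>"
proof -
  have fB: "finite B" "card B = Suc q" if "B \<in> \<S>" for B
    using S that by (auto simp: resolvable_3design_def intro: finite_subset)
  define good where "good B R \<longleftrightarrow> (if \<omega> \<in> B then
     quad_design (tripled \<omega> B) id R \<and> (\<forall>x\<in>B - {\<omega>}. fibre \<omega> x \<in> R) \<and>
     (\<exists>c. rgdd k {y\<in>tripled \<omega> B. fst y \<noteq> \<omega>} fst c
        (derived_blocks R (\<omega>,0) - {fibre \<omega> x - {(\<omega>,0)} | x. x \<in> B \<and> x \<noteq> \<omega>})) \<and>
     (\<forall>x i. (x,i) \<in> tripled \<omega> B \<and> x \<noteq> \<omega> \<longrightarrow>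
        (\<exists>c. rgdd (Suc k) (tripled \<omega> B - {(x,i)}) id c (derived_blocks R (x,i)) \<and> c (fibre \<omega> x - {(x,i)}) = k))
     else quad_design (tripled \<omega> B) fst R \<and>
     (\<forall>p\<in>tripled \<omega> B. \<exists>c. rgdd k {y\<in>tripled \<omega> B. fst y \<noteq> fst p} fst c (derived_blocks R p)))" for B R
  have "\<exists>R. good B R" if "B \<in> \<S>" for B
    unfolding good_def using fibred_SQS_on[OF Q fB[OF that], of \<omega>] fibred_design_on[OF H fB[OF that], of \<omega>]
    by (cases "\<omega> \<in> B") simp_all
  then obtain R where R: "\<And>B. B \<in> \<S> \<Longrightarrow> good B (R B)" by metis
  define spec where "spec B p c \<longleftrightarrow> (if \<omega> \<notin> B then rgdd k {y\<in>tripled \<omega> B. fst y \<noteq> fst p} fst c (derived_blocks (R B) p)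
     else if p = (\<omega>,0) then rgdd k {y\<in>tripled \<omega> B. fst y \<noteq> \<omega>} fst c
        (derived_blocks (R B) (\<omega>,0) - {fibre \<omega> x - {(\<omega>,0)} | x. x \<in> B \<and> x \<noteq> \<omega>})
     else rgdd (Suc k) (tripled \<omega> B - {p}) id c (derived_blocks (R B) p) \<and> c (fibre \<omega> (fst p) - {p}) = k)" for B p c
  have "\<exists>c. spec B p c" if B: "B \<in> \<S>" and p: "p \<in> tripled \<omega> B" for B p
  proof (cases "\<omega> \<in> B")
    case True
    show ?thesis
    proof (cases "p = (\<omega>,0)")
      case p0: True
      then show ?thesis using R[OF B] True unfolding good_def spec_def by simp
    next
      case False
      then have "fst p \<noteq> \<omega>" using p by (auto simp: tripled_def)
      moreover have "(fst p, snd p) \<in> tripled \<omega> B" using p by simp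
      ultimately have "\<exists>c. rgdd (Suc k) (tripled \<omega> B - {(fst p, snd p)}) id c (derived_blocks (R B) (fst p, snd p)) \<and> c (fibre \<omega> (fst p) - {(fst p, snd p)}) = k"
        using R[OF B] True \<open>fst p \<noteq> \<omega>\<close> unfolding good_def by (simp only: if_True)
      then show ?thesis using True False unfolding spec_def by simp
    qed
  next
    case False
    then show ?thesis using R[OF B] p unfolding good_def spec_def by simp
  qed
  then obtain c where c: "\<And>B p. B \<in> \<S> \<Longrightarrow> p \<in> tripled \<omega> B \<Longrightarrow> spec B p (c B p)" by metis
  interpret tripling P \<omega> \<S> \<pi> q k R c
  proof
    show "resolvable_3design q P \<S> \<pi>" "\<omega> \<in> P" "3 \<le> card P" by fact+
  next
    fix B assume B: "B \<in> \<S>" "\<omega> \<in> B"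
    note RB = R[OF B(1), unfolded good_def]
    show "quad_design (tripled \<omega> B) id (R B)" using RB B(2) by simp
    show "fibre \<omega> x \<in> R B" if "x \<in> B" "x \<noteq> \<omega>" for x using RB B(2) that by simp
    have "(\<omega>,0) \<in> tripled \<omega> B" using B(2) by (simp add: tripled_def)
    then show "rgdd k {y\<in>tripled \<omega> B. fst y \<noteq> \<omega>} fst (c B (\<omega>,0))
            (derived_blocks (R B) (\<omega>,0) - {fibre \<omega> x - {(\<omega>,0)} | x. x \<in> B \<and> x \<noteq> \<omega>})"
      using c[OF B(1)] B(2) unfolding spec_def by simp
    show "rgdd (Suc k) (tripled \<omega> B - {(x,i)}) id (c B (x,i)) (derived_blocks (R B) (x,i))
            \<and> c B (x,i) (fibre \<omega> x - {(x,i)}) = k" if "(x,i) \<in> tripled \<omega> B" "x \<noteq> \<omega>" for x i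
      using c[OF B(1) that(1)] B(2) that(2) unfolding spec_def by simp
  next
    fix B assume B: "B \<in> \<S>" "\<omega> \<notin> B"
    note RB = R[OF B(1), unfolded good_def]
    show "quad_design (tripled \<omega> B) fst (R B)" using RB B(2) by simp
    show "rgdd k {y\<in>tripled \<omega> B. fst y \<noteq> fst p} fst (c B p) (derived_blocks (R B) p)" if "p \<in> tripled \<omega> B" for p
      using c[OF B(1) that] B(2) unfolding spec_def by simp
  qed
  show ?thesis using RDSQS_blocks by blast
qed

lemma card_tripled:
  assumes "finite P" "\<omega> \<in> P" shows "card (tripled \<omega> P) = 3 * (card P - 1) + 1"
proof -
  have "card ((P - {\<omega>}) \<times> {..<3::nat}) = 3 * (card P - 1)" using assms by (simp add: card_cartesian_product)
  moreover have "(\<omega>,0) \<notin> (P - {\<omega>}) \<times> {..<3::nat}" by simp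
  ultimately show ?thesis using assms(1) unfolding tripled_with[OF assms(2)] by simp
qed

text \<open>
  A block is coloured with the parallel class that contains it.
\<close>

lemma colouring_of_resolvable:
  assumes r: "resolvable Y \<A>"
  shows "\<exists>c :: 'a set \<Rightarrow> 'a set set. \<forall>T\<in>\<A>. \<forall>y\<in>Y. \<exists>!T'. T' \<in> \<A> \<and> c T' = c T \<and> y \<in> T'"
proof -
  obtain \<R> where \<R>: "partition_on \<A> \<R>" "\<And>C. C \<in> \<R> \<Longrightarrow> C \<subseteq> \<A> \<and> partition_on Y C"
    using r unfolding resolvable_def parallel_class_def by blast
  define c where "c T = (THE C. C \<in> \<R> \<and> T \<in> C)" for T
  have c_eq: "c T = C" if CT: "C \<in> \<R>" "T \<in> C" for T C
    unfolding c_def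
  proof (rule the_equality)
    show "C \<in> \<R> \<and> T \<in> C" using CT by simp
    fix C' assume "C' \<in> \<R> \<and> T \<in> C'"
    then show "C' = C" using \<R>(1) CT unfolding partition_on_def disjoint_def by blast
  qed
  have "\<exists>!T'. T' \<in> \<A> \<and> c T' = c T \<and> y \<in> T'" if T: "T \<in> \<A>" and y: "y \<in> Y" for T y
  proof -
    obtain C where C: "C \<in> \<R>" "T \<in> C" using \<R>(1) T unfolding partition_on_def by blast
    have cT: "c T = C" by (rule c_eq[OF C])
    have pC: "partition_on Y C" "C \<subseteq> \<A>" using \<R>(2)[OF C(1)] by auto
    obtain T' where T': "T' \<in> C" "y \<in> T'" using pC(1) y unfolding partition_on_def by blast
    show ?thesis
    proof (rule ex1I[of _ T'])
      show "T' \<in> \<A> \<and> c T' = c T \<and> y \<in> T'" using T' pC(2) c_eq[OF C(1) T'(1)] cT by blast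
      fix U assume U: "U \<in> \<A> \<and> c U = c T \<and> y \<in> U"
      obtain C' where C': "C' \<in> \<R>" "U \<in> C'" using \<R>(1) U unfolding partition_on_def by blast
      have "U \<in> C" using c_eq[OF C'] U cT C'(2) by simp
      then show "U = T'" using pC(1) T' U unfolding partition_on_def disjoint_def by blast
    qed
  qed
  then show ?thesis by blast
qed

lemma SQS_quad_design:
  assumes "steiner_quadruple_system v X \<B>" shows "quad_design X id \<B>"
  using assms unfolding steiner_quadruple_system_def quad_design_def by simp

lemma RDSQS_nat:
  fixes X :: "'a set"
  assumes "RDSQS v X \<B>" shows "\<exists>(Y :: nat set) \<C>. RDSQS v Y \<C>"
proof -
  have sqs: "steiner_quadruple_system v X \<B>" and res: "\<And>x. x \<in> X \<Longrightarrow> resolvable (X - {x}) (derived_blocks \<B> x)"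
    using assms by (auto simp: RDSQS_def)
  have fin: "finite X" "card X = v" and sub: "\<And>B. B \<in> \<B> \<Longrightarrow> B \<subseteq> X \<and> card B = 4" using sqs by (auto simp: steiner_quadruple_system_def)
  obtain f :: "'a \<Rightarrow> nat" where inj: "inj_on f X" using finite_imp_inj_to_nat_seg[OF fin(1)] by blast
  have idf: "id (f x) = id (f y) \<longleftrightarrow> id x = id y" if "x \<in> X" "y \<in> X" for x y using inj_on_eq_iff[OF inj that] by simp
  have tr1: "quad_design (f ` X) id (image f ` \<B>)"
    by (rule quad_design_transport(1)[OF SQS_quad_design[OF sqs] inj]) (rule idf)
  have tr2: "derived_blocks (image f ` \<B>) (f r) = image f ` derived_blocks \<B> r" if "r \<in> X" for r
    by (rule quad_design_transport(2)[where g' = id, OF SQS_quad_design[OF sqs] inj _ that]) (rule idf)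
  have "steiner_quadruple_system v (f ` X) (image f ` \<B>)"
    using tr1 card_image[OF inj] fin(2) unfolding quad_design_def steiner_quadruple_system_def by simp
  moreover have "resolvable (f ` X - {u}) (derived_blocks (image f ` \<B>) u)" if "u \<in> f ` X" for u
  proof -
    obtain x where x: "x \<in> X" "u = f x" using \<open>u \<in> f ` X\<close> by blast
    let ?D = "derived_blocks \<B> x" and ?Y = "X - {x}"
    have D: "T \<subseteq> ?Y \<and> T \<noteq> {}" if T: "T \<in> ?D" for T
    proof -
      obtain B where B: "B \<in> \<B>" "T = B - {x}" using T by (auto simp: derived_blocks_def)
      have "B \<noteq> {x}" "B \<noteq> {}" using sub[OF B(1)] by auto
      then show ?thesis using sub[OF B(1)] B(2) by blast
    qed
    have injY: "inj_on f ?Y" by (rule inj_on_subset[OF inj]) blast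
    obtain c :: "'a set \<Rightarrow> 'a set set" where c: "\<forall>T\<in>?D. \<forall>y\<in>?Y. \<exists>!T'. T' \<in> ?D \<and> c T' = c T \<and> y \<in> T'"
      using colouring_of_resolvable[OF res[OF x(1)]] by blast
    have inv: "the_inv_into ?Y f ` f ` T = T" if "T \<in> ?D" for T
    proof -
      have "the_inv_into ?Y f (f t) = t" if "t \<in> T" for t
        using the_inv_into_f_f[OF injY] D[OF \<open>T \<in> ?D\<close>] that by blast
      then show ?thesis by (simp add: image_image)
    qed
    have injD: "inj_on (image f) ?D" by (rule inj_on_inverseI[where g = "image (the_inv_into ?Y f)"]) (rule inv)
    have eq: "f ` X - {u} = f ` ?Y" "derived_blocks (image f ` \<B>) u = image f ` ?D"
      using inj_on_image_set_diff[OF inj, of X "{x}"] x tr2[OF x(1)] by simp_all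
    show ?thesis unfolding eq
    proof (rule resolvable_by_colouring[where c = "\<lambda>S. c (the_inv_into ?Y f ` S)"])
      show "S \<subseteq> f ` ?Y \<and> S \<noteq> {}" if "S \<in> image f ` ?D" for S using D that by blast
      fix S v assume "S \<in> image f ` ?D" "v \<in> f ` ?Y"
      then obtain T y where Ty: "T \<in> ?D" "S = f ` T" "y \<in> ?Y" "v = f y" by blast
      have "\<exists>!T'. T' \<in> ?D \<and> (c T' = c T \<and> y \<in> T')" using c Ty(1,3) by blast
      moreover have "(\<exists>!S'. S' \<in> image f ` ?D \<and> (c (the_inv_into ?Y f ` S') = c T \<and> f y \<in> S')) \<longleftrightarrow> (\<exists>!T'. T' \<in> ?D \<and> (c T' = c T \<and> y \<in> T'))"
      proof (rule ex1_image_iff[OF injD])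
        fix T' assume T': "T' \<in> ?D"
        have "f y \<in> f ` T' \<longleftrightarrow> y \<in> T'" using inj_on_image_mem_iff[OF injY Ty(3)] D[OF T'] by blast
        then show "(c (the_inv_into ?Y f ` f ` T') = c T \<and> f y \<in> f ` T') \<longleftrightarrow> (c T' = c T \<and> y \<in> T')" using inv[OF T'] by simp
      qed
      ultimately show "\<exists>!T'. T' \<in> image f ` ?D \<and> c (the_inv_into ?Y f ` T') = c (the_inv_into ?Y f ` S) \<and> v \<in> T'"
        using inv[OF Ty(1)] Ty(2,4) by simp
    qed
  qed
  ultimately show ?thesis unfolding RDSQS_def by blast
qed

lemma RDSQS_4: "RDSQS 4 {0..<4::nat} {{0..<4}}"
proof -
  have d: "derived_blocks {{0..<4}} x = {{0..<4} - {x}}" if "x \<in> {0..<4::nat}" for x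
    using that by (auto simp: derived_blocks_def)
  have "resolvable Y {Y}" if "Y \<noteq> {}" for Y :: "nat set"
    by (rule resolvable_by_colouring[where c = "\<lambda>_. ()"]) (use that in auto)
  moreover have "{0..<4} - {x} \<noteq> {}" for x :: nat
  proof
    assume "{0..<4} - {x} = {}"
    then have "{0..<4} \<subseteq> {x}" by blast
    then have "card {0..<4::nat} \<le> card {x}" by (rule card_mono[rotated]) simp
    then show False by simp
  qed
  ultimately show ?thesis unfolding RDSQS_def steiner_quadruple_system_def using d by auto
qed

lemma RDSQS_from_fields:
  assumes H: "fibred_design (Suc q) k" and Q: "fibred_SQS q k" and t: "field_tower K F" "card K = q" "card F = q ^ n"
    and n: "2 \<le> q ^ n"
  shows "\<exists>(X :: nat set) \<B>. RDSQS (3 * q ^ n + 1) X \<B>"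
proof -
  interpret field_tower K F by (rule t(1))
  have cP: "card points = Suc (q ^ n)" using card_points t(3) by simp
  obtain \<B> where "RDSQS (card (tripled None points)) (tripled None points) \<B>"
    using tripling_exists[OF H Q spherical_geometry[unfolded t(2)], of None] cP n by (auto simp: points_def)
  moreover have "card (tripled None points) = 3 * q ^ n + 1"
    using card_tripled[of points None] cP fin by (simp add: points_def)
  ultimately show ?thesis using RDSQS_nat by metis
qed

lemma RDSQS_of_characteristic:
  assumes q: "CHAR('a::alg_closed_field) = q" "prime q"
    and H: "fibred_design (Suc q) k" and Q: "fibred_SQS q k"
  shows "\<exists>(X :: nat set) \<B>. RDSQS (3 * q ^ n + 1) X \<B>"
proof (cases "n = 0")
  case True
  then show ?thesis using RDSQS_4 by auto
next
  case False
  have p: "prime CHAR('a)" using q by simp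
  let ?K = "roots_of_frobenius (q ^ 1) :: 'a set" and ?F = "roots_of_frobenius (q ^ n) :: 'a set"
  have card: "card ?K = q" "card ?F = q ^ n"
    using card_fixed_frobenius[OF p, of 1] card_fixed_frobenius[OF p, of n] False q(1) by simp_all
  have q2: "2 \<le> q ^ n" using prime_ge_2_nat[OF q(2)] self_le_power[of q n] False by simp
  have "0 < card ?F" unfolding card(2) using q2 by linarith
  then have "finite ?F" by (rule card_ge_0_finite)
  have "field_tower ?K ?F"
  proof
    show "?K \<subseteq> ?F" by (rule frobenius_mono)
    show "finite ?F" by fact
  qed (use frobenius_closed[OF p, where n = n] frobenius_closed[OF p, where n = 1] q(1) in simp_all)
  then show ?thesis by (rule RDSQS_from_fields[OF H Q _ card q2])
qed

theorem theorem2p7: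
  fixes n :: nat
  shows "(\<exists>(X :: nat set) \<B>. RDSQS (3 * 7 ^ n + 1) X \<B>) \<and>
         (\<exists>(X :: nat set) \<B>. RDSQS (3 * 13 ^ n + 1) X \<B>)"
proof
  show "\<exists>(X :: nat set) \<B>. RDSQS (3 * 7 ^ n + 1) X \<B>"
    by (rule RDSQS_of_characteristic[where 'a = "seven mod_ring alg_closure" and k = 9])
      (simp_all add: CHAR_mod_ring card_seven fibred_design_8 fibred_SQS_7)
  show "\<exists>(X :: nat set) \<B>. RDSQS (3 * 13 ^ n + 1) X \<B>"
    by (rule RDSQS_of_characteristic[where 'a = "thirteen mod_ring alg_closure" and k = 18])
      (simp_all add: CHAR_mod_ring card_thirteen fibred_design_14 fibred_SQS_13)
qed

end
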